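(* Let $q>2$ be an even integer and let $n,m\ge 1$ be integers. Suppose there exist orthogonal multiplications $f:\mathbb{R}^{q/2}\times\mathbb{R}^{q/2}\to\mathbb{R}^n$ and $g:\mathbb{R}^2\times\mathbb{R}^{n+1}\to\mathbb{R}^{m+1}$. Let $\phi:S^1\to S^1\subset\mathbb{R}^2$ be $\phi=e^{i\theta}$ (the identity map of the unit circle), let $\psi:S^{q-1}\to S^n$ be the map $$\psi(x,y)=(2f(x,y),\,|x|^2-|y|^2),\qquad (x,y)\in\mathbb{R}^{q/2}\times\mathbb{R}^{q/2},\ |x|^2+|y|^2=1,$$ and let $g(\phi,\psi):S^1\times S^{q-1}\to S^m$ be the map $(x,y)\mapsto g(\phi(x),\psi(y))$. Then the homotopy class $[F_{g(\phi,\psi)}]\in\pi_{q+1}(S^{m+1})$ of the Hopf construction $F_{g(\phi,\psi)}:S^{q+1}\to S^{m+1}$ has a harmonic representative, i.e. there is a harmonic map $S^{q+1}\to S^{m+1}$ (between round unit spheres) homotopic to $F_{g(\phi,\psi)}$.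
   Context: An orthogonal multiplication is a bilinear map $f:\mathbb{R}^k\times\mathbb{R}^l\to\mathbb{R}^n$ such that $|f(x,y)|=|x||y|$ for all $x\in\mathbb{R}^k$, $y\in\mathbb{R}^l$. The Hopf construction on an orthogonal multiplication $f$ is the map $F_f:\mathbb{R}^k\times\mathbb{R}^l\to\mathbb{R}^{n+1}$, $(x,y)\mapsto(2f(x,y),|x|^2-|y|^2)$; it restricts to a map $S^{k+l-1}\to S^n$. For a map $h:S^1\times S^{q-1}\to S^m$ (such as $h=g(\phi,\psi)$), the Hopf construction $F_h:S^{q+1}\to S^{m+1}$ is given by $$F_h(\sin t\cdot x,\cos t\cdot y)=(2\sin t\cos t\,h(x,y),\ \sin^2t-\cos^2t),\qquad x\in S^1,\ y\in S^{q-1},\ t\in[0,\tfrac{\pi}{2}],$$ where $S^{q+1}$ is the unit sphere of $\mathbb{R}^2\times\mathbb{R}^q$. *)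

theory Defs
  imports "HOL-Analysis.Analysis"
begin

definition orthogonal_multiplication ::
  "('a::euclidean_space \<Rightarrow> 'b::euclidean_space \<Rightarrow> 'c::euclidean_space) \<Rightarrow> bool" where
  "orthogonal_multiplication f \<longleftrightarrow>
     bilinear f \<and> (\<forall>x y. norm (f x y) = norm x * norm y)"

definition hopf_of_mult ::
  "('a::euclidean_space \<Rightarrow> 'b::euclidean_space \<Rightarrow> 'c::euclidean_space) \<Rightarrow> 'a \<times> 'b \<Rightarrow> 'c \<times> real" where
  "hopf_of_mult f = (\<lambda>(x, y). (2 *\<^sub>R f x y, (norm x)\<^sup>2 - (norm y)\<^sup>2))"

text \<open>
  The Hopf construction on a map \<open>h\<close> defined on a product of unit spheres. A point of the unit
  sphere of the product is \<open>(u, v) = (sin t x, cos t y)\<close> with \<open>sin t = norm u\<close>, \<open>cos t = norm v\<close>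
  and, where these are nonzero, \<open>x = sgn u\<close>, \<open>y = sgn v\<close>. If \<open>u\<close> or \<open>v\<close> vanishes, \<open>x\<close> or \<open>y\<close>
  is undetermined, but the first component is then zero whatever the value of \<open>h\<close>. The lemma
  below is the usual parametrised description.
\<close>

definition hopf_construction ::
  "('a::euclidean_space \<Rightarrow> 'b::euclidean_space \<Rightarrow> 'c::euclidean_space) \<Rightarrow> 'a \<times> 'b \<Rightarrow> 'c \<times> real" where
  "hopf_construction h =
     (\<lambda>(u, v). ((2 * norm u * norm v) *\<^sub>R h (sgn u) (sgn v), (norm u)\<^sup>2 - (norm v)\<^sup>2))"

lemma hopf_construction_param:
  assumes "norm x = 1" "norm y = 1" "0 \<le> t" "t \<le> pi / 2"
  shows "hopf_construction h (sin t *\<^sub>R x, cos t *\<^sub>R y) =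
    ((2 * sin t * cos t) *\<^sub>R h x y, (sin t)\<^sup>2 - (cos t)\<^sup>2)"
proof -
  have s: "sin t \<ge> 0" and c: "cos t \<ge> 0"
    using assms by (auto intro!: sin_ge_zero cos_ge_zero)
  have "sgn x = x" "sgn y = y"
    using assms by (simp_all add: sgn_div_norm)
  then show ?thesis
    using assms s c
    by (cases "sin t = 0 \<or> cos t = 0") (auto simp: hopf_construction_def sgn_scaleR)
qed

text \<open>
  \<open>Ck_on k f U\<close> is \<open>k\<close>-fold continuous differentiability, intended for open subsets \<open>U\<close> of a
  Euclidean space.
\<close>

primrec Ck_on ::
  "nat \<Rightarrow> ('a::euclidean_space \<Rightarrow> 'b::euclidean_space) \<Rightarrow> 'a set \<Rightarrow> bool" where
  "Ck_on 0 f U \<longleftrightarrow> continuous_on U f"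
| "Ck_on (Suc k) f U \<longleftrightarrow>
     (\<forall>x\<in>U. f differentiable (at x)) \<and> (\<forall>v. Ck_on k (\<lambda>x. frechet_derivative f (at x) v) U)"

definition smooth_map_on ::
  "'a::euclidean_space set \<Rightarrow> ('a \<Rightarrow> 'b::euclidean_space) \<Rightarrow> bool" where
  "smooth_map_on S f \<longleftrightarrow>
     (\<exists>U g. open U \<and> S \<subseteq> U \<and> (\<forall>k. Ck_on k g U) \<and> (\<forall>x\<in>S. g x = f x))"

definition sphere_tangent_space :: "'a::euclidean_space \<Rightarrow> 'a set" where
  "sphere_tangent_space x = {v. v \<bullet> x = 0}"

definition orthonormal_basis_of :: "'a::euclidean_space set \<Rightarrow> 'a set \<Rightarrow> bool" where
  "orthonormal_basis_of V B \<longleftrightarrow>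
     B \<subseteq> V \<and> span B = V \<and> pairwise orthogonal B \<and> (\<forall>e\<in>B. norm e = 1)"

text \<open>
  The covariant acceleration at time \<open>0\<close> of a curve \<open>c\<close> in the unit sphere: the Levi-Civita
  connection of the round metric is the tangential part of the derivative in the ambient space.
\<close>

definition sphere_acceleration :: "(real \<Rightarrow> 'b::euclidean_space) \<Rightarrow> 'b" where
  "sphere_acceleration c =
     (let a = vector_derivative (\<lambda>s. vector_derivative c (at s)) (at 0)
      in a - (a \<bullet> c 0) *\<^sub>R c 0)"

text \<open>
  The second fundamental form \<open>(\<nabla>du)(e, e)\<close> at \<open>x\<close> of a map \<open>u\<close> between unit spheres, for a unit
  tangent vector \<open>e\<close>. Along a geodesic \<open>\<gamma>\<close> the term \<open>du(\<nabla>\<^bsub>\<gamma>'\<^esub> \<gamma>')\<close> vanishes, so it is the covariant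
  acceleration of \<open>u \<circ> \<gamma>\<close>, where \<open>\<gamma>\<close> is the great circle through \<open>x\<close> with velocity \<open>e\<close>.
\<close>

definition second_fundamental_form ::
  "('a::euclidean_space \<Rightarrow> 'b::euclidean_space) \<Rightarrow> 'a \<Rightarrow> 'a \<Rightarrow> 'b" where
  "second_fundamental_form u x e = sphere_acceleration (\<lambda>t. u (cos t *\<^sub>R x + sin t *\<^sub>R e))"

text \<open>
  Harmonic maps between round unit spheres: smooth maps whose tension field, the trace of the
  second fundamental form, vanishes identically. The trace does not depend on the orthonormal
  basis \<open>B\<close> of the tangent space.
\<close>

definition harmonic_sphere_map ::
  "('a::euclidean_space \<Rightarrow> 'b::euclidean_space) \<Rightarrow> bool" where
  "harmonic_sphere_map u \<longleftrightarrow>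
     smooth_map_on (sphere 0 1) u \<and> u ` sphere 0 1 \<subseteq> sphere 0 1 \<and>
     (\<forall>x\<in>sphere 0 1. \<forall>B. orthonormal_basis_of (sphere_tangent_space x) B \<longrightarrow>
        (\<Sum>e\<in>B. second_fundamental_form u x e) = 0)"

end

theory Submission imports Defs begin

text \<open>
Write \<open>k = q/2\<close>. A point of the sphere in \<open>\<real>\<^sup>2 \<times> \<real>\<^sup>q\<close> is \<open>(sin t x, cos t y)\<close> with unit vectors
\<open>x\<close>, \<open>y\<close>, and the Hopf construction on \<open>h(x, y) = g(x, \<psi>(y))\<close> is the member \<open>\<alpha>(t) = 2t\<close> of the family of maps

  \<open>u\<^sub>\<alpha>(sin t x, cos t y) = (sin \<alpha>(t) h(x, y), - cos \<alpha>(t))\<close>, with \<open>\<alpha>(0) = 0\<close>, \<open>\<alpha>(\<pi>/2) = \<pi>\<close> and \<open>0 < \<alpha> < \<pi>\<close> in between.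

All members are homotopic, because the values of two of them at a point are antipodal nowhere. A harmonic
member is found as follows. Up to a factor, \<open>h\<close> is the polynomial \<open>N(x, y) = g(x, H(y))\<close>, where \<open>H\<close> is the
Hopf map of \<open>f\<close>; \<open>N\<close> is linear in \<open>x\<close>, quadratic in \<open>y\<close>, harmonic, and \<open>|N| = |x| |y|\<^sup>2\<close>. Hence
the tension field of \<open>u\<^sub>\<alpha>\<close> vanishes iff \<open>\<alpha>\<close> solves one ordinary differential equation. With
\<open>\<rho> = sin\<^sup>2 t\<close> and the parameter \<open>s = ln (\<rho> / (1 - \<rho>))\<close>, which runs over the whole line, it reads

  \<open>\<alpha>'' = (k - 1) \<rho> \<alpha>' + (1 + (4k - 1) \<rho>)/4 sin \<alpha> cos \<alpha>\<close>,

a pendulum with unstable equilibria \<open>0\<close> and \<open>\<pi>\<close> that is undamped at \<open>-\<infinity>\<close> and negatively damped at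
\<open>+\<infinity>\<close>. What is needed is a solution that joins \<open>0\<close> to \<open>\<pi>\<close>.

The solution comes from shooting. Put \<open>Z = (1 - \<rho>)\<^bsup>k-1\<^esup> \<alpha>'\<close>; then
\<open>Z\<^sup>2 - g sin\<^sup>2 \<alpha>\<close> has derivative \<open>- g' sin\<^sup>2 \<alpha>\<close>, where \<open>g\<close> rises from \<open>1/4\<close> at \<open>-\<infinity>\<close> to
a maximum and then falls to \<open>0\<close>. If \<open>\<alpha>\<close> increases from near \<open>0\<close> and reaches \<open>\<pi>/2\<close> too late, the
decrease of \<open>g\<close> outweighs its increase, this energy becomes positive, and \<open>\<alpha>\<close> runs through \<open>\<pi>\<close>
(\<open>late_crossing\<close>). If \<open>\<alpha>\<close> reaches \<open>\<pi>/2\<close> too early, \<open>\<pi> - \<alpha>\<close> decays like \<open>e\<^bsup>-s/2\<^esup>\<close> while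
\<open>g'\<close> grows like \<open>e\<^sup>s\<close>, the energy lost is proportional to the time spent near \<open>\<pi>\<close>, and \<open>\<alpha>\<close> turns back
before \<open>\<pi>\<close> (\<open>early_crossing\<close>). Between the two, connectedness gives a solution on a half-line that
increases for ever below \<open>\<pi>\<close> (\<open>shooting\<close>). Both estimates confine its crossing of \<open>\<pi>/2\<close> to a
fixed interval, so the starting point can be moved to \<open>-\<infinity>\<close> by compactness (\<open>entire_solution\<close>).

It remains to see that \<open>u\<^sub>\<alpha>\<close> is smooth where \<open>x\<close> or \<open>y\<close> vanishes. There the equation has regular
singular points. The function \<open>|tan \<alpha>|\<close> is a subsolution of the linearised equation, of which
\<open>\<surd>\<rho>\<close> and \<open>1 - \<rho>\<close> are supersolutions; comparison shows that \<open>\<alpha>/\<surd>\<rho>\<close> and \<open>(\<pi> - \<alpha>)/(1 - \<rho>)\<close>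
have limits (\<open>quotient_limit_bot\<close>, \<open>quotient_limit_top\<close>), and an integral formula for the derivative
then gives smoothness of all orders by induction (\<open>singular_regularity\<close>).
\<close>

section \<open>Differential equations with a global Lipschitz bound\<close>

lemma integral_from_0_has_vector_derivative:
  fixes h :: "real \<Rightarrow> 'a::banach"
  assumes "continuous_on UNIV h" "0 \<le> t"
  shows "((\<lambda>u. integral {0..u} h) has_vector_derivative h t) (at t within {0..})"
proof -
  have "((\<lambda>u. integral {0..u} h) has_vector_derivative h t) (at t within {0..t+1})"
    by (rule integral_has_vector_derivative)
      (use assms in \<open>auto intro: continuous_on_subset\<close>)
  moreover have "at t within {0..t+1} = at t within {0..}"
    by (rule at_within_nhd[of t "{..<t+1}"]) auto
  ultimately show ?thesis by simp
qed

text \<open>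
Picard iteration is a contraction on the whole half-line once the solution is weighted by \<open>e\<^bsup>-2Lt\<^esup>\<close>:
the unknown is the bounded continuous function \<open>z(t) = e\<^bsup>-2Lt\<^esup> y(t)\<close>, and the factor \<open>\<integral> L e\<^bsup>2Ls\<^esup> ds \<le> e\<^bsup>2Lt\<^esup>/2\<close>
gives the constant \<open>1/2\<close>. As \<open>f t 0 = 0\<close>, the field grows at most linearly, so the iteration preserves boundedness.
\<close>

lemma ode_exists_forward:
  fixes f :: "real \<Rightarrow> 'a::euclidean_space \<Rightarrow> 'a"
  assumes cont: "continuous_on UNIV (\<lambda>(t, y). f t y)"
    and lip: "\<And>t y z. norm (f t y - f t z) \<le> L * norm (y - z)"
    and zero: "\<And>t. f t 0 = 0" and L: "L > 0"
  obtains y where "y 0 = y0"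
    and "\<And>t. 0 \<le> t \<Longrightarrow> (y has_vector_derivative f t (y t)) (at t within {0..})"
proof -
  define K where "K = 2 * L"
  have K: "K > 0" using L by (simp add: K_def)
  define h where "h z s = f s (exp (K * s) *\<^sub>R z s)" for z :: "real \<Rightarrow> 'a" and s
  define T where "T z t = exp (- K * max 0 t) *\<^sub>R (y0 + integral {0..max 0 t} (h z))"
    for z and t :: real
  have fcont: "continuous_on S (\<lambda>s. f (a s) (b s))"
    if "continuous_on S a" "continuous_on S b" for S :: "real set" and a b
    using continuous_on_compose2[OF cont, of S "\<lambda>s. (a s, b s)"] that
    by (auto intro: continuous_on_Pair)
  have hcont: "continuous_on UNIV (h z)" if "continuous_on UNIV z" for z
    unfolding h_def by (intro fcont continuous_intros that)
  have hint: "h z integrable_on {0..t}" if "continuous_on UNIV z" for z t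
    by (rule integrable_continuous_interval) (use hcont[OF that] in \<open>auto intro: continuous_on_subset\<close>)
  have expint: "((\<lambda>s. C * exp (K * s)) has_integral (C * (exp (K * t) - 1) / K)) {0..t}"
    if "0 \<le> t" for C t
  proof -
    have "((\<lambda>s. C * exp (K * s)) has_integral (C * exp (K * t) / K - C * exp (K * 0) / K)) {0..t}"
      by (rule fundamental_theorem_of_calculus[OF that])
        (use K in \<open>auto intro!: derivative_eq_intros simp flip: has_real_derivative_iff_has_vector_derivative\<close>)
    then show ?thesis by (simp add: diff_divide_distrib right_diff_distrib)
  qed
  have Tcont: "continuous_on UNIV (T z)" if "continuous_on UNIV z" for z
  proof -
    have "continuous_on {0..} (\<lambda>u. integral {0..u} (h z))"
      by (rule continuous_on_vector_derivative[OF integral_from_0_has_vector_derivative])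
        (use hcont[OF that] in auto)
    then have "continuous_on UNIV (\<lambda>t. integral {0..max 0 t} (h z))"
      by (rule continuous_on_compose2) (auto intro!: continuous_intros)
    then show ?thesis unfolding T_def by (intro continuous_intros)
  qed
  have bnd: "exp (- K * max 0 t) * (C * (exp (K * max 0 t) - 1) / K) \<le> C / K"
    if "C \<ge> 0" for C t
  proof -
    have "exp (- K * max 0 t) * (C * (exp (K * max 0 t) - 1) / K) = C / K * (1 - exp (- K * max 0 t))"
      using K by (simp add: field_simps exp_minus)
    also have "\<dots> \<le> C / K * 1" by (rule mult_left_mono) (use that K in auto)
    finally show ?thesis by simp
  qed
  have Tmem: "T (apply_bcontfun z) \<in> bcontfun" for z :: "real \<Rightarrow>\<^sub>C 'a"
  proof -
    obtain N where N: "\<And>t. norm (apply_bcontfun z t) \<le> N"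
      using bounded_apply_bcontfun[of z] by (auto simp: bounded_iff)
    have N0: "N \<ge> 0" using N[of 0] norm_ge_zero order_trans by blast
    show ?thesis
    proof (rule bcontfun_normI)
      show "continuous_on UNIV (T (apply_bcontfun z))" by (rule Tcont) simp
      fix t :: real
      let ?t = "max 0 t"
      have "norm (integral {0..?t} (h (apply_bcontfun z))) \<le> integral {0..?t} (\<lambda>s. L * N * exp (K * s))"
      proof (rule integral_norm_bound_integral)
        show "h (apply_bcontfun z) integrable_on {0..?t}" by (rule hint) simp
        show "(\<lambda>s. L * N * exp (K * s)) integrable_on {0..?t}" using expint[of ?t "L * N"] by auto
        fix s
        have "norm (h z s) \<le> L * norm (exp (K * s) *\<^sub>R z s)"
          using lip[of s "exp (K * s) *\<^sub>R z s" 0] by (simp add: zero h_def)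
        also have "\<dots> \<le> L * (exp (K * s) * N)"
          using L N[of s] by (intro mult_left_mono) auto
        finally show "norm (h z s) \<le> L * N * exp (K * s)" by (simp add: ac_simps)
      qed
      also have "\<dots> = L * N * (exp (K * ?t) - 1) / K"
        using expint[of ?t "L * N"] by (intro integral_unique) auto
      finally have I: "norm (integral {0..?t} (h z)) \<le> L * N * (exp (K * ?t) - 1) / K" .
      have "norm (T z t) \<le> exp (- K * ?t) * (norm y0 + norm (integral {0..?t} (h z)))"
        unfolding T_def using norm_triangle_ineq by (simp add: mult_left_mono)
      also have "\<dots> \<le> exp (- K * ?t) * (norm y0 + L * N * (exp (K * ?t) - 1) / K)"
        by (intro mult_left_mono add_left_mono I) auto
      also have "\<dots> = exp (- K * ?t) * norm y0 + exp (- K * ?t) * (L * N * (exp (K * ?t) - 1) / K)"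
        by (simp add: distrib_left)
      also have "\<dots> \<le> 1 * norm y0 + L * N / K"
        by (intro add_mono mult_right_mono bnd) (use K L N0 in auto)
      finally show "norm (T z t) \<le> 1 * norm y0 + L * N / K" .
    qed
  qed
  define TC where "TC z = Bcontfun (T (apply_bcontfun z))" for z :: "real \<Rightarrow>\<^sub>C 'a"
  have TC: "apply_bcontfun (TC z) = T (apply_bcontfun z)" for z
    unfolding TC_def using Tmem by (rule Bcontfun_inverse)
  have "\<exists>!z. TC z = z"
  proof (rule banach_fix_type)
    show "0 \<le> (1/2::real)" "(1/2::real) < 1" by auto
    show "\<forall>z w. dist (TC z) (TC w) \<le> 1/2 * dist z w"
    proof (intro allI dist_bound)
      fix z w :: "real \<Rightarrow>\<^sub>C 'a" and t :: real
      let ?t = "max 0 t" and ?D = "dist z w"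
      have "norm (integral {0..?t} (\<lambda>s. h z s - h w s)) \<le> integral {0..?t} (\<lambda>s. L * ?D * exp (K * s))"
      proof (rule integral_norm_bound_integral)
        show "(\<lambda>s. h z s - h w s) integrable_on {0..?t}"
          by (intro integrable_diff hint) auto
        show "(\<lambda>s. L * ?D * exp (K * s)) integrable_on {0..?t}" using expint[of ?t "L * ?D"] by auto
        fix s
        have "norm (h z s - h w s) \<le> L * norm (exp (K * s) *\<^sub>R z s - exp (K * s) *\<^sub>R w s)"
          unfolding h_def by (rule lip)
        also have "\<dots> = L * (exp (K * s) * dist (z s) (w s))"
          by (simp add: dist_norm flip: scaleR_diff_right)
        also have "\<dots> \<le> L * (exp (K * s) * ?D)"
          using L dist_bounded by (intro mult_left_mono) auto
        finally show "norm (h z s - h w s) \<le> L * ?D * exp (K * s)" by (simp add: ac_simps)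
      qed
      also have "\<dots> = L * ?D * (exp (K * ?t) - 1) / K"
        using expint[of ?t "L * ?D"] by (intro integral_unique) auto
      also have "integral {0..?t} (\<lambda>s. h z s - h w s) = integral {0..?t} (h z) - integral {0..?t} (h w)"
        by (intro integral_diff hint) auto
      finally have I: "norm (integral {0..?t} (h z) - integral {0..?t} (h w)) \<le> L * ?D * (exp (K * ?t) - 1) / K" .
      have "dist (TC z t) (TC w t) = exp (- K * ?t) * norm (integral {0..?t} (h z) - integral {0..?t} (h w))"
        by (simp add: TC T_def dist_norm flip: scaleR_diff_right)
      also have "\<dots> \<le> exp (- K * ?t) * (L * ?D * (exp (K * ?t) - 1) / K)"
        by (intro mult_left_mono I) auto
      also have "\<dots> \<le> L * ?D / K" by (rule bnd) (use L in auto)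
      finally show "dist (TC z t) (TC w t) \<le> 1/2 * ?D" using L by (simp add: K_def)
    qed
  qed
  then obtain z where "TC z = z" by blast
  then have z: "T z t = z t" for t using TC[of z] by metis
  define y where "y t = exp (K * t) *\<^sub>R z t" for t
  have y: "y t = y0 + integral {0..t} (h z)" if "t \<ge> 0" for t
    using that z[of t, symmetric] by (simp add: y_def T_def flip: exp_add)
  have hz: "h z s = f s (y s)" for s by (simp add: h_def y_def)
  show ?thesis
  proof
    show "y 0 = y0" using y[of 0] by simp
    fix t :: real assume t: "0 \<le> t"
    have "((\<lambda>t. y0 + integral {0..t} (h z)) has_vector_derivative h z t) (at t within {0..})"
      using integral_from_0_has_vector_derivative[OF hcont[of z] t]
      by (auto intro!: derivative_eq_intros)
    then show "(y has_vector_derivative f t (y t)) (at t within {0..})"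
      unfolding hz by (rule has_vector_derivative_transform[rotated 2]) (use t y in \<open>auto simp flip: hz\<close>)
  qed
qed

text \<open>
The backward half of the solution is the forward solution of the time-reversed field.
\<close>

lemma ode_exists:
  fixes f :: "real \<Rightarrow> 'a::euclidean_space \<Rightarrow> 'a"
  assumes cont: "continuous_on UNIV (\<lambda>(t, y). f t y)"
    and lip: "\<And>t y z. norm (f t y - f t z) \<le> L * norm (y - z)"
    and zero: "\<And>t. f t 0 = 0" and L: "L > 0"
  obtains y where "y t0 = y0" and "\<And>t. (y has_vector_derivative f t (y t)) (at t)"
proof -
  have ct: "continuous_on UNIV (\<lambda>(t, y). c *\<^sub>R f (t0 + c * t) y)" for c :: real
  proof -
    have "continuous_on UNIV (\<lambda>p. (t0 + c * fst p, snd p :: 'a))"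
      by (intro continuous_intros)
    then have "continuous_on UNIV (\<lambda>p. f (t0 + c * fst p) (snd p))"
      using continuous_on_compose2[OF cont, of UNIV "\<lambda>p. (t0 + c * fst p, snd p)"] by auto
    then show ?thesis unfolding case_prod_unfold by (intro continuous_intros)
  qed
  have lp: "norm (c *\<^sub>R f (t0 + c * t) y - c *\<^sub>R f (t0 + c * t) z) \<le> L * norm (y - z)"
    if "\<bar>c\<bar> = 1" for c t y z
    using lip[of "t0 + c * t" y z] that by (simp flip: scaleR_diff_right)
  obtain p where p: "p 0 = y0"
      "\<And>t. 0 \<le> t \<Longrightarrow> (p has_vector_derivative 1 *\<^sub>R f (t0 + 1 * t) (p t)) (at t within {0..})"
    using ode_exists_forward[OF ct lp, of 1 y0] zero L by auto
  obtain m where m: "m 0 = y0"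
      "\<And>t. 0 \<le> t \<Longrightarrow> (m has_vector_derivative (-1) *\<^sub>R f (t0 + (-1) * t) (m t)) (at t within {0..})"
    using ode_exists_forward[OF ct lp, of "-1" y0] zero L by auto
  define y where "y t = (if t \<le> t0 then m (t0 - t) else p (t - t0))" for t
  have yp: "y t = p (t - t0)" if "t0 \<le> t" for t using that by (auto simp: y_def p m)
  have ym: "y t = m (t0 - t)" if "t \<le> t0" for t using that by (auto simp: y_def p m)
  have R: "(y has_vector_derivative f t (y t)) (at t within {t0..})" if "t0 \<le> t" for t
  proof -
    have "((p \<circ> (\<lambda>t. t - t0)) has_vector_derivative (1 *\<^sub>R (f t (p (t - t0))))) (at t within {t0..})"
    proof (rule vector_diff_chain_within)
      show "((\<lambda>t. t - t0) has_vector_derivative 1) (at t within {t0..})"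
        by (auto intro!: derivative_eq_intros)
      show "(p has_vector_derivative f t (p (t - t0))) (at (t - t0) within (\<lambda>t. t - t0) ` {t0..})"
        by (rule has_vector_derivative_within_subset[OF p(2)[of "t - t0", simplified]]) (use that in auto)
    qed
    then show ?thesis
      using that by (auto simp: yp o_def intro: has_vector_derivative_transform[rotated 2])
  qed
  have Lf: "(y has_vector_derivative f t (y t)) (at t within {..t0})" if "t \<le> t0" for t
  proof -
    have "((m \<circ> (\<lambda>t. t0 - t)) has_vector_derivative ((-1) *\<^sub>R (- f t (m (t0 - t))))) (at t within {..t0})"
    proof (rule vector_diff_chain_within)
      show "((\<lambda>t. t0 - t) has_vector_derivative -1) (at t within {..t0})"
        by (auto intro!: derivative_eq_intros)
      show "(m has_vector_derivative - f t (m (t0 - t))) (at (t0 - t) within (\<lambda>t. t0 - t) ` {..t0})"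
        by (rule has_vector_derivative_within_subset[OF m(2)[of "t0 - t", simplified]]) (use that in auto)
    qed
    then show ?thesis
      using that by (auto simp: ym o_def intro: has_vector_derivative_transform[rotated 2])
  qed
  show ?thesis
  proof
    show "y t0 = y0" by (simp add: y_def m)
    fix t
    consider "t < t0" | "t = t0" | "t > t0" by linarith
    then show "(y has_vector_derivative f t (y t)) (at t)"
    proof cases
      case 1
      have "at t within {..t0} = at t" by (rule at_within_interior) (use 1 in auto)
      then show ?thesis using Lf[of t] 1 by simp
    next
      case 3
      have "at t within {t0..} = at t" by (rule at_within_interior) (use 3 in auto)
      then show ?thesis using R[of t] 3 by simp
    next
      case 2
      have "UNIV = {..t0} \<union> {t0..}" by auto
      then show ?thesis using Lf[of t] R[of t] 2
        unfolding has_vector_derivative_def has_derivative_within[of _ _ t]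
        by (auto intro: Lim_Un_univ)
    qed
  qed
qed

lemma nondecreasing_of_deriv:
  fixes f :: "real \<Rightarrow> real"
  assumes "a \<le> b" "\<And>x. \<lbrakk>a \<le> x; x \<le> b\<rbrakk> \<Longrightarrow> (f has_real_derivative f' x) (at x)"
    "\<And>x. \<lbrakk>a \<le> x; x \<le> b\<rbrakk> \<Longrightarrow> f' x \<ge> 0"
  shows "f a \<le> f b"
  using DERIV_nonneg_imp_nondecreasing[of a b f] assms by blast

lemma nonincreasing_of_deriv:
  fixes f :: "real \<Rightarrow> real"
  assumes "a \<le> b" "\<And>x. \<lbrakk>a \<le> x; x \<le> b\<rbrakk> \<Longrightarrow> (f has_real_derivative f' x) (at x)"
    "\<And>x. \<lbrakk>a \<le> x; x \<le> b\<rbrakk> \<Longrightarrow> f' x \<le> 0"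
  shows "f b \<le> f a"
  using DERIV_nonpos_imp_nonincreasing[of a b f] assms by blast

text \<open>
Gronwall's inequality for \<open>|y - z|\<^sup>2\<close>, which also contains uniqueness.
\<close>

lemma ode_dependence:
  fixes f :: "real \<Rightarrow> 'a::euclidean_space \<Rightarrow> 'a"
  assumes lip: "\<And>t y z. norm (f t y - f t z) \<le> L * norm (y - z)"
    and y: "\<And>t. (y has_vector_derivative f t (y t)) (at t)"
    and z: "\<And>t. (z has_vector_derivative f t (z t)) (at t)"
  shows "norm (y t - z t) \<le> exp (L * \<bar>t - t0\<bar>) * norm (y t0 - z t0)"
proof -
  define d where "d t = (y t - z t) \<bullet> (y t - z t)" for t
  define d' where "d' t = 2 * ((y t - z t) \<bullet> (f t (y t) - f t (z t)))" for t
  have dd: "(d has_real_derivative d' t) (at t)" for t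
    unfolding d_def d'_def has_field_derivative_def
    using y[of t] z[of t] unfolding has_vector_derivative_def
    by (auto intro!: derivative_eq_intros simp: inner_commute algebra_simps)
  have d'le: "\<bar>d' t\<bar> \<le> 2 * L * d t" for t
  proof -
    have "\<bar>d' t\<bar> \<le> 2 * (norm (y t - z t) * norm (f t (y t) - f t (z t)))"
      unfolding d'_def using Cauchy_Schwarz_ineq2 by (auto simp: abs_mult)
    also have "\<dots> \<le> 2 * (norm (y t - z t) * (L * norm (y t - z t)))"
      by (intro mult_left_mono lip) auto
    also have "\<dots> = 2 * L * d t" by (simp add: d_def dot_square_norm power2_eq_square)
    finally show ?thesis .
  qed
  have "d t \<le> exp (2 * L * \<bar>t - t0\<bar>) * d t0"
  proof (cases "t0 \<le> t")
    case True
    have "exp (- 2 * L * t) * d t \<le> exp (- 2 * L * t0) * d t0"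
    proof (rule nonincreasing_of_deriv[OF True])
      show "((\<lambda>t. exp (- 2 * L * t) * d t) has_real_derivative exp (- 2 * L * s) * (d' s - 2 * L * d s)) (at s)" for s
        by (auto intro!: derivative_eq_intros dd simp: algebra_simps)
      show "exp (- 2 * L * s) * (d' s - 2 * L * d s) \<le> 0" for s
        using d'le[of s] by (auto simp: mult_le_0_iff)
    qed
    then have "exp (2 * L * t) * (exp (- 2 * L * t) * d t) \<le> exp (2 * L * t) * (exp (- 2 * L * t0) * d t0)"
      by (intro mult_left_mono) auto
    then show ?thesis using True by (simp add: algebra_simps flip: exp_add mult.assoc)
  next
    case False
    have "exp (2 * L * t) * d t \<le> exp (2 * L * t0) * d t0"
    proof (rule nondecreasing_of_deriv[where a = t and b = t0])
      show "t \<le> t0" using False by simp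
      show "((\<lambda>t. exp (2 * L * t) * d t) has_real_derivative exp (2 * L * s) * (d' s + 2 * L * d s)) (at s)" for s
        by (auto intro!: derivative_eq_intros dd simp: algebra_simps)
      show "exp (2 * L * s) * (d' s + 2 * L * d s) \<ge> 0" for s
        using d'le[of s] by (auto simp: zero_le_mult_iff)
    qed
    then have "exp (- 2 * L * t) * (exp (2 * L * t) * d t) \<le> exp (- 2 * L * t) * (exp (2 * L * t0) * d t0)"
      by (intro mult_left_mono) auto
    then show ?thesis using False by (simp add: algebra_simps flip: exp_add mult.assoc)
  qed
  moreover have "exp (2 * L * \<bar>t - t0\<bar>) = (exp (L * \<bar>t - t0\<bar>))\<^sup>2"
    using exp_double[of "L * \<bar>t - t0\<bar>"] by (simp add: mult.assoc)
  ultimately have "(norm (y t - z t))\<^sup>2 \<le> (exp (L * \<bar>t - t0\<bar>) * norm (y t0 - z t0))\<^sup>2"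
    by (simp add: d_def dot_square_norm power_mult_distrib)
  then show ?thesis by (rule power2_le_imp_le) auto
qed

section \<open>The profile equation on the line\<close>

text \<open>
Used to catch the first moment at which a positivity that is being propagated could fail.
\<close>

lemma first_zero:
  fixes f :: "real \<Rightarrow> real"
  assumes "continuous_on {a..b} f" "a \<le> b" "f a > 0" "f b \<le> 0"
  obtains c where "a < c" "c \<le> b" "f c = 0" "\<And>s. a \<le> s \<Longrightarrow> s < c \<Longrightarrow> f s > 0"
proof -
  define S where "S = {a..b} \<inter> f -` {..0}"
  have "compact S" unfolding S_def
    by (metis assms(1) closed_atMost closed_atLeastAtMost compact_Icc compact_Int_closed
        continuous_closed_preimage inf_left_idem)
  moreover have "b \<in> S" using assms by (auto simp: S_def)
  ultimately obtain c where c: "c \<in> S" "\<And>s. s \<in> S \<Longrightarrow> c \<le> s"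
    using compact_attains_inf[of S] by blast
  have pos: "f s > 0" if "a \<le> s" "s < c" for s
    using c(2)[of s] that c(1) by (force simp: S_def)
  have ac: "a < c" using c(1) assms by (cases "a = c") (auto simp: S_def)
  have "f c \<ge> 0"
  proof (rule ccontr)
    assume "\<not> f c \<ge> 0"
    then obtain s where "a \<le> s" "s \<le> c" "f s = 0"
      using IVT2'[of f c 0 a] ac assms(1,3) c(1) continuous_on_subset[OF assms(1), of "{a..c}"]
      by (auto simp: S_def)
    then show False using pos[of s] \<open>\<not> f c \<ge> 0\<close> by (cases "s = c") auto
  qed
  then show ?thesis using that[of c] c ac pos by (auto simp: S_def)
qed

text \<open>
The inverse of \<open>\<rho> \<mapsto> ln (\<rho> / (1 - \<rho>))\<close>. In terms of the join parameter \<open>t\<close>, \<open>logistic s = sin\<^sup>2 t\<close> for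
\<open>s = ln tan\<^sup>2 t\<close>.
\<close>

definition logistic :: "real \<Rightarrow> real" where "logistic s = 1 / (1 + exp (- s))"

lemma logistic_bounds: "0 < logistic s" "logistic s < 1" "logistic s \<le> 1" "0 \<le> logistic s"
  by (auto simp: logistic_def add_pos_pos less_imp_le)

lemma logistic_less: "logistic s < logistic t \<longleftrightarrow> s < t"
  by (simp add: logistic_def divide_inverse inverse_less_iff_less add_pos_pos)

lemma logistic_deriv: "(logistic has_real_derivative logistic s * (1 - logistic s)) (at s)"
proof -
  have "1 + exp (- s) \<noteq> 0" by (smt (verit) exp_gt_zero)
  then show ?thesis unfolding logistic_def[abs_def]
    by (auto intro!: derivative_eq_intros simp: field_simps power2_eq_square)
qed

lemma logistic_logit: "0 < r \<Longrightarrow> r < 1 \<Longrightarrow> logistic (ln (r / (1 - r))) = r"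
  by (simp add: logistic_def exp_minus field_simps)

lemma exp_eq_logistic: "logistic s = exp s * (1 - logistic s)"
proof -
  have "1 + exp s \<noteq> 0" by (smt (verit) exp_gt_zero)
  then show ?thesis by (simp add: logistic_def exp_minus field_simps)
qed

lemma logistic_tendsto_bot: "(logistic \<longlongrightarrow> 0) at_bot"
proof (rule tendsto_sandwich[OF _ _ tendsto_const exp_at_bot])
  have "logistic s \<le> exp s" for s
    using exp_eq_logistic[of s] mult_left_mono[of "1 - logistic s" 1 "exp s"] logistic_bounds[of s] by simp
  then show "\<forall>\<^sub>F s in at_bot. logistic s \<le> exp s" by simp
qed (simp add: logistic_bounds)

lemma logistic_tendsto_top: "(logistic \<longlongrightarrow> 1) at_top"
proof -
  have "logistic (- s) = 1 - logistic s" for s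
  proof -
    have "1 + exp s \<noteq> 0" "1 + exp (- s) \<noteq> 0" by (smt (verit) exp_gt_zero)+
    then show ?thesis by (simp add: logistic_def exp_minus field_simps)
  qed
  then have "((\<lambda>s. 1 - logistic s) \<longlongrightarrow> 0) at_top"
    using filterlim_compose[OF logistic_tendsto_bot filterlim_uminus_at_bot_at_top] by simp
  then show ?thesis using tendsto_diff[OF tendsto_const, of _ 0 at_top "1::real"] by force
qed

locale profile_ode =
  fixes k :: nat
  assumes k2: "2 \<le> k"
begin

lemma rk2: "2 \<le> real k" using k2 by simp

text \<open>
With \<open>\<rho> = logistic s\<close>: \<open>H\<close> is the coefficient of \<open>sin \<alpha> cos \<alpha>\<close> in the profile equation, \<open>w\<close> is the
integrating factor that removes its first-order term, \<open>g = w\<^sup>2 H\<close> is the potential in the energy, and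
\<open>dg\<close> is the derivative of \<open>g\<close>.
\<close>

definition H :: "real \<Rightarrow> real" where "H s = (1 + (4 * real k - 1) * logistic s) / 4"
definition w :: "real \<Rightarrow> real" where "w s = (1 - logistic s) ^ (k - 1)"
definition g :: "real \<Rightarrow> real" where "g s = (w s)\<^sup>2 * H s"
definition dg :: "real \<Rightarrow> real" where
  "dg s = logistic s * (w s)\<^sup>2 * (2 * real k + 1 - (4 * real k - 1) * (2 * real k - 1) * logistic s) / 4"

lemma H_deriv: "(H has_real_derivative (4 * real k - 1) * (logistic s * (1 - logistic s)) / 4) (at s)"
  unfolding H_def[abs_def] by (auto intro!: derivative_eq_intros logistic_deriv)

lemma H_bounds: "1/4 < H s" "H s \<le> real k" "0 < H s" "0 \<le> H s"
proof -
  have "0 < (4 * real k - 1) * logistic s" using rk2 logistic_bounds[of s] by simp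
  then show a: "1/4 < H s" by (simp add: H_def)
  have "(4 * real k - 1) * logistic s \<le> (4 * real k - 1) * 1"
    using rk2 logistic_bounds[of s] by (intro mult_left_mono) auto
  then show "H s \<le> real k" by (simp add: H_def)
  show "0 < H s" "0 \<le> H s" using a by auto
qed

lemma w_bounds: "0 < w s" "w s \<le> 1" "0 \<le> w s" "w s \<noteq> 0"
proof -
  show *: "0 < w s" using logistic_bounds[of s] by (simp add: w_def)
  show "w s \<le> 1" using logistic_bounds[of s] by (auto simp: w_def intro!: power_le_one)
  show "0 \<le> w s" "w s \<noteq> 0" using * by auto
qed

lemma w_deriv: "(w has_real_derivative - (real k - 1) * logistic s * w s) (at s)"
proof -
  define m where "m = k - 2"
  have m: "k - 1 = Suc m" "real k - 1 = real (Suc m)" using k2 by (auto simp: m_def)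
  have "((\<lambda>s. (1 - logistic s) ^ Suc m) has_real_derivative
      real (Suc m) * ((0 - logistic s * (1 - logistic s)) * (1 - logistic s) ^ m)) (at s)"
    using DERIV_power[OF DERIV_diff[OF DERIV_const[of 1] logistic_deriv[of s]], of "Suc m"] by simp
  moreover have "real (Suc m) * ((0 - logistic s * (1 - logistic s)) * (1 - logistic s) ^ m)
      = - real (Suc m) * logistic s * (1 - logistic s) ^ Suc m"
    by (simp add: algebra_simps)
  ultimately show ?thesis unfolding w_def[abs_def] m by simp
qed

lemma g_deriv: "(g has_real_derivative dg s) (at s)"
proof -
  have "(g has_real_derivative (2 * (- (real k - 1) * logistic s * w s) * w s) * H s
      + (4 * real k - 1) * (logistic s * (1 - logistic s)) / 4 * (w s)\<^sup>2) (at s)"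
    unfolding g_def[abs_def] using DERIV_mult[OF DERIV_power[OF w_deriv, of 2] H_deriv]
    by (simp add: ac_simps)
  moreover have "(2 * (- (real k - 1) * logistic s * w s) * w s) * H s
      + (4 * real k - 1) * (logistic s * (1 - logistic s)) / 4 * (w s)\<^sup>2 = dg s"
    unfolding dg_def H_def power2_eq_square by (simp add: algebra_simps) (simp add: field_simps)
  ultimately show ?thesis by simp
qed

lemma g_pos: "0 < g s" using w_bounds[of s] H_bounds[of s] by (simp add: g_def)

lemma continuous_on_coefficients [continuous_intros]:
  "continuous_on S logistic" "continuous_on S H" "continuous_on S w" "continuous_on S g"
  by (meson DERIV_continuous_on has_field_derivative_at_within logistic_deriv H_deriv w_deriv g_deriv)+

text \<open>
The maximum of \<open>g\<close>: the zero of the bracket in \<open>dg\<close>.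
\<close>

definition s_max :: real where
  "s_max = (let r = (2 * real k + 1) / ((4 * real k - 1) * (2 * real k - 1)) in ln (r / (1 - r)))"

lemma logistic_s_max: "logistic s_max = (2 * real k + 1) / ((4 * real k - 1) * (2 * real k - 1))"
proof -
  have a: "0 < (4 * real k - 1) * (2 * real k - 1)" using rk2 by (intro mult_pos_pos) auto
  have "2 * real k + 1 < 7 * (2 * real k - 1)" using rk2 by auto
  also have "\<dots> \<le> (4 * real k - 1) * (2 * real k - 1)" using rk2 by (intro mult_right_mono) auto
  finally show ?thesis unfolding s_max_def Let_def
    by (intro logistic_logit divide_pos_pos) (use a rk2 in auto)
qed

lemma dg_sign: "s < s_max \<Longrightarrow> dg s > 0" "s \<le> s_max \<Longrightarrow> dg s \<ge> 0" "s_max < s \<Longrightarrow> dg s < 0" "s_max \<le> s \<Longrightarrow> dg s \<le> 0"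
proof -
  define q where "q = (4 * real k - 1) * (2 * real k - 1)"
  have q: "q > 0" unfolding q_def using rk2 by (intro mult_pos_pos) auto
  have e: "dg s = (q * logistic s * (w s)\<^sup>2 / 4) * (logistic s_max - logistic s)"
    using q unfolding dg_def logistic_s_max q_def[symmetric] by (simp add: field_simps)
  have p: "q * logistic s * (w s)\<^sup>2 / 4 > 0" using q logistic_bounds[of s] w_bounds[of s] by simp
  show l: "dg s > 0" if "s < s_max" using that p unfolding e
    by (intro mult_pos_pos) (auto simp: logistic_less)
  show g: "dg s < 0" if "s_max < s" using that p unfolding e
    by (intro mult_pos_neg) (auto simp: logistic_less)
  have z: "dg s = 0" if "s = s_max" unfolding e using that by simp
  show "dg s \<ge> 0" if "s \<le> s_max" using l z that by (cases "s = s_max") auto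
  show "dg s \<le> 0" if "s_max \<le> s" using g z that by (cases "s = s_max") auto
qed

lemma w_tendsto_bot: "(w \<longlongrightarrow> 1) at_bot"
  using tendsto_power[OF tendsto_diff[OF tendsto_const logistic_tendsto_bot], of 1 "k - 1"]
  by (simp add: w_def[abs_def])

lemma H_tendsto: "(logistic \<longlongrightarrow> r) F \<Longrightarrow> (H \<longlongrightarrow> (1 + (4 * real k - 1) * r) / 4) F"
  unfolding H_def[abs_def] by (intro tendsto_intros) auto

lemma g_tendsto_bot: "(g \<longlongrightarrow> 1/4) at_bot"
  using tendsto_mult[OF tendsto_power[OF w_tendsto_bot, of 2] H_tendsto[OF logistic_tendsto_bot]]
  by (simp add: g_def[abs_def])

lemma w_tendsto_top: "(w \<longlongrightarrow> 0) at_top"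
proof -
  have "((\<lambda>s. (1 - logistic s) ^ (k - 1)) \<longlongrightarrow> (1 - 1) ^ (k - 1)) at_top"
    by (intro tendsto_intros logistic_tendsto_top)
  moreover have "(1 - 1 :: real) ^ (k - 1) = 0" using k2 by simp
  ultimately show ?thesis by (simp only: w_def[abs_def])
qed

lemma g_tendsto_top: "(g \<longlongrightarrow> 0) at_top"
  using tendsto_mult[OF tendsto_power[OF w_tendsto_top, of 2] H_tendsto[OF logistic_tendsto_top]]
  by (simp add: g_def[abs_def])

lemma g_gt_quarter: "s < s_max \<Longrightarrow> 1/4 < g s"
  using DERIV_pos_imp_increasing_at_bot[of s g "1/4"] g_deriv dg_sign(1) g_tendsto_bot
  by (metis order_le_less_trans)

lemma ex_s_low: "\<exists>s_low. s_max < s_low \<and> g s_low < 1/4"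
proof -
  have "eventually (\<lambda>s. g s < 1/4) at_top" using g_tendsto_top by (rule order_tendstoD) simp
  then obtain N where "\<forall>s\<ge>N. g s < 1/4" by (auto simp: eventually_at_top_linorder)
  then show ?thesis by (intro exI[of _ "max N (s_max + 1)"]) auto
qed

text \<open>
A point beyond the maximum where \<open>g\<close> has fallen below its limit \<open>1/4\<close> at \<open>-\<infinity>\<close>.
\<close>

definition s_low :: real where "s_low = (SOME s. s_max < s \<and> g s < 1/4)"

lemma s_low: "s_max < s_low" "g s_low < 1/4"
  using someI_ex[OF ex_s_low] by (auto simp: s_low_def)

text \<open>
The vanishing of the tension field of a join map, as an equation for its angle \<open>al\<close> in the variable
\<open>s = ln tan\<^sup>2 t\<close>.
\<close>

definition sol :: "(real \<Rightarrow> real) \<Rightarrow> (real \<Rightarrow> real) \<Rightarrow> bool" where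
  "sol al be \<longleftrightarrow> (\<forall>s. (al has_real_derivative be s) (at s) \<and>
     (be has_real_derivative ((real k - 1) * logistic s * be s + H s * (sin (al s) * cos (al s)))) (at s))"

text \<open>
Twice the mechanical energy with respect to the time whose derivation is \<open>w d/ds\<close>: in this time the
equation is that of an undamped pendulum with time-dependent potential \<open>g\<close>.
\<close>

definition energy :: "(real \<Rightarrow> real) \<Rightarrow> (real \<Rightarrow> real) \<Rightarrow> real \<Rightarrow> real" where
  "energy al be s = (w s * be s)\<^sup>2 - g s * (sin (al s))\<^sup>2"

lemma sol_deriv:
  assumes "sol al be"
  shows "(al has_real_derivative be s) (at s)"
    "(be has_real_derivative ((real k - 1) * logistic s * be s + H s * (sin (al s) * cos (al s)))) (at s)"
  using assms by (auto simp: sol_def)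

lemma sol_continuous:
  assumes "sol al be" shows "continuous_on S al" "continuous_on S be"
  by (meson DERIV_continuous_on has_field_derivative_at_within sol_deriv[OF assms])+

lemma Z_deriv:
  assumes "sol al be"
  shows "((\<lambda>s. w s * be s) has_real_derivative w s * H s * (sin (al s) * cos (al s))) (at s)"
  by (auto intro!: derivative_eq_intros w_deriv sol_deriv[OF assms] simp: algebra_simps)

text \<open>
Adding \<open>c g\<close> replaces the factor \<open>sin\<^sup>2 al\<close> in the derivative of the energy by \<open>sin\<^sup>2 al - c\<close>. If \<open>c\<close> is
the value of \<open>sin\<^sup>2 al\<close> at the maximum of \<open>g\<close> and \<open>sin\<^sup>2 al\<close> is monotone, then both factors change sign
there, so that \<open>energy + c g\<close> is monotone. This replaces all integrals over \<open>dg\<close>.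
\<close>

lemma energy_shift_deriv:
  assumes "sol al be"
  shows "((\<lambda>s. energy al be s + c * g s) has_real_derivative - dg s * ((sin (al s))\<^sup>2 - c)) (at s)"
proof -
  have "((\<lambda>s. (sin (al s))\<^sup>2) has_real_derivative 2 * sin (al s) * cos (al s) * be s) (at s)"
    by (auto intro!: derivative_eq_intros sol_deriv[OF assms])
  note D = DERIV_add[OF DERIV_diff[OF DERIV_power[OF Z_deriv[OF assms], of 2]
      DERIV_mult[OF g_deriv this]] DERIV_cmult[OF g_deriv, of c]]
  show ?thesis unfolding energy_def
    by (rule DERIV_cong[OF D]) (simp add: g_def algebra_simps power2_eq_square)
qed

lemma energy_deriv:
  assumes "sol al be"
  shows "(energy al be has_real_derivative - dg s * (sin (al s))\<^sup>2) (at s)"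
  using energy_shift_deriv[OF assms, of 0] by simp

definition profile_field :: "real \<Rightarrow> real \<times> real \<Rightarrow> real \<times> real" where
  "profile_field s y = (snd y, (real k - 1) * logistic s * snd y + H s * (sin (fst y) * cos (fst y)))"

lemma profile_field_lipschitz: "norm (profile_field s y - profile_field s z) \<le> (2 * real k) * norm (y - z)"
proof -
  obtain a b where y: "y = (a, b)" by (cases y)
  obtain c d where z: "z = (c, d)" by (cases z)
  have sc: "\<bar>sin a * cos a - sin c * cos c\<bar> \<le> \<bar>a - c\<bar>"
  proof -
    have "sin a * cos a - sin c * cos c = (sin (2 * a) - sin (2 * c)) / 2"
      by (simp add: sin_double)
    also have "\<dots> = sin ((2 * a - 2 * c) / 2) * cos ((2 * a + 2 * c) / 2)"
      by (simp add: sin_diff_sin)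
    finally have "\<bar>sin a * cos a - sin c * cos c\<bar> = \<bar>sin (a - c)\<bar> * \<bar>cos (a + c)\<bar>"
      by (simp add: abs_mult diff_divide_distrib add_divide_distrib)
    also have "\<dots> \<le> \<bar>a - c\<bar> * 1"
      by (intro mult_mono abs_sin_x_le_abs_x abs_cos_le_one) auto
    finally show ?thesis by simp
  qed
  have "profile_field s y - profile_field s z = (b - d, (real k - 1) * logistic s * (b - d) + H s * (sin a * cos a - sin c * cos c))"
    by (simp add: profile_field_def y z algebra_simps)
  then have "norm (profile_field s y - profile_field s z)
      \<le> \<bar>b - d\<bar> + \<bar>(real k - 1) * logistic s * (b - d) + H s * (sin a * cos a - sin c * cos c)\<bar>"
    by (simp add: norm_Pair sqrt_sum_squares_le_sum_abs)
  also have "\<dots> \<le> \<bar>b - d\<bar> + ((real k - 1) * logistic s * \<bar>b - d\<bar> + H s * \<bar>sin a * cos a - sin c * cos c\<bar>)"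
    using rk2 logistic_bounds[of s] H_bounds[of s]
    by (intro add_left_mono order_trans[OF abs_triangle_ineq]) (auto simp: abs_mult)
  also have "\<dots> \<le> \<bar>b - d\<bar> + ((real k - 1) * 1 * \<bar>b - d\<bar> + real k * \<bar>a - c\<bar>)"
    using rk2 logistic_bounds[of s] H_bounds[of s] sc
    by (intro add_left_mono add_mono mult_mono mult_right_mono mult_left_mono) auto
  also have "\<dots> = real k * (\<bar>b - d\<bar> + \<bar>a - c\<bar>)" by (simp add: algebra_simps)
  also have "\<dots> \<le> real k * (norm (y - z) + norm (y - z))"
    by (intro mult_left_mono add_mono) (auto simp: y z norm_Pair real_le_rsqrt)
  finally show ?thesis by simp
qed

lemma sol_iff_profile_field:
  "sol al be \<longleftrightarrow> (\<forall>s. ((\<lambda>s. (al s, be s)) has_vector_derivative profile_field s (al s, be s)) (at s))"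
  (is "_ \<longleftrightarrow> ?R")
proof
  assume "sol al be"
  then show ?R unfolding profile_field_def
    by (auto intro!: has_vector_derivative_Pair simp: sol_def has_real_derivative_iff_has_vector_derivative)
next
  assume R: ?R
  show "sol al be" unfolding sol_def
  proof (intro allI conjI)
    fix s
    show "(al has_real_derivative be s) (at s)"
      using bounded_linear.has_vector_derivative[OF bounded_linear_fst R[rule_format, of s]]
      by (simp add: profile_field_def has_real_derivative_iff_has_vector_derivative)
    show "(be has_real_derivative ((real k - 1) * logistic s * be s + H s * (sin (al s) * cos (al s)))) (at s)"
      using bounded_linear.has_vector_derivative[OF bounded_linear_snd R[rule_format, of s]]
      by (simp add: profile_field_def has_real_derivative_iff_has_vector_derivative)
  qed
qed

lemma sol_exists: obtains al be where "sol al be" "al t = a" "be t = b"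
proof -
  have c: "continuous_on UNIV (\<lambda>(s, y). profile_field s y)"
  proof -
    have "continuous_on UNIV (\<lambda>p :: real \<times> real \<times> real. logistic (fst p))"
      "continuous_on UNIV (\<lambda>p :: real \<times> real \<times> real. H (fst p))"
      by (rule continuous_on_compose2[OF continuous_on_coefficients(1)[of UNIV]]
          continuous_on_compose2[OF continuous_on_coefficients(2)[of UNIV]]; auto intro: continuous_intros)+
    then show ?thesis unfolding profile_field_def case_prod_unfold by (intro continuous_intros)
  qed
  obtain y where y: "y t = (a, b)" "\<And>s. (y has_vector_derivative profile_field s (y s)) (at s)"
  proof (rule ode_exists[OF c profile_field_lipschitz, of t "(a, b)"])
    show "profile_field s 0 = 0" for s by (simp add: profile_field_def zero_prod_def)
    show "0 < 2 * real k" using rk2 by simp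
  qed blast
  have "sol (fst \<circ> y) (snd \<circ> y)" unfolding sol_iff_profile_field using y(2) by simp
  then show ?thesis using that y(1) by force
qed

lemma sol_dependence:
  assumes "sol al be" "sol al' be'"
  shows "norm (al s - al' s, be s - be' s) \<le> exp (2 * real k * \<bar>s - t\<bar>) * norm (al t - al' t, be t - be' t)"
  using ode_dependence[of profile_field "2 * real k" "\<lambda>s. (al s, be s)" "\<lambda>s. (al' s, be' s)" s t,
      OF profile_field_lipschitz] assms
  by (simp add: sol_iff_profile_field)

lemma sol_unique:
  assumes "sol al be" "sol al' be'" "al t = al' t" "be t = be' t"
  shows "al s = al' s" "be s = be' s"
  using sol_dependence[OF assms(1,2), of s t] assms(3,4) by (auto simp: norm_Pair sum_power2_le_zero_iff)

lemma sol_const: "sin c * cos c = 0 \<Longrightarrow> sol (\<lambda>_. c) (\<lambda>_. 0)"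
  by (auto simp: sol_def)

lemma sol_mono:
  assumes "sol al be" "a \<le> b" "\<And>s. a \<le> s \<Longrightarrow> s \<le> b \<Longrightarrow> be s \<ge> 0"
  shows "al a \<le> al b"
  using nondecreasing_of_deriv[of a b al be] assms sol_deriv by blast

text \<open>
While \<open>al \<le> \<pi>/2\<close> the function \<open>sin\<^sup>2 al\<close> increases, so the energy gains more after \<open>s_max\<close>, where
\<open>g\<close> falls below \<open>1/4\<close>, than it loses before, where \<open>g\<close> rises from at least \<open>1/4\<close>. A positive energy
beyond \<open>s_max\<close> can only grow, which keeps the velocity away from \<open>0\<close>.
\<close>

lemma late_crossing:
  assumes S: "sol al be" and t: "t < s_max" "0 < al t" "0 < be t" "0 \<le> energy al be t"
    and le: "\<And>s. t \<le> s \<Longrightarrow> s \<le> s_low \<Longrightarrow> al s \<le> pi/2"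
  obtains s where "t \<le> s" "pi < al s" "\<And>r. t \<le> r \<Longrightarrow> r \<le> s \<Longrightarrow> 0 < be r"
proof -
  let ?Z = "\<lambda>s. w s * be s"
  have Zc: "continuous_on A ?Z" for A by (intro continuous_intros sol_continuous[OF S])
  have be_iff: "0 < be s \<longleftrightarrow> 0 < ?Z s" for s using w_bounds[of s] by (simp add: zero_less_mult_iff)
  have pos: "0 < ?Z s" if "t \<le> s" "s \<le> s_low" for s
  proof (rule ccontr)
    assume "\<not> 0 < ?Z s"
    then have "?Z s \<le> 0" "?Z t > 0" using t(3) be_iff by (blast intro: leI)+
    then obtain c where c: "t < c" "c \<le> s" "?Z c = 0" "\<And>r. t \<le> r \<Longrightarrow> r < c \<Longrightarrow> ?Z r > 0"
      using first_zero[OF Zc \<open>t \<le> s\<close>] by blast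
    have al: "0 < al r" "al r \<le> pi/2" if "t \<le> r" "r \<le> c" for r
    proof -
      have "be q \<ge> 0" if "t \<le> q" "q \<le> r" for q
      proof (cases "q = c")
        case True
        then show ?thesis using c(3) w_bounds(4)[of q] by simp
      next
        case False
        then have "0 < ?Z q" using c(4)[of q] that \<open>r \<le> c\<close> by linarith
        then show ?thesis using be_iff by (simp add: less_imp_le)
      qed
      then have "al t \<le> al r" using sol_mono[OF S, of t r] that by auto
      then show "0 < al r" using t by auto
      show "al r \<le> pi/2" using le[of r] that c \<open>s \<le> s_low\<close> by auto
    qed
    have "?Z t \<le> ?Z c"
    proof (rule nondecreasing_of_deriv[OF _ Z_deriv[OF S]])
      show "t \<le> c" using c by simp
      fix r assume "t \<le> r" "r \<le> c"
      with al[of r] have "sin (al r) \<ge> 0" "cos (al r) \<ge> 0"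
        by (auto intro!: sin_ge_zero cos_ge_zero)
      then show "0 \<le> w r * H r * (sin (al r) * cos (al r))"
        using w_bounds[of r] H_bounds[of r] by simp
    qed
    then show False using c(3) be_iff t(3) by (metis not_less)
  qed
  have mono: "al r \<le> al s" if "t \<le> r" "r \<le> s" "s \<le> s_low" for r s
    proof (rule sol_mono[OF S])
    show "0 \<le> be q" if "r \<le> q" "q \<le> s" for q
      using pos[of q] be_iff that \<open>t \<le> r\<close> \<open>s \<le> s_low\<close> by (meson less_imp_le order_trans)
  qed (use that in simp)
  have apos: "0 < al s" if "t \<le> s" "s \<le> s_low" for s using mono[of t s] that t by auto
  have smono: "(sin (al r))\<^sup>2 \<le> (sin (al s))\<^sup>2" if "t \<le> r" "r \<le> s" "s \<le> s_low" for r s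
    using mono[OF that] apos[of r] le[of s] that
    by (intro power_mono sin_monotone_2pi_le sin_ge_zero) auto
  let ?c = "(sin (al s_max))\<^sup>2" let ?F = "\<lambda>s. energy al be s + ?c * g s"
  have "?F t \<le> ?F s_max"
  proof (rule nondecreasing_of_deriv[OF _ energy_shift_deriv[OF S]])
    fix r assume "t \<le> r" "r \<le> s_max"
    then show "0 \<le> - dg r * ((sin (al r))\<^sup>2 - ?c)"
      using smono[of r s_max] dg_sign(2)[of r] s_low by (simp add: mult_nonneg_nonpos)
  qed (use t in simp)
  also have "\<dots> \<le> ?F s_low"
  proof (rule nondecreasing_of_deriv[OF _ energy_shift_deriv[OF S]])
    fix r assume "s_max \<le> r" "r \<le> s_low"
    then show "0 \<le> - dg r * ((sin (al r))\<^sup>2 - ?c)"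
      using smono[of s_max r] dg_sign(4)[of r] t by (simp add: mult_nonpos_nonneg)
  qed (use s_low in simp)
  finally have "energy al be t + ?c * (g t - g s_low) \<le> energy al be s_low" by (simp add: algebra_simps)
  moreover have "0 < sin (al s_max)" using apos[of s_max] le[of s_max] t s_low by (intro sin_gt_zero) auto
  then have "0 < ?c * (g t - g s_low)"
    using g_gt_quarter[OF t(1)] s_low by (intro mult_pos_pos) auto
  ultimately have Eb: "0 < energy al be s_low" using t by simp
  define e where "e = sqrt (energy al be s_low)"
  have e: "e > 0" "e\<^sup>2 = energy al be s_low" using Eb by (auto simp: e_def)
  have Ege: "energy al be s_low \<le> energy al be s" if "s_low \<le> s" for s
  proof (rule nondecreasing_of_deriv[OF that energy_deriv[OF S]])
    fix r assume "s_low \<le> r" "r \<le> s"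
    then show "0 \<le> - dg r * (sin (al r))\<^sup>2" using dg_sign(4)[of r] s_low by (simp add: mult_nonpos_nonneg)
  qed
  have Z2: "e\<^sup>2 \<le> (?Z s)\<^sup>2" if "s_low \<le> s" for s
  proof -
    have "0 \<le> g s * (sin (al s))\<^sup>2" using g_pos[of s] by simp
    then show ?thesis using Ege[OF that] unfolding e(2) energy_def[of al be s] by linarith
  qed
  have Ze: "e \<le> ?Z s" if "s_low \<le> s" for s
  proof -
    have "0 < ?Z s"
    proof (rule ccontr)
      assume "\<not> 0 < ?Z s"
      then have "?Z s \<le> 0" "?Z s_low > 0" using pos[of s_low] t(1) s_low(1) by linarith+
      then obtain c where "s_low < c" "?Z c = 0"
        using first_zero[OF Zc \<open>s_low \<le> s\<close>] by blast
      then have "e\<^sup>2 \<le> 0\<^sup>2" using Z2[of c] by (simp only: less_imp_le)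
      then show False using e(1) by simp
    qed
    then show ?thesis using power2_le_imp_le[OF Z2[OF that]] by (simp only: less_imp_le)
  qed
  have bege: "e \<le> be s" if "s_low \<le> s" for s
  proof -
    have "0 < be s" using Ze[OF that] e(1) be_iff by (meson less_le_trans)
    then have "?Z s \<le> 1 * be s" using w_bounds[of s] by (intro mult_right_mono) auto
    then show ?thesis using Ze[OF that] by simp
  qed
  define s where "s = s_low + (pi + 1) / e"
  have s: "s_low \<le> s" using e by (simp add: s_def)
  have "al s_low - e * s_low \<le> al s - e * s"
  proof (rule nondecreasing_of_deriv[OF s, where f = "\<lambda>s. al s - e * s"])
    show "((\<lambda>s. al s - e * s) has_real_derivative be r - e) (at r)" for r
      by (auto intro!: derivative_eq_intros sol_deriv[OF S])
    show "0 \<le> be r - e" if "s_low \<le> r" for r using bege[OF that] by simp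
  qed
  then have "al s_low + e * (s - s_low) \<le> al s" by (simp add: algebra_simps)
  then have "pi < al s" using apos[of s_low] e t s_low by (simp add: s_def)
  moreover have "0 < be r" if "t \<le> r" for r
  proof (cases "r \<le> s_low")
    case True
    then show ?thesis using pos[OF that] be_iff by blast
  next
    case False
    then show ?thesis using bege[of r] e(1) by linarith
  qed
  ultimately show ?thesis using that[of s] s t s_low by auto
qed

end

section \<open>An early crossing turns back\<close>

lemma sin_squared_ge_half: "pi/2 \<le> x \<Longrightarrow> x \<le> 3*pi/4 \<Longrightarrow> 1/2 \<le> (sin x)\<^sup>2"
proof -
  assume x: "pi/2 \<le> x" "x \<le> 3*pi/4"
  have "cos (pi/4) \<le> cos (x - pi/2)" using x by (intro cos_monotone_0_pi_le) auto
  then have "(sqrt 2 / 2)\<^sup>2 \<le> (sin x)\<^sup>2"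
    by (intro power_mono) (auto simp: cos_45 cos_diff)
  then show ?thesis by (simp add: power_divide)
qed

lemma cos_squared_ge_half: "3*pi/4 \<le> x \<Longrightarrow> x \<le> pi \<Longrightarrow> 1/2 \<le> (cos x)\<^sup>2"
proof -
  assume x: "3*pi/4 \<le> x" "x \<le> pi"
  have "cos (pi/4) \<le> cos (pi - x)" using x by (intro cos_monotone_0_pi_le) auto
  then have "(sqrt 2 / 2)\<^sup>2 \<le> (- cos x)\<^sup>2"
    by (intro power_mono) (auto simp: cos_45)
  then show ?thesis by (simp add: power_divide)
qed

context profile_ode begin

lemma tan_sol_deriv:
  assumes "sol al be" "cos (al s) \<noteq> 0"
  shows "((\<lambda>s. tan (al s)) has_real_derivative (1 + (tan (al s))\<^sup>2) * be s) (at s)"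
  by (rule DERIV_cong[OF DERIV_chain2[OF DERIV_tan sol_deriv(1)[OF assms(1)]]])
    (use assms(2) tan_sec[of "al s"] in \<open>auto simp: power_inverse\<close>)

text \<open>
Along a solution \<open>v = tan al\<close> satisfies
\<open>v'' - (k - 1) \<rho> v' = (H + 2 (1 + v\<^sup>2) be\<^sup>2) v\<close>: thus \<open>|v|\<close> is a subsolution of the linearisation at \<open>0\<close> and at
\<open>\<pi>\<close>, without any error term to be absorbed. The weighted Wronskian of \<open>v\<close> and a comparison function
\<open>\<Psi>\<close> is therefore monotone as soon as \<open>\<Psi>\<close> is a supersolution.
\<close>

lemma tan_wronskian_deriv:
  assumes "sol al be" "cos (al s) \<noteq> 0"
    and P: "(\<Psi> has_real_derivative \<Psi>1 s) (at s)" "(\<Psi>1 has_real_derivative \<Psi>2) (at s)"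
  shows "((\<lambda>s. w s * ((1 + (tan (al s))\<^sup>2) * be s * \<Psi> s - tan (al s) * \<Psi>1 s)) has_real_derivative
    w s * tan (al s) * ((H s + 2 * (1 + (tan (al s))\<^sup>2) * (be s)\<^sup>2) * \<Psi> s - \<Psi>2
      + (real k - 1) * logistic s * \<Psi>1 s)) (at s)"
proof -
  define v where "v = tan (al s)"
  note T = tan_sol_deriv[OF assms(1,2)]
  have sc: "(1 + v\<^sup>2) * (sin (al s) * cos (al s)) = v"
    using assms(2) tan_sec[of "al s"] by (simp add: v_def tan_def field_simps power2_eq_square)
  note D = DERIV_mult[OF w_deriv[of s] DERIV_diff[OF DERIV_mult[OF DERIV_mult[OF DERIV_add[OF DERIV_const[of 1]
     DERIV_power[OF T, of 2]] sol_deriv(2)[OF assms(1), of s]] P(1)] DERIV_mult[OF T P(2)]]]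
  show ?thesis
  proof (rule DERIV_cong[OF D])
    have "(1 + v\<^sup>2) * ((real k - 1) * logistic s * be s + H s * (sin (al s) * cos (al s)))
      = (1 + v\<^sup>2) * (real k - 1) * logistic s * be s + H s * v"
      unfolding distrib_left by (subst (2) sc[symmetric]) (simp add: algebra_simps)
    then show "- (real k - 1) * logistic s * w s * ((1 + (tan (al s))\<^sup>2) * be s * \<Psi> s - tan (al s) * \<Psi>1 s) +
      (((0 + of_nat 2 * ((1 + (tan (al s))\<^sup>2) * be s * tan (al s) ^ (2 - Suc 0))) * be s +
         ((real k - 1) * logistic s * be s + H s * (sin (al s) * cos (al s))) * (1 + (tan (al s))\<^sup>2)) * \<Psi> s +
        \<Psi>1 s * ((1 + (tan (al s))\<^sup>2) * be s) -
        ((1 + (tan (al s))\<^sup>2) * be s * \<Psi>1 s + \<Psi>2 * tan (al s))) * w s =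
      w s * tan (al s) * ((H s + 2 * (1 + (tan (al s))\<^sup>2) * (be s)\<^sup>2) * \<Psi> s - \<Psi>2 +
        (real k - 1) * logistic s * \<Psi>1 s)"
      unfolding v_def[symmetric]
      by (simp only: mult.commute[of _ "1 + v\<^sup>2"]) (simp add: algebra_simps power2_eq_square)
  qed
qed

lemma tan_quotient_deriv:
  assumes "sol al be" "cos (al s) \<noteq> 0" "\<Psi> s > 0"
    and P: "(\<Psi> has_real_derivative \<Psi>1 s) (at s)"
  shows "((\<lambda>s. tan (al s) / \<Psi> s) has_real_derivative
    w s * ((1 + (tan (al s))\<^sup>2) * be s * \<Psi> s - tan (al s) * \<Psi>1 s) / (w s * (\<Psi> s)\<^sup>2)) (at s)"
  by (rule DERIV_cong[OF DERIV_divide[OF tan_sol_deriv[OF assms(1,2)] P]])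
    (use assms(3) w_bounds[of s] in \<open>auto simp: power2_eq_square\<close>)

lemma energy_nonincreasing:
  assumes "sol al be" "a \<le> b" "b \<le> s_max"
  shows "energy al be b \<le> energy al be a"
proof (rule nonincreasing_of_deriv[OF assms(2) energy_deriv[OF assms(1)]])
  show "- dg r * (sin (al r))\<^sup>2 \<le> 0" if "r \<le> b" for r
    using dg_sign(2)[of r] that assms by simp
qed

text \<open>
As \<open>\<rho>\<close> is asymptotic to \<open>e\<^sup>s\<close> at \<open>-\<infinity>\<close>, \<open>dg\<close> is asymptotic to \<open>(2k + 1)/4 e\<^sup>s\<close>.
\<close>

lemma potential_near_bot:
  obtains T0 where "T0 < s_max" "\<And>s. s \<le> T0 \<Longrightarrow> g s \<le> 5/16" "\<And>s. s \<le> T0 \<Longrightarrow> exp s / 4 \<le> dg s"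
proof -
  define d where "d s = (1 - logistic s) * (w s)\<^sup>2 * (2 * real k + 1 - (4 * real k - 1) * (2 * real k - 1) * logistic s) / 4" for s
  have "(d \<longlongrightarrow> (1 - 0) * 1\<^sup>2 * (2 * real k + 1 - (4 * real k - 1) * (2 * real k - 1) * 0) / 4) at_bot"
    unfolding d_def by (intro tendsto_intros logistic_tendsto_bot w_tendsto_bot) simp
  then have "eventually (\<lambda>s. 1/4 < d s) at_bot"
    by (rule order_tendstoD) (use rk2 in auto)
  then obtain A where A: "\<And>s. s \<le> A \<Longrightarrow> 1/4 < d s" by (auto simp: eventually_at_bot_linorder)
  have "eventually (\<lambda>s. g s < 5/16) at_bot" using g_tendsto_bot by (rule order_tendstoD) simp
  then obtain B where B: "\<And>s. s \<le> B \<Longrightarrow> g s < 5/16" by (auto simp: eventually_at_bot_linorder)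
  have dgd: "dg s = exp s * d s" for s
    unfolding dg_def d_def by (subst exp_eq_logistic) simp
  show ?thesis
  proof (rule that[of "min (min A B) (s_max - 1)"])
    fix s assume "s \<le> min (min A B) (s_max - 1)"
    then have "g s < 5/16" "1/4 < d s" using A[of s] B[of s] by auto
    then show "g s \<le> 5/16" "exp s / 4 \<le> dg s"
      using mult_left_mono[of "1/4" "d s" "exp s"] by (auto simp: dgd)
  qed simp
qed

text \<open>
After an early crossing of \<open>\<pi>/2\<close> the solution enters the range \<open>al \<ge> 3\<pi>/4\<close> within time \<open>4\<close>. As long as it
increases and stays below \<open>\<pi>\<close>, comparison of \<open>- tan al\<close> with \<open>cosh ((s - s_max)/2)\<close> gives
\<open>sin\<^sup>2 al(s) \<ge> c e\<^bsup>s_max - s\<^esup>/8\<close> with \<open>c = sin\<^sup>2 al(s_max)\<close>. As \<open>dg \<ge> e\<^sup>s/4\<close> near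
\<open>-\<infinity>\<close>, the energy decreases there at a rate bounded below by a multiple of \<open>c\<close>. An early start thus makes the energy at \<open>s_max\<close>
smaller than \<open>-2 c g(s_max)\<close>, and at most \<open>c g(s_max)\<close> is recovered afterwards. But the energy would have
to be nonnegative on reaching \<open>\<pi>\<close>, or to have limit inferior at least \<open>0\<close> at \<open>+\<infinity>\<close>.
\<close>

lemma early_crossing:
  obtains T where "T < s_max"
    "\<And>al be t. \<lbrakk>sol al be; t \<le> T; al t = pi/2; 0 < be t; 1/4 - g t \<le> energy al be t; energy al be t \<le> 0\<rbrakk> \<Longrightarrow>
      \<not> (\<exists>s\<ge>t. pi < al s \<and> (\<forall>r. t \<le> r \<longrightarrow> r \<le> s \<longrightarrow> 0 < be r)) \<and> \<not> (\<forall>s\<ge>t. 0 < be s \<and> al s < pi)"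
proof -
  obtain T0 where T0: "T0 < s_max" "\<And>s. s \<le> T0 \<Longrightarrow> g s \<le> 5/16" "\<And>s. s \<le> T0 \<Longrightarrow> exp s / 4 \<le> dg s"
    using potential_near_bot by blast
  \<comment> \<open>chosen so that losing energy at rate \<open>c e\<^bsup>s_max\<^esup>/32\<close> for this time costs \<open>2 c g(s_max)\<close>\<close>
  define M where "M = 64 * g s_max * exp (- s_max)"
  have M: "M > 0" using g_pos by (simp add: M_def)
  define T where "T = T0 - 4 - M"
  show ?thesis
  proof (rule that[of T])
    show "T < s_max" using T0 M by (simp add: T_def)
    fix al be t
    assume S: "sol al be" and t: "t \<le> T" "al t = pi/2" "0 < be t"
      and Et: "1/4 - g t \<le> energy al be t" "energy al be t \<le> 0"
    have t4: "t + 4 \<le> T0 - M" "t + 4 < T0" "t + 4 < s_max" using t(1) M T0(1) by (auto simp: T_def)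
    define c where "c = (sin (al s_max))\<^sup>2"
    have key: "energy al be se \<le> - c * g s_max"
      if se: "s_max \<le> se" and be: "\<And>r. t \<le> r \<Longrightarrow> r \<le> se \<Longrightarrow> 0 \<le> be r" and ale: "al se \<le> pi" and al1: "al s_max < pi"
      for se
    proof -
      have mono: "al a \<le> al b" if "t \<le> a" "a \<le> b" "b \<le> se" for a b
        using sol_mono[OF S, of a b] be that by simp
      have half: "pi/2 \<le> al r" if "t \<le> r" "r \<le> se" for r using mono[of t r] that t by simp
      have a: "3*pi/4 \<le> al (t + 4)"
      proof (rule ccontr)
        assume n: "\<not> ?thesis"
        \<comment> \<open>\<open>Z\<^sup>2 \<ge> 1/4 - g cos\<^sup>2 al \<ge> 1/4 - 5/32 > (3/10)\<^sup>2\<close>, and \<open>4 * 3/10 > \<pi>/4\<close>\<close>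
        have be3: "3/10 \<le> be r" if r: "t \<le> r" "r \<le> t + 4" for r
        proof -
          have "al r \<le> al (t + 4)" using mono[of r "t+4"] that t4 se by simp
          then have s2: "1/2 \<le> (sin (al r))\<^sup>2"
            using n half[of r] r t4 se by (intro sin_squared_ge_half) auto
          have "energy al be t + 1 * g t \<le> energy al be r + 1 * g r"
          proof (rule nondecreasing_of_deriv[OF r(1) energy_shift_deriv[OF S]])
            fix q assume q: "t \<le> q" "q \<le> r"
            have "(sin (al q))\<^sup>2 \<le> 1" by (simp add: abs_square_le_1)
            then show "0 \<le> - dg q * ((sin (al q))\<^sup>2 - 1)"
              using dg_sign(2)[of q] q r t4 by (simp add: mult_nonneg_nonpos)
          qed
          then have "1/4 \<le> energy al be r + g r" using Et by simp
          moreover have "g r * (1/2) \<le> g r * (sin (al r))\<^sup>2"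
            using s2 g_pos[of r] by (intro mult_left_mono) auto
          moreover have "g r \<le> 5/16" using T0(2)[of r] r t4 by simp
          ultimately have "(3/10)\<^sup>2 \<le> (w r * be r)\<^sup>2" unfolding energy_def by (simp add: power2_eq_square)
          moreover have b0: "0 \<le> be r" using be[of r] r t4 se by simp
          ultimately have "3/10 \<le> w r * be r"
            using mult_nonneg_nonneg[OF w_bounds(3) b0] by (metis power2_le_imp_le)
          also have "\<dots> \<le> 1 * be r" using w_bounds(2)[of r] b0 by (intro mult_right_mono)
          finally show ?thesis by simp
        qed
        have "al t - 3/10 * t \<le> al (t + 4) - 3/10 * (t + 4)"
        proof (rule nondecreasing_of_deriv[where f = "\<lambda>s. al s - 3/10 * s" and a = t and b = "t + 4"])
          show "((\<lambda>s. al s - 3/10 * s) has_real_derivative be r - 3/10) (at r)" for r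
            by (auto intro!: derivative_eq_intros sol_deriv[OF S])
          show "0 \<le> be r - 3/10" if "t \<le> r" "r \<le> t + 4" for r using be3[OF that] by simp
        qed simp
        then show False using n t(2) pi_less_4 by (simp add: distrib_left)
      qed
      have rng: "3*pi/4 \<le> al r" "al r < pi" if "t + 4 \<le> r" "r \<le> s_max" for r
        using mono[of "t+4" r] mono[of r s_max] a al1 that t4 se by auto
      have cosn: "cos (al r) < 0" if "t + 4 \<le> r" "r \<le> s_max" for r
        using cos_gt_zero_pi[of "pi - al r"] rng[OF that] pi_gt_zero by auto
      have tann: "tan (al r) < 0" if "t + 4 \<le> r" "r \<le> s_max" for r
        using cosn[OF that] sin_gt_zero[of "al r"] rng[OF that] pi_gt_zero
        unfolding tan_def by (intro divide_pos_neg) auto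
      define \<Psi> where "\<Psi> s = cosh ((s - s_max) / 2)" for s
      define \<Psi>1 where "\<Psi>1 s = sinh ((s - s_max) / 2) / 2" for s
      have P: "(\<Psi> has_real_derivative \<Psi>1 s) (at s)" "(\<Psi>1 has_real_derivative \<Psi> s / 4) (at s)" for s
        unfolding \<Psi>_def[abs_def] \<Psi>1_def[abs_def] by (auto intro!: derivative_eq_intros)
      have Ppos: "0 < \<Psi> s" for s by (simp add: \<Psi>_def)
      have P1: "\<bar>\<Psi>1 s\<bar> \<le> \<Psi> s / 2" for s
        using cosh_plus_sinh[of "(s - s_max) / 2"] cosh_minus_sinh[of "(s - s_max) / 2"]
          exp_gt_zero[of "(s - s_max) / 2"] exp_gt_zero[of "- ((s - s_max) / 2)"]
        unfolding \<Psi>_def \<Psi>1_def by linarith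
      let ?W = "\<lambda>s. w s * ((1 + (tan (al s))\<^sup>2) * be s * \<Psi> s - tan (al s) * \<Psi>1 s)"
      \<comment> \<open>\<open>\<Psi>\<close> has slope \<open>0\<close> at \<open>s_max\<close>, so the Wronskian is nonnegative there; to the left it is larger\<close>
      have Wnn: "0 \<le> ?W r" if r: "t + 4 \<le> r" "r \<le> s_max" for r
      proof -
        have "?W s_max \<le> ?W r"
        proof (rule nonincreasing_of_deriv[OF r(2) tan_wronskian_deriv[OF S _ P]])
          fix q assume q: "r \<le> q" "q \<le> s_max"
          then have q': "t + 4 \<le> q" "q \<le> s_max" using r by auto
          show "cos (al q) \<noteq> 0" using cosn[OF q'] by simp
          have "(real k - 1) * logistic q * (- \<Psi>1 q) \<le> (real k - 1) * logistic q * (\<Psi> q / 2)"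
            using P1[of q] rk2 logistic_bounds[of q] by (intro mult_left_mono) auto
          also have "\<dots> \<le> (H q - 1/4) * \<Psi> q"
          proof -
            have "(real k - 1) * logistic q / 2 \<le> H q - 1/4"
            proof -
              have "(2 * real k - 2) * logistic q \<le> (4 * real k - 1) * logistic q"
                using rk2 logistic_bounds[of q] by (intro mult_right_mono) auto
              then show ?thesis unfolding H_def by (simp add: algebra_simps add_divide_distrib diff_divide_distrib)
            qed
            from mult_right_mono[OF this less_imp_le[OF Ppos[of q]]] show ?thesis by (simp add: algebra_simps diff_divide_distrib)
          qed
          finally have "0 \<le> H q * \<Psi> q - \<Psi> q / 4 + (real k - 1) * logistic q * \<Psi>1 q" by (simp add: algebra_simps)
          moreover have "0 \<le> 2 * (1 + (tan (al q))\<^sup>2) * (be q)\<^sup>2 * \<Psi> q" using Ppos[of q] by (simp add: less_imp_le)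
          ultimately have "0 \<le> (H q + 2 * (1 + (tan (al q))\<^sup>2) * (be q)\<^sup>2) * \<Psi> q - \<Psi> q / 4
              + (real k - 1) * logistic q * \<Psi>1 q" by (simp add: distrib_right)
          moreover have "w q * tan (al q) \<le> 0" using w_bounds(1)[of q] tann[OF q'] by (simp add: mult_nonneg_nonpos)
          ultimately show "w q * tan (al q) * ((H q + 2 * (1 + (tan (al q))\<^sup>2) * (be q)\<^sup>2) * \<Psi> q - \<Psi> q / 4
              + (real k - 1) * logistic q * \<Psi>1 q) \<le> 0" by (rule mult_nonpos_nonneg[rotated])
        qed
        moreover have "0 \<le> ?W s_max"
        proof -
          have "\<Psi>1 s_max = 0" by (simp add: \<Psi>1_def)
          moreover have "0 \<le> be s_max" using be[of s_max] t4 se by simp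
          then have "0 \<le> (1 + (tan (al s_max))\<^sup>2) * be s_max * \<Psi> s_max"
            by (intro mult_nonneg_nonneg add_nonneg_nonneg less_imp_le[OF Ppos]) auto
          ultimately show ?thesis using mult_nonneg_nonneg[OF w_bounds(3)[of s_max]] by simp
        qed
        ultimately show ?thesis by (rule order_trans[rotated])
      qed
      have sinbd: "c * exp (s_max - r) / 8 \<le> (sin (al r))\<^sup>2" if r: "t + 4 \<le> r" "r \<le> s_max" for r
      proof -
        have "tan (al r) / \<Psi> r \<le> tan (al s_max) / \<Psi> s_max"
        proof (rule nondecreasing_of_deriv[OF r(2) tan_quotient_deriv[OF S]])
          fix q assume q: "r \<le> q" "q \<le> s_max"
          then have q': "t + 4 \<le> q" "q \<le> s_max" using r by auto
          show "cos (al q) \<noteq> 0" using cosn[OF q'] by simp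
          show "0 < \<Psi> q" "(\<Psi> has_real_derivative \<Psi>1 q) (at q)" by (fact Ppos P)+
          show "0 \<le> ?W q / (w q * (\<Psi> q)\<^sup>2)"
            by (rule divide_nonneg_nonneg[OF Wnn[OF q'] mult_nonneg_nonneg[OF w_bounds(3) zero_le_power2]])
        qed
        then have "(- tan (al s_max)) * \<Psi> r \<le> - tan (al r)"
          using Ppos[of r] by (simp add: \<Psi>_def field_simps)
        then have "((- tan (al s_max)) * \<Psi> r)\<^sup>2 \<le> (- tan (al r))\<^sup>2"
          using tann[of s_max] t4 Ppos[of r] by (intro power_mono) (auto intro!: mult_nonpos_nonneg)
        then have t2: "(tan (al s_max))\<^sup>2 * (\<Psi> r)\<^sup>2 \<le> (tan (al r))\<^sup>2" by (simp add: power_mult_distrib)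
        have c1: "c \<le> (tan (al s_max))\<^sup>2"
        proof -
          have cn: "cos (al s_max) \<noteq> 0" using cosn[of s_max] t4 by simp
          have "(cos (al s_max))\<^sup>2 \<le> 1" by (simp add: abs_square_le_1)
          from mult_left_mono[OF this, of "(tan (al s_max))\<^sup>2"] show ?thesis
            using cn by (simp add: c_def tan_def power_divide)
        qed
        have c2: "exp (s_max - r) / 4 \<le> (\<Psi> r)\<^sup>2"
        proof -
          have "exp ((s_max - r) / 2) / 2 \<le> \<Psi> r" unfolding \<Psi>_def cosh_field_def
            by (simp add: minus_divide_left)
          then have "(exp ((s_max - r) / 2) / 2)\<^sup>2 \<le> (\<Psi> r)\<^sup>2" by (intro power_mono) auto
          moreover have "(exp ((s_max - r) / 2))\<^sup>2 = exp (s_max - r)"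
            unfolding power2_eq_square exp_add[symmetric] field_sum_of_halves ..
          ultimately show ?thesis by (simp add: power_divide)
        qed
        have "c * (exp (s_max - r) / 4) \<le> (tan (al s_max))\<^sup>2 * (\<Psi> r)\<^sup>2"
          by (intro mult_mono c1 c2) auto
        then have c3: "c * (exp (s_max - r) / 4) \<le> (tan (al r))\<^sup>2" using t2 by linarith
        have "1/2 \<le> (cos (al r))\<^sup>2" using rng[OF r] by (intro cos_squared_ge_half) auto
        then have "(c * (exp (s_max - r) / 4)) * (1/2) \<le> (tan (al r))\<^sup>2 * (cos (al r))\<^sup>2"
          using c3 by (intro mult_mono) (auto simp: c_def)
        also have "\<dots> = (sin (al r))\<^sup>2" using cosn[OF r] by (simp add: tan_def power_divide)
        finally show ?thesis by simp
      qed
      define m where "m = c * exp s_max / 32"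
      have "energy al be T0 + m * T0 \<le> energy al be (t + 4) + m * (t + 4)"
      proof (rule nonincreasing_of_deriv[where f = "\<lambda>s. energy al be s + m * s" and a = "t + 4" and b = T0])
        show "t + 4 \<le> T0" using t4 by simp
        show "((\<lambda>s. energy al be s + m * s) has_real_derivative - dg r * (sin (al r))\<^sup>2 + m) (at r)" for r
          by (auto intro!: derivative_eq_intros energy_deriv[OF S])
        fix r assume r: "t + 4 \<le> r" "r \<le> T0"
        have "(exp r / 4) * (c * exp (s_max - r) / 8) \<le> dg r * (sin (al r))\<^sup>2"
          using T0(3)[of r] sinbd[of r] r T0(1)
          by (intro mult_mono) (auto simp: c_def intro: order_trans[OF _ T0(3)[of r]])
        moreover have "(exp r / 4) * (c * exp (s_max - r) / 8) = m" by (simp add: m_def exp_diff)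
        ultimately show "- dg r * (sin (al r))\<^sup>2 + m \<le> 0" by simp
      qed
      moreover have "energy al be (t + 4) \<le> 0" using energy_nonincreasing[OF S, of t "t+4"] t4 Et by simp
      moreover have "m * M \<le> m * (T0 - (t + 4))" using t4 by (intro mult_left_mono) (auto simp: m_def c_def)
      moreover have "m * M = 2 * c * g s_max" by (simp add: m_def M_def exp_minus field_simps)
      ultimately have "energy al be T0 \<le> - 2 * c * g s_max" by (simp add: algebra_simps)
      then have E1: "energy al be s_max \<le> - 2 * c * g s_max" using energy_nonincreasing[OF S, of T0 s_max] T0 by simp
      have "energy al be se + c * g se \<le> energy al be s_max + c * g s_max"
      proof (rule nonincreasing_of_deriv[OF se energy_shift_deriv[OF S]])
        fix q assume q: "s_max \<le> q" "q \<le> se"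
        have "al s_max \<le> al q" "al q \<le> pi" "pi/2 \<le> al s_max"
          using mono[of s_max q] mono[of q se] half[of s_max] ale q t4 by auto
        then have "sin (al q) \<le> sin (al s_max)" "0 \<le> sin (al q)"
          using cos_monotone_0_pi_le[of "al s_max - pi/2" "al q - pi/2"] by (auto simp: cos_diff intro: sin_ge_zero)
        then have "(sin (al q))\<^sup>2 \<le> c" unfolding c_def by (intro power_mono)
        then show "- dg q * ((sin (al q))\<^sup>2 - c) \<le> 0"
          using dg_sign(4)[of q] q by (simp add: mult_nonpos_nonpos)
      qed
      moreover have "0 \<le> c * g se" using g_pos[of se] by (simp add: c_def)
      ultimately show ?thesis using E1 by simp
    qed
    have cpos: "0 < c" if "pi/2 \<le> al s_max" "al s_max < pi"
      using sin_gt_zero[of "al s_max"] that pi_gt_zero by (simp add: c_def)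
    show "\<not> (\<exists>s\<ge>t. pi < al s \<and> (\<forall>r. t \<le> r \<longrightarrow> r \<le> s \<longrightarrow> 0 < be r)) \<and> \<not> (\<forall>s\<ge>t. 0 < be s \<and> al s < pi)"
    proof (intro conjI notI)
      assume "\<exists>s\<ge>t. pi < al s \<and> (\<forall>r. t \<le> r \<longrightarrow> r \<le> s \<longrightarrow> 0 < be r)"
      then obtain s where s: "t \<le> s" "pi < al s" "\<And>r. t \<le> r \<Longrightarrow> r \<le> s \<Longrightarrow> 0 < be r" by blast
      obtain se where se: "t \<le> se" "se \<le> s" "al se = pi"
        using IVT'[of al t pi s] s t sol_continuous(1)[OF S] by auto
      have bpos: "0 < be r" if "t \<le> r" "r \<le> se" for r using s(3) that se by simp
      have Epos: "0 < energy al be se"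
        using w_bounds(4)[of se] bpos[of se] se(1) unfolding energy_def se(3) by simp
      show False
      proof (cases "se \<le> s_max")
        case True
        then show False using energy_nonincreasing[OF S, of t se] se Et Epos by simp
      next
        case False
        have "al s_max < al se"
        proof (rule DERIV_pos_imp_increasing[where f = al])
          show "s_max < se" using False by simp
          show "\<exists>y. (al has_real_derivative y) (at r) \<and> 0 < y" if "s_max \<le> r" "r \<le> se" for r
            using sol_deriv(1)[OF S, of r] bpos[of r] that t4 by auto
        qed
        moreover have "pi/2 \<le> al s_max"
          using sol_mono[OF S, of t s_max] bpos t False t4 by (simp add: less_imp_le)
        ultimately have "0 < c" using cpos se by simp
        moreover have "energy al be se \<le> - c * g s_max"
          by (rule key) (use False bpos se \<open>al s_max < al se\<close> in \<open>auto simp: less_imp_le\<close>)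
        ultimately show False using Epos g_pos[of s_max] by (smt (verit) mult_neg_pos)
      qed
    next
      assume A: "\<forall>s\<ge>t. 0 < be s \<and> al s < pi"
      have "pi/2 \<le> al s_max"
        using sol_mono[OF S, of t s_max] A t t4 by (simp add: less_imp_le)
      then have c: "0 < c" using cpos A t4 by simp
      have "eventually (\<lambda>s. g s < c * g s_max) at_top"
        using g_tendsto_top by (rule order_tendstoD) (use c g_pos in simp)
      then obtain N where N: "\<And>s. N \<le> s \<Longrightarrow> g s < c * g s_max" by (auto simp: eventually_at_top_linorder)
      define se where "se = max N s_max"
      have "energy al be se \<le> - c * g s_max"
      proof (rule key)
        show "s_max \<le> se" by (simp add: se_def)
        then show "al se \<le> pi" "al s_max < pi" using A t4 by (auto simp: less_imp_le)
        show "0 \<le> be r" if "t \<le> r" for r using A that by (simp add: less_imp_le)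
      qed
      moreover have "- g se \<le> energy al be se"
      proof -
        have "(sin (al se))\<^sup>2 \<le> 1" by (simp add: abs_square_le_1)
        then have "g se * (sin (al se))\<^sup>2 \<le> g se * 1" using g_pos[of se] by (intro mult_left_mono) auto
        then show ?thesis unfolding energy_def by (smt (verit) zero_le_power2)
      qed
      ultimately show False using N[of se] by (simp add: se_def)
    qed
  qed
qed

section \<open>Shooting\<close>

definition crosses_pi :: "(real \<Rightarrow> real) \<Rightarrow> (real \<Rightarrow> real) \<Rightarrow> real \<Rightarrow> bool" where
  "crosses_pi al be t \<longleftrightarrow> (\<exists>s\<ge>t. pi < al s \<and> (\<forall>r. t \<le> r \<longrightarrow> r \<le> s \<longrightarrow> 0 < be r))"
definition turns_back :: "(real \<Rightarrow> real) \<Rightarrow> (real \<Rightarrow> real) \<Rightarrow> real \<Rightarrow> bool" where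
  "turns_back al be t \<longleftrightarrow> (\<exists>s\<ge>t. be s < 0 \<and> (\<forall>r. t \<le> r \<longrightarrow> r \<le> s \<longrightarrow> al r < pi))"
definition stays_monotone :: "(real \<Rightarrow> real) \<Rightarrow> (real \<Rightarrow> real) \<Rightarrow> real \<Rightarrow> bool" where
  "stays_monotone al be t \<longleftrightarrow> (\<forall>s\<ge>t. 0 < be s \<and> al s < pi)"

lemma crosses_pi_not_turns_back: "crosses_pi al be t \<Longrightarrow> \<not> turns_back al be t"
proof (rule notI)
  assume "crosses_pi al be t" "turns_back al be t"
  then obtain s q where s: "t \<le> s" "pi < al s" "\<And>r. t \<le> r \<Longrightarrow> r \<le> s \<Longrightarrow> 0 < be r"
    and q: "t \<le> q" "be q < 0" "\<And>r. t \<le> r \<Longrightarrow> r \<le> q \<Longrightarrow> al r < pi"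
    unfolding crosses_pi_def turns_back_def by blast
  show False using s(3)[of q] q(3)[of s] s(1,2) q(1,2) by (metis less_asym linear)
qed

lemma sol_strict_mono:
  assumes "sol al be" "a < b" "\<And>s. a \<le> s \<Longrightarrow> s \<le> b \<Longrightarrow> 0 < be s"
  shows "al a < al b"
proof (rule DERIV_pos_imp_increasing[where f = al, OF assms(2)])
  show "\<exists>y. (al has_real_derivative y) (at r) \<and> 0 < y" if "a \<le> r" "r \<le> b" for r
    using sol_deriv(1)[OF assms(1), of r] assms(3)[OF that] by auto
qed

text \<open>
By uniqueness a solution cannot meet the constant solutions tangentially, so the first failure of
monotonicity or of the bound \<open>al < \<pi>\<close> is transversal and falls into exactly one of the two open
conditions.
\<close>

lemma monotone_trichotomy:
  assumes S: "sol al be" and t: "0 < al t" "al t < pi" "0 < be t"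
    and n: "\<not> crosses_pi al be t" "\<not> turns_back al be t"
  shows "stays_monotone al be t"
proof -
  have const: False if "be c = 0" "sin (al c) * cos (al c) = 0" for c
    using sol_unique(2)[OF S sol_const[OF that(2)], of c t] that t(3) by simp
  define f where "f s = min (be s) (pi - al s)" for s
  have fpos: "0 < f s" if "t \<le> s" for s
  proof (rule ccontr)
    assume "\<not> 0 < f s"
    then have 1: "f s \<le> 0" by simp
    have 2: "0 < f t" using t by (simp add: f_def)
    have "continuous_on {t..s} f" unfolding f_def by (intro continuous_intros sol_continuous[OF S])
    from first_zero[OF this that 2 1] obtain c where
      c: "t < c" "c \<le> s" "f c = 0" and cp: "\<And>r. t \<le> r \<Longrightarrow> r < c \<Longrightarrow> 0 < f r" by metis
    have bp: "0 < be r" "al r < pi" if "t \<le> r" "r < c" for r using cp[OF that] by (auto simp: f_def)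
    have c0: "0 \<le> be c" "al c \<le> pi" using c(3) by (auto simp: f_def min_def split: if_splits)
    have alc: "al t \<le> al c"
    proof (rule sol_mono[OF S])
      show "0 \<le> be r" if "t \<le> r" "r \<le> c" for r
        using bp[of r] that c0 by (cases "r = c") (auto simp: less_imp_le)
    qed (use c in simp)
    show False
    proof (cases "al c = pi")
      case True
      then have bc: "0 < be c" using const[of c] c0 by force
      have "isCont be c" using sol_continuous(2)[OF S, of UNIV] by (simp add: continuous_on_eq_continuous_at)
      then have "eventually (\<lambda>r. 0 < be r) (at c)"
        using bc unfolding isCont_def by (rule order_tendstoD)
      then obtain d where d: "d > 0" "\<And>r. r \<noteq> c \<Longrightarrow> dist r c < d \<Longrightarrow> 0 < be r"
        unfolding eventually_at by auto
      define q where "q = c + d / 2"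
      have bq: "0 < be r" if "t \<le> r" "r \<le> q" for r
        using bp[of r] bc d(2)[of r] that d(1) by (cases r c rule: linorder_cases) (auto simp: q_def dist_real_def)
      have "al c < al q"
        by (rule sol_strict_mono[OF S]) (use d bq c in \<open>auto simp: q_def\<close>)
      then have "crosses_pi al be t"
        unfolding crosses_pi_def using True bq c d by (intro exI[of _ q]) (auto simp: q_def)
      then show False using n by simp
    next
      case False
      then have b0: "be c = 0" using c(3) by (auto simp: f_def min_def split: if_splits)
      define l where "l = (real k - 1) * logistic c * be c + H c * (sin (al c) * cos (al c))"
      have D: "(be has_real_derivative l) (at c)" unfolding l_def by (rule sol_deriv(2)[OF S])
      consider "l < 0" | "l = 0" | "l > 0" by linarith
      then show False
      proof cases
        case 1
        then obtain d where d: "d > 0" "\<And>h. h > 0 \<Longrightarrow> h < d \<Longrightarrow> be (c + h) < be c"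
          using DERIV_neg_dec_right[OF D] by metis
        have "isCont al c" using sol_continuous(1)[OF S, of UNIV] by (simp add: continuous_on_eq_continuous_at)
        then have "eventually (\<lambda>r. al r < pi) (at c)"
          using False c0 unfolding isCont_def by (intro order_tendstoD(2)) auto
        then obtain e where e: "e > 0" "\<And>r. r \<noteq> c \<Longrightarrow> dist r c < e \<Longrightarrow> al r < pi"
          unfolding eventually_at by auto
        define h where "h = min d e / 2"
        have h: "h > 0" "h < d" "h < e" using d(1) e(1) by (auto simp: h_def)
        have "al r < pi" if "t \<le> r" "r \<le> c + h" for r
          using bp(2)[of r] e(2)[of r] that h False c0
          by (cases r c rule: linorder_cases) (auto simp: dist_real_def)
        then have "turns_back al be t"
          unfolding turns_back_def using d(2)[of h] h b0 c(1) by (intro exI[of _ "c + h"]) auto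
        then show False using n by simp
      next
        case 2
        then have "sin (al c) * cos (al c) = 0" using b0 H_bounds(3)[of c] by (simp add: l_def)
        then show False using const b0 by blast
      next
        case 3
        then obtain d where d: "d > 0" "\<And>h. h > 0 \<Longrightarrow> h < d \<Longrightarrow> be (c - h) < be c"
          using DERIV_pos_inc_left[OF D] by metis
        define h where "h = min d (c - t) / 2"
        have h: "h > 0" "h < d" "t \<le> c - h" using d(1) c(1) by (auto simp: h_def min_def field_simps)
        show False using d(2)[OF h(1,2)] bp(1)[of "c - h"] h b0 by simp
      qed
    qed
  qed
  show ?thesis unfolding stays_monotone_def
  proof (intro allI impI)
    fix s assume "t \<le> s"
    from fpos[OF this] show "0 < be s \<and> al s < pi" by (simp add: f_def)
  qed
qed

lemma abs_sin_diff_le: "\<bar>sin x - sin y\<bar> \<le> \<bar>x - y\<bar>" for x y :: real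
proof -
  have "\<bar>sin x - sin y\<bar> = 2 * (\<bar>sin ((x - y) / 2)\<bar> * \<bar>cos ((x + y) / 2)\<bar>)"
    by (simp add: sin_diff_sin abs_mult)
  also have "\<dots> \<le> 2 * (\<bar>(x - y) / 2\<bar> * 1)"
    by (intro mult_left_mono mult_mono abs_sin_x_le_abs_x abs_cos_le_one) auto
  finally show ?thesis by simp
qed

text \<open>
The initial data \<open>(\<epsilon>, \<surd>H sin \<epsilon>)\<close> have energy \<open>0\<close>. For small \<open>\<epsilon>\<close> the solution crosses \<open>\<pi>\<close>, for
\<open>\<epsilon> = \<pi>/2\<close> it turns back, and both conditions are open in \<open>\<epsilon>\<close>; the interval of parameters is
connected, so some \<open>\<epsilon>\<close> satisfies neither.
\<close>

lemma shooting:
  assumes t: "t < s_max"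
    and right_end: "\<And>al be. \<lbrakk>sol al be; al t = pi/2; 0 < be t; 1/4 - g t \<le> energy al be t; energy al be t \<le> 0\<rbrakk>
      \<Longrightarrow> \<not> crosses_pi al be t \<and> \<not> stays_monotone al be t"
  obtains al be where "sol al be" "0 < al t" "al t \<le> pi/2" "energy al be t = 0" "stays_monotone al be t"
proof (rule ccontr)
  assume none: "\<not> thesis"
  define I where "I = {0<..pi/2}"
  have "\<forall>e. \<exists>al be. sol al be \<and> al t = e \<and> be t = sqrt (H t) * sin e"
    using sol_exists by metis
  then obtain A B where AB: "\<And>e. sol (A e) (B e)" "\<And>e. A e t = e" "\<And>e. B e t = sqrt (H t) * sin e"
    by metis
  have Et: "energy (A e) (B e) t = 0" for e
    using H_bounds(4)[of t] by (simp add: energy_def AB g_def power_mult_distrib)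
  have Bpos: "0 < B e t" if "e \<in> I" for e
    using that H_bounds(3)[of t] sin_gt_zero[of e] by (auto simp: AB I_def)
  have rng: "0 < A e t" "A e t < pi" if "e \<in> I" for e using that by (auto simp: AB I_def)
  define C where "C S = exp (2 * real k * (S - t)) * (1 + sqrt (H t))" for S
  have Cpos: "0 < C S" for S using H_bounds(4)[of t] by (simp add: C_def add_pos_nonneg)
  have dep: "\<bar>A e s - A d s\<bar> \<le> C S * \<bar>e - d\<bar>" "\<bar>B e s - B d s\<bar> \<le> C S * \<bar>e - d\<bar>"
    if s: "t \<le> s" "s \<le> S" for e d s S
  proof -
    have "norm (A e t - A d t, B e t - B d t) \<le> \<bar>e - d\<bar> + \<bar>sqrt (H t) * (sin e - sin d)\<bar>"
      by (simp add: AB norm_Pair sqrt_sum_squares_le_sum_abs flip: right_diff_distrib)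
    also have "\<dots> \<le> \<bar>e - d\<bar> + sqrt (H t) * \<bar>e - d\<bar>"
      using H_bounds(4)[of t] by (auto simp: abs_mult intro!: mult_left_mono abs_sin_diff_le)
    also have "\<dots> = (1 + sqrt (H t)) * \<bar>e - d\<bar>" by (simp add: algebra_simps)
    finally have a: "norm (A e t - A d t, B e t - B d t) \<le> (1 + sqrt (H t)) * \<bar>e - d\<bar>" .
    have "norm (A e s - A d s, B e s - B d s)
        \<le> exp (2 * real k * \<bar>s - t\<bar>) * norm (A e t - A d t, B e t - B d t)"
      by (rule sol_dependence[OF AB(1) AB(1)])
    also have "\<dots> \<le> exp (2 * real k * (S - t)) * ((1 + sqrt (H t)) * \<bar>e - d\<bar>)"
      using s by (intro mult_mono a) (auto intro!: mult_left_mono)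
    also have "\<dots> = C S * \<bar>e - d\<bar>" by (simp add: C_def)
    finally have n: "norm (A e s - A d s, B e s - B d s) \<le> C S * \<bar>e - d\<bar>" .
    show "\<bar>A e s - A d s\<bar> \<le> C S * \<bar>e - d\<bar>" "\<bar>B e s - B d s\<bar> \<le> C S * \<bar>e - d\<bar>"
      using norm_fst_le[of "A e s - A d s" "B e s - B d s"]
        norm_snd_le[of "B e s - B d s" "A e s - A d s"] n by auto
  qed
  have minatt: "\<exists>m>0. \<forall>r\<in>{t..s}. m \<le> f r"
    if h: "t \<le> s" "continuous_on {t..s} f" "\<And>r. t \<le> r \<Longrightarrow> r \<le> s \<Longrightarrow> 0 < f r" for f :: "real \<Rightarrow> real" and s
  proof -
    obtain x where "x \<in> {t..s}" "\<forall>y\<in>{t..s}. f x \<le> f y"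
      using continuous_attains_inf[of "{t..s}" f] h(1,2) by auto
    then show ?thesis using h(3)[of x] by auto
  qed
  define U where "U = {e \<in> I. crosses_pi (A e) (B e) t}"
  define V where "V = {e \<in> I. turns_back (A e) (B e) t}"
  have Uo: "\<exists>\<delta>>0. \<forall>d\<in>I. dist d e < \<delta> \<longrightarrow> d \<in> U" if eU: "e \<in> U" for e
  proof -
    obtain s where s: "t \<le> s" "pi < A e s" "\<And>r. t \<le> r \<Longrightarrow> r \<le> s \<Longrightarrow> 0 < B e r"
      using eU unfolding U_def crosses_pi_def by blast
    obtain m where m: "m > 0" "\<And>r. t \<le> r \<Longrightarrow> r \<le> s \<Longrightarrow> m \<le> B e r"
      using minatt[OF s(1) sol_continuous(2)[OF AB(1)] s(3)] by auto
    define \<delta> where "\<delta> = min m (A e s - pi) / C s"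
    have \<delta>: "\<delta> > 0" "C s * \<delta> \<le> m" "C s * \<delta> \<le> A e s - pi"
      using m(1) s(2) Cpos[of s] by (auto simp: \<delta>_def)
    show ?thesis
    proof (intro exI[of _ \<delta>] conjI ballI impI \<delta>(1))
      fix d assume d: "d \<in> I" "dist d e < \<delta>"
      have Cd: "C s * \<bar>e - d\<bar> < C s * \<delta>" using d Cpos[of s] by (auto simp: dist_real_def)
      have "pi < A d s" using dep(1)[of s s e d] s(1) Cd \<delta>(3) by linarith
      moreover have "0 < B d r" if "t \<le> r" "r \<le> s" for r
        using dep(2)[of r s e d] that Cd \<delta>(2) m(2)[OF that] by linarith
      ultimately show "d \<in> U" using d(1) s(1) unfolding U_def crosses_pi_def by blast
    qed
  qed
  have Vo: "\<exists>\<delta>>0. \<forall>d\<in>I. dist d e < \<delta> \<longrightarrow> d \<in> V" if eV: "e \<in> V" for e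
  proof -
    obtain s where s: "t \<le> s" "B e s < 0" "\<And>r. t \<le> r \<Longrightarrow> r \<le> s \<Longrightarrow> A e r < pi"
      using eV unfolding V_def turns_back_def by blast
    have "\<exists>m>0. \<forall>r\<in>{t..s}. m \<le> pi - A e r"
      by (rule minatt[OF s(1)]) (use s(3) in \<open>auto intro!: continuous_intros sol_continuous[OF AB(1)]\<close>)
    then obtain m where m: "m > 0" "\<And>r. t \<le> r \<Longrightarrow> r \<le> s \<Longrightarrow> m \<le> pi - A e r"
      by auto
    define \<delta> where "\<delta> = min m (- B e s) / C s"
    have \<delta>: "\<delta> > 0" "C s * \<delta> \<le> m" "C s * \<delta> \<le> - B e s"
      using m(1) s(2) Cpos[of s] by (auto simp: \<delta>_def)
    show ?thesis
    proof (intro exI[of _ \<delta>] conjI ballI impI \<delta>(1))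
      fix d assume d: "d \<in> I" "dist d e < \<delta>"
      have Cd: "C s * \<bar>e - d\<bar> < C s * \<delta>" using d Cpos[of s] by (auto simp: dist_real_def)
      have "B d s < 0" using dep(2)[of s s e d] s(1) Cd \<delta>(3) by linarith
      moreover have "A d r < pi" if "t \<le> r" "r \<le> s" for r
        using dep(1)[of r s e d] that Cd \<delta>(2) m(2)[OF that] by linarith
      ultimately show "d \<in> V" using d(1) s(1) unfolding V_def turns_back_def by blast
    qed
  qed
  have op: "openin (top_of_set I) W" if "\<And>e. e \<in> W \<Longrightarrow> \<exists>\<delta>>0. \<forall>d\<in>I. dist d e < \<delta> \<longrightarrow> d \<in> W" "W \<subseteq> I" for W
    using that unfolding openin_euclidean_subtopology_iff by blast
  have cover: "I \<subseteq> U \<union> V"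
  proof
    fix e assume e: "e \<in> I"
    have "\<not> stays_monotone (A e) (B e) t"
      using none that[OF AB(1)[of e] rng(1)[OF e] _ Et[of e]] e by (auto simp: AB I_def)
    then have "crosses_pi (A e) (B e) t \<or> turns_back (A e) (B e) t"
      using monotone_trichotomy[OF AB(1) rng[OF e] Bpos[OF e]] by blast
    then show "e \<in> U \<union> V" using e by (auto simp: U_def V_def)
  qed
  have pi2: "pi/2 \<in> I" by (auto simp: I_def)
  have "pi/2 \<notin> U"
    using right_end[OF AB(1), of "pi/2"] AB(2) Bpos[OF pi2] Et[of "pi/2"] g_gt_quarter[OF t]
    by (auto simp: U_def)
  then have Vne: "V \<noteq> {}" using cover pi2 by auto
  \<comment> \<open>close enough to the zero solution to stay below \<open>1 < \<pi>/2\<close> up to \<open>s_low\<close>\<close>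
  define e where "e = min (pi/2) (1 / C s_low)"
  have e: "e \<in> I" using Cpos[of s_low] by (auto simp: I_def e_def)
  have A0: "A 0 s = 0" for s
    using sol_unique(1)[OF AB(1) sol_const[of 0], of 0 t s] by (simp add: AB)
  have small: "A e s \<le> pi/2" if "t \<le> s" "s \<le> s_low" for s
  proof -
    have "\<bar>A e s - A 0 s\<bar> \<le> C s_low * \<bar>e - 0\<bar>" by (rule dep(1)[OF that])
    also have "\<dots> = C s_low * e" using e by (simp add: I_def)
    also have "\<dots> \<le> C s_low * (1 / C s_low)" using Cpos[of s_low] by (intro mult_left_mono) (auto simp: e_def)
    also have "\<dots> = 1" using Cpos[of s_low] by simp
    finally show ?thesis using pi_gt3 by (simp add: A0)
  qed
  have E0: "0 \<le> energy (A e) (B e) t" by (simp add: Et)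
  have "crosses_pi (A e) (B e) t"
    using late_crossing[OF AB(1) t rng(1)[OF e] Bpos[OF e] E0 small] unfolding crosses_pi_def by metis
  then have Une: "U \<noteq> {}" using e by (auto simp: U_def)
  have "U \<inter> V = {}" using crosses_pi_not_turns_back by (auto simp: U_def V_def)
  moreover have "connected I" by (simp add: I_def)
  ultimately show False
    using connected_openin[of I] op[OF Uo] op[OF Vo] cover Une Vne
    by (metis (no_types, lifting) U_def V_def mem_Collect_eq subsetI)
qed

text \<open>
Before \<open>s_max\<close> the energy decreases; a positive value after \<open>s_max\<close> would persist and drive the solution
to \<open>\<pi>\<close> in finite time.
\<close>

lemma nonpositive_energy:
  assumes S: "sol al be" and t: "t \<le> s_max" "energy al be t = 0" and m: "stays_monotone al be t" and s: "t \<le> s"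
  shows "energy al be s \<le> 0"
proof (cases "s \<le> s_max")
  case True
  then show ?thesis using energy_nonincreasing[OF S s] t by simp
next
  case False
  show ?thesis
  proof (rule ccontr)
    assume n: "\<not> ?thesis"
    define e where "e = sqrt (energy al be s)"
    have e: "e > 0" "e\<^sup>2 = energy al be s" using n by (auto simp: e_def)
    have be: "0 < be r" "al r < pi" if "s \<le> r" for r using m s that by (auto simp: stays_monotone_def)
    have bege: "e \<le> be r" if "s \<le> r" for r
    proof -
      have "energy al be s \<le> energy al be r"
      proof (rule nondecreasing_of_deriv[OF that energy_deriv[OF S]])
        show "0 \<le> - dg q * (sin (al q))\<^sup>2" if "s \<le> q" for q
          using dg_sign(4)[of q] that False by (simp add: mult_nonpos_nonneg)
      qed
      moreover have "0 \<le> g r * (sin (al r))\<^sup>2" using g_pos[of r] by simp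
      ultimately have "e\<^sup>2 \<le> (w r * be r)\<^sup>2" unfolding e(2) energy_def[of al be r] by linarith
      moreover have "0 \<le> w r * be r" by (rule mult_nonneg_nonneg[OF w_bounds(3) less_imp_le[OF be(1)[OF that]]])
      ultimately have "e \<le> w r * be r" by (rule power2_le_imp_le)
      also have "\<dots> \<le> 1 * be r" by (rule mult_right_mono[OF w_bounds(2) less_imp_le[OF be(1)[OF that]]])
      finally show ?thesis by simp
    qed
    define q where "q = s + (pi - al s) / e"
    have q: "s \<le> q" using be(2)[of s] e(1) by (simp add: q_def)
    have "al s - e * s \<le> al q - e * q"
    proof (rule nondecreasing_of_deriv[OF q, where f = "\<lambda>s. al s - e * s"])
      show "((\<lambda>s. al s - e * s) has_real_derivative be r - e) (at r)" for r
        by (auto intro!: derivative_eq_intros sol_deriv[OF S])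
      show "0 \<le> be r - e" if "s \<le> r" for r using bege[OF that] by simp
    qed
    then have "al s + e * (q - s) \<le> al q" by (simp add: algebra_simps)
    then have "pi \<le> al q" using e(1) by (simp add: q_def)
    then show False using be(2)[OF q] by simp
  qed
qed

lemma slope_le:
  assumes "energy al be s \<le> 0" shows "(be s)\<^sup>2 \<le> H s * (sin (al s))\<^sup>2"
proof -
  have "(w s)\<^sup>2 * (be s)\<^sup>2 \<le> (w s)\<^sup>2 * (H s * (sin (al s))\<^sup>2)"
    using assms by (simp add: energy_def g_def power_mult_distrib mult.assoc)
  then show ?thesis using w_bounds(4)[of s] by simp
qed

text \<open>
The bounds on the crossing point \<open>c\<close> do not depend on the starting point \<open>t\<close>; they make the compactness
argument work. The last inequality keeps the limit away from the constant solution \<open>\<pi>/2\<close>, whose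
energy is \<open>- g\<close>.
\<close>

lemma truncated_solutions:
  obtains T where
    "\<And>t. t \<le> T \<Longrightarrow> \<exists>al be c. sol al be \<and> T \<le> c \<and> c \<le> s_low \<and> al c = pi/2 \<and>
      (\<forall>s\<ge>t. 0 < be s \<and> 0 < al s \<and> al s < pi \<and> energy al be s \<le> 0 \<and> (s \<le> s_max \<longrightarrow> 1/4 \<le> energy al be s + g s))"
proof -
  obtain T where T: "T < s_max" and
    early: "\<And>al be t. \<lbrakk>sol al be; t \<le> T; al t = pi/2; 0 < be t; 1/4 - g t \<le> energy al be t; energy al be t \<le> 0\<rbrakk> \<Longrightarrow>
      \<not> crosses_pi al be t \<and> \<not> stays_monotone al be t"
    using early_crossing unfolding crosses_pi_def stays_monotone_def by metis
  show ?thesis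
  proof (rule that[of T])
    fix t assume tT: "t \<le> T"
    then have ts: "t < s_max" using T by simp
    obtain al be where S: "sol al be" and a: "0 < al t" "al t \<le> pi/2" "energy al be t = 0" and m: "stays_monotone al be t"
    proof (rule shooting[OF ts])
      show "\<not> crosses_pi al be t \<and> \<not> stays_monotone al be t"
        if "sol al be" "al t = pi/2" "0 < be t" "1/4 - g t \<le> energy al be t" "energy al be t \<le> 0" for al be
        using early[OF that(1) tT that(2-5)] .
    qed
    have be: "0 < be s" "al s < pi" if "t \<le> s" for s using m that by (auto simp: stays_monotone_def)
    have apos: "0 < al s" if "t \<le> s" for s
      using sol_mono[OF S that] be(1) a(1) by (smt (verit))
    have Eg: "1/4 \<le> energy al be s + g s" if s: "t \<le> s" "s \<le> s_max" for s
    proof -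
      have "energy al be t + 1 * g t \<le> energy al be s + 1 * g s"
      proof (rule nondecreasing_of_deriv[OF s(1) energy_shift_deriv[OF S]])
        fix q assume q: "t \<le> q" "q \<le> s"
        have "(sin (al q))\<^sup>2 \<le> 1" by (simp add: abs_square_le_1)
        then show "0 \<le> - dg q * ((sin (al q))\<^sup>2 - 1)"
          using dg_sign(2)[of q] q s by (simp add: mult_nonneg_nonpos)
      qed
      then show ?thesis using a(3) g_gt_quarter[OF ts] by simp
    qed
    note E0 = nonpositive_energy[OF S less_imp_le[OF ts] a(3) m]
    have "\<exists>c0. t \<le> c0 \<and> c0 \<le> s_low \<and> pi/2 < al c0"
    proof (rule ccontr)
      assume "\<not> ?thesis"
      then have "\<And>s. t \<le> s \<Longrightarrow> s \<le> s_low \<Longrightarrow> al s \<le> pi/2" by force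
      from late_crossing[OF S ts a(1) be(1)[OF order_refl] _ this] obtain s where "t \<le> s" "pi < al s"
        using a(3) by (metis order_refl)
      then show False using be(2)[of s] by simp
    qed
    then obtain c0 where c0: "t \<le> c0" "c0 \<le> s_low" "pi/2 < al c0" by blast
    obtain c where c: "t \<le> c" "c \<le> c0" "al c = pi/2"
      using IVT'[of al t "pi/2" c0] a(2) c0 sol_continuous(1)[OF S] by auto
    have "T \<le> c"
    proof (rule ccontr)
      assume "\<not> T \<le> c"
      then have "c \<le> T" by simp
      moreover have "1/4 - g c \<le> energy al be c" using Eg[of c] c(1) \<open>c \<le> T\<close> T by simp
      moreover have "stays_monotone al be c" using m c(1) by (auto simp: stays_monotone_def)
      ultimately show False using early[OF S _ c(3) be(1)[OF c(1)] _ E0[OF c(1)]] by blast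
    qed
    then show "\<exists>al be c. sol al be \<and> T \<le> c \<and> c \<le> s_low \<and> al c = pi/2 \<and>
      (\<forall>s\<ge>t. 0 < be s \<and> 0 < al s \<and> al s < pi \<and> energy al be s \<le> 0 \<and> (s \<le> s_max \<longrightarrow> 1/4 \<le> energy al be s + g s))"
      using S c c0 be apos Eg E0 by (intro exI[of _ al] exI[of _ be] exI[of _ c]) auto
  qed
qed

text \<open>
The data of the truncated solutions at their crossing points lie in a compact set. A limit point of
these data determines a solution to which a subsequence converges pointwise; the weak inequalities survive
the limit and become strict by uniqueness. The final estimate expresses that the energy is nonpositive.
\<close>

lemma entire_solution:
  obtains al be where "sol al be" "\<And>s. 0 < be s" "\<And>s. 0 < al s" "\<And>s. al s < pi"
    "\<And>s. (be s)\<^sup>2 \<le> H s * (sin (al s))\<^sup>2"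
proof -
  obtain T where T: "\<And>t. t \<le> T \<Longrightarrow> \<exists>al be c. sol al be \<and> T \<le> c \<and> c \<le> s_low \<and> al c = pi/2 \<and>
      (\<forall>s\<ge>t. 0 < be s \<and> 0 < al s \<and> al s < pi \<and> energy al be s \<le> 0 \<and> (s \<le> s_max \<longrightarrow> 1/4 \<le> energy al be s + g s))"
    using truncated_solutions by blast
  have "\<forall>n. \<exists>al be c. sol al be \<and> T \<le> c \<and> c \<le> s_low \<and> al c = pi/2 \<and>
      (\<forall>s\<ge>T - real n. 0 < be s \<and> 0 < al s \<and> al s < pi \<and> energy al be s \<le> 0 \<and> (s \<le> s_max \<longrightarrow> 1/4 \<le> energy al be s + g s))"
    by (intro allI T) simp
  then obtain A B c where S: "\<And>n. sol (A n) (B n)" and c: "\<And>n. T \<le> c n" "\<And>n. c n \<le> s_low" "\<And>n. A n (c n) = pi/2"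
    and P: "\<And>n s. T - real n \<le> s \<Longrightarrow> 0 < B n s \<and> 0 < A n s \<and> A n s < pi \<and> energy (A n) (B n) s \<le> 0
        \<and> (s \<le> s_max \<longrightarrow> 1/4 \<le> energy (A n) (B n) s + g s)"
    by metis
  have bd: "(c n, B n (c n)) \<in> {T..s_low} \<times> {0..sqrt (real k)}" for n
  proof -
    have cn: "T - real n \<le> c n" using c(1)[of n] by simp
    then have b: "0 < B n (c n)" "energy (A n) (B n) (c n) \<le> 0" using P[of n "c n"] by auto
    have "(B n (c n))\<^sup>2 \<le> real k" using slope_le[OF b(2)] c(3)[of n] H_bounds(2)[of "c n"] by simp
    then have "B n (c n) \<le> sqrt (real k)" by (rule real_le_rsqrt)
    then show ?thesis using b(1) c by (simp add: less_imp_le)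
  qed
  have "seq_compact ({T..s_low} \<times> {0..sqrt (real k)})"
    by (simp add: compact_imp_seq_compact compact_Times)
  then obtain l r where r: "strict_mono r" "((\<lambda>n. (c n, B n (c n))) \<circ> r) \<longlonglongrightarrow> l"
    unfolding seq_compact_def using bd by meson
  obtain c0 p where l: "l = (c0, p)" by (cases l)
  have cl: "(\<lambda>n. c (r n)) \<longlonglongrightarrow> c0" "(\<lambda>n. B (r n) (c (r n))) \<longlonglongrightarrow> p"
    using tendsto_fst[OF r(2)] tendsto_snd[OF r(2)] by (auto simp: l o_def)
  obtain al be where sol: "sol al be" "al c0 = pi/2" "be c0 = p" using sol_exists by blast
  have cont: "isCont al x" "isCont be x" for x
    using sol_continuous[OF sol(1), of UNIV] by (auto simp: continuous_on_eq_continuous_at)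
  have lim: "(\<lambda>n. A (r n) s) \<longlonglongrightarrow> al s" "(\<lambda>n. B (r n) s) \<longlonglongrightarrow> be s" for s
  proof -
    define b where "b n = exp (2 * real k * \<bar>s - c (r n)\<bar>) * norm (A (r n) (c (r n)) - al (c (r n)), B (r n) (c (r n)) - be (c (r n)))" for n
    have "b \<longlonglongrightarrow> exp (2 * real k * \<bar>s - c0\<bar>) * norm (pi/2 - al c0, p - be c0)"
      unfolding b_def c(3)
      by (intro tendsto_intros cl isCont_tendsto_compose[OF cont(1)] isCont_tendsto_compose[OF cont(2)])
    then have b0: "b \<longlonglongrightarrow> 0" by (simp add: sol)
    have le: "norm (A (r n) s - al s, B (r n) s - be s) \<le> b n" for n
      unfolding b_def by (rule sol_dependence[OF S sol(1)])
    have "norm (A (r n) s - al s) \<le> b n" "norm (B (r n) s - be s) \<le> b n" for n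
      using norm_fst_le[of "A (r n) s - al s" "B (r n) s - be s"]
        norm_snd_le[of "B (r n) s - be s" "A (r n) s - al s"] le[of n] by auto
    then have "(\<lambda>n. A (r n) s - al s) \<longlonglongrightarrow> 0" "(\<lambda>n. B (r n) s - be s) \<longlonglongrightarrow> 0"
      by (auto intro!: Lim_null_comparison[OF _ b0])
    then show "(\<lambda>n. A (r n) s) \<longlonglongrightarrow> al s" "(\<lambda>n. B (r n) s) \<longlonglongrightarrow> be s"
      by (simp_all add: Lim_null[symmetric])
  qed
  have limE: "(\<lambda>n. energy (A (r n)) (B (r n)) s) \<longlonglongrightarrow> energy al be s" for s
    unfolding energy_def by (intro tendsto_intros lim)
  have ev: "eventually (\<lambda>n. T - real (r n) \<le> s) sequentially" for s
  proof -
    obtain N where N: "T - s \<le> real N" using real_arch_simple by blast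
    have "T - real (r n) \<le> s" if "N \<le> n" for n
      using seq_suble[OF r(1), of n] that N by linarith
    then show ?thesis unfolding eventually_sequentially by blast
  qed
  have lims: "0 \<le> be s" "0 \<le> al s" "al s \<le> pi" "energy al be s \<le> 0" "s \<le> s_max \<Longrightarrow> 1/4 \<le> energy al be s + g s" for s
  proof -
    note e = eventually_mono[OF ev[of s]]
    show "0 \<le> be s" by (rule tendsto_lowerbound[OF lim(2)]) (rule e, use P in \<open>force intro: less_imp_le\<close>, simp)
    show "0 \<le> al s" by (rule tendsto_lowerbound[OF lim(1)]) (rule e, use P in \<open>force intro: less_imp_le\<close>, simp)
    show "al s \<le> pi" by (rule tendsto_upperbound[OF lim(1)]) (rule e, use P in \<open>force intro: less_imp_le\<close>, simp)
    show "energy al be s \<le> 0" by (rule tendsto_upperbound[OF limE]) (rule e, use P in \<open>force\<close>, simp)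
    show "1/4 \<le> energy al be s + g s" if "s \<le> s_max"
      by (rule tendsto_lowerbound[OF tendsto_add[OF limE tendsto_const]]) (rule e, use P that in \<open>force\<close>, simp)
  qed
  have notconst: False if "be x = 0" "sin (al x) * cos (al x) = 0" for x
  proof -
    have eq: "al y = al x" "be y = 0" for y using sol_unique[OF sol(1) sol_const[OF that(2)], of x y] that by auto
    have al1: "al s_max = pi/2" using eq(1)[of s_max] eq(1)[of c0] sol(2) by simp
    have "energy al be s_max + g s_max = 0" unfolding energy_def al1 eq(2)[of s_max] by simp
    then show False using lims(5)[of s_max] by simp
  qed
  have ends: False if "al x = 0 \<or> al x = pi" for x
  proof -
    have "be x = 0"
      using that
    proof
      assume "al x = 0"
      then show ?thesis
        using DERIV_local_min[OF sol_deriv(1)[OF sol(1)], of 1 x] lims(2) by simp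
    next
      assume "al x = pi"
      then show ?thesis
        using DERIV_local_max[OF sol_deriv(1)[OF sol(1)], of 1 x] lims(3) by simp
    qed
    then show False using notconst[of x] that by auto
  qed
  have "be x \<noteq> 0" for x
  proof
    assume b: "be x = 0"
    then have "(real k - 1) * logistic x * be x + H x * (sin (al x) * cos (al x)) = 0"
      using DERIV_local_min[OF sol_deriv(2)[OF sol(1)], of 1 x] lims(1) by simp
    then have "sin (al x) * cos (al x) = 0" using b H_bounds(3)[of x] by simp
    then show False using notconst b by blast
  qed
  then have "0 < be s" for s using lims(1)[of s] by (simp add: less_le)
  moreover have "0 < al s" "al s < pi" for s using ends[of s] lims(2,3)[of s] by (auto simp: less_le)
  ultimately show ?thesis using that sol(1) slope_le[OF lims(4)] by blast
qed

end

section \<open>Behaviour of the transition profile at infinity\<close>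

lemma mono_bounded_tendsto_bot:
  fixes f :: "real \<Rightarrow> real"
  assumes mono: "\<And>a b. a \<le> b \<Longrightarrow> b \<le> s0 \<Longrightarrow> f a \<le> f b" and bd: "\<And>s. s \<le> s0 \<Longrightarrow> c \<le> f s"
  obtains L where "(f \<longlongrightarrow> L) at_bot"
proof -
  define L where "L = Inf (f ` {..s0})"
  have bb: "bdd_below (f ` {..s0})" using bd by (intro bdd_belowI[of _ c]) auto
  have "(f \<longlongrightarrow> L) at_bot"
  proof (rule order_tendstoI)
    fix a assume a: "a < L"
    have "a < f s" if "s \<le> s0" for s
      using cInf_lower[OF _ bb, of "f s"] that a by (force simp: L_def)
    then show "eventually (\<lambda>s. a < f s) at_bot" unfolding eventually_at_bot_linorder by blast
  next
    fix a assume "L < a"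
    then obtain s where s: "s \<le> s0" "f s < a"
      using cInf_lessD[of "f ` {..s0}" a] by (auto simp: L_def)
    have "f q < a" if "q \<le> s" for q using mono[OF that s(1)] s(2) by linarith
    then show "eventually (\<lambda>s. f s < a) at_bot" unfolding eventually_at_bot_linorder by blast
  qed
  then show ?thesis using that by blast
qed

lemma antimono_bounded_tendsto_top:
  fixes f :: "real \<Rightarrow> real"
  assumes mono: "\<And>a b. s0 \<le> a \<Longrightarrow> a \<le> b \<Longrightarrow> f b \<le> f a" and bd: "\<And>s. s0 \<le> s \<Longrightarrow> c \<le> f s"
  obtains L where "(f \<longlongrightarrow> L) at_top"
proof -
  obtain L where "((\<lambda>s. f (- s)) \<longlongrightarrow> L) at_bot"
    by (rule mono_bounded_tendsto_bot[of "- s0" "\<lambda>s. f (- s)" c]) (auto intro!: assms)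
  then have "(f \<longlongrightarrow> L) at_top" by (simp add: filterlim_at_top_mirror)
  then show ?thesis using that by blast
qed

lemma div_tan_tendsto:
  fixes f :: "real \<Rightarrow> real"
  assumes "(f \<longlongrightarrow> 0) F" "eventually (\<lambda>s. f s \<noteq> (0::real)) F"
  shows "((\<lambda>s. f s / tan (f s)) \<longlongrightarrow> 1) F"
proof -
  have s: "((\<lambda>h. sin h / h) \<longlongrightarrow> (1::real)) (at 0)"
    using DERIV_sin[of "0::real"] by (simp add: DERIV_def)
  have "filterlim f (at 0) F" using assms by (simp add: filterlim_at)
  from filterlim_compose[OF s this] have "((\<lambda>x. sin (f x) / f x) \<longlongrightarrow> 1) F" .
  from tendsto_divide[OF tendsto_cos[OF assms(1)] this]
  show ?thesis by (simp add: tan_def mult.commute)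
qed

context profile_ode begin

lemma w_antimono: "a \<le> b \<Longrightarrow> w b \<le> w a"
  by (rule nonincreasing_of_deriv[OF _ w_deriv])
    (use rk2 logistic_bounds w_bounds in \<open>auto simp: mult_nonpos_nonneg\<close>)

text \<open>
If \<open>al\<close> stayed above some \<open>\<epsilon> > 0\<close>, then either \<open>al \<ge> \<pi>/2\<close> throughout, \<open>w be\<close> is at least a positive
constant towards \<open>-\<infinity>\<close> and \<open>al\<close> is unbounded; or the derivative of \<open>w be\<close> is at least a positive
constant and \<open>w be\<close> becomes negative.
\<close>

lemma transit_bot:
  assumes S: "sol al be" and be: "\<And>s. 0 < be s" and al: "\<And>s. 0 < al s" "\<And>s. al s < pi"
  shows "(al \<longlongrightarrow> 0) at_bot"
proof -
  let ?Z = "\<lambda>s. w s * be s"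
  have Zpos: "0 < ?Z s" for s by (rule mult_pos_pos[OF w_bounds(1) be])
  have Zbe: "?Z s \<le> be s" for s using mult_right_mono[OF w_bounds(2) less_imp_le[OF be], of s] by simp
  have mono: "al a \<le> al b" if "a \<le> b" for a b
    using sol_mono[OF S that] be by (simp add: less_imp_le)
  have sinp: "0 < sin (al s)" for s using al by (intro sin_gt_zero)
  obtain s0 where s0: "al s0 < pi/2"
  proof -
    have "\<exists>s. al s < pi/2"
    proof (rule ccontr)
      assume "\<not> ?thesis"
      then have ge: "pi/2 \<le> al s" for s by (simp add: not_less)
      have Zge: "?Z 0 \<le> ?Z s" if "s \<le> 0" for s
      proof (rule nonincreasing_of_deriv[OF that Z_deriv[OF S]])
        fix q
        have "cos (al q) \<le> cos (pi/2)" using ge[of q] al[of q] by (intro cos_monotone_0_pi_le) auto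
        then show "w q * H q * (sin (al q) * cos (al q)) \<le> 0"
          by (intro mult_nonneg_nonpos mult_nonneg_nonneg w_bounds H_bounds less_imp_le[OF sinp]) simp
      qed
      define q where "q = - (pi / ?Z 0)"
      have q: "q \<le> 0" using Zpos[of 0] by (simp add: q_def)
      have "al q - ?Z 0 * q \<le> al 0 - ?Z 0 * 0"
      proof (rule nondecreasing_of_deriv[OF q, where f = "\<lambda>s. al s - ?Z 0 * s"])
        show "((\<lambda>s. al s - ?Z 0 * s) has_real_derivative be r - ?Z 0) (at r)" for r
          by (auto intro!: derivative_eq_intros sol_deriv[OF S])
        show "0 \<le> be r - ?Z 0" if "r \<le> 0" for r using Zge[OF that] Zbe[of r] by linarith
      qed
      moreover have "?Z 0 * q = - pi" using w_bounds(4)[of 0] be[of 0] by (simp add: q_def)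
      ultimately show False using al(1)[of q] al(2)[of 0] by simp
    qed
    then show ?thesis using that by blast
  qed
  have small: "\<exists>s. al s < e" if e: "0 < e" "e < pi/2" for e
  proof (rule ccontr)
    assume "\<not> ?thesis"
    then have ge: "e \<le> al s" for s by (simp add: not_less)
    define c where "c = w s0 * (1/4) * (sin e * cos (al s0))"
    have se: "0 < sin e" using e by (intro sin_gt_zero) auto
    have cs: "0 < cos (al s0)" using s0 al(1)[of s0] by (intro cos_gt_zero_pi) auto
    have c: "0 < c" unfolding c_def by (intro mult_pos_pos w_bounds se cs) simp
    have Zd: "c \<le> w q * H q * (sin (al q) * cos (al q))" if "q \<le> s0" for q
    proof -
      have "sin e \<le> sin (al q)" "cos (al s0) \<le> cos (al q)"
        using ge[of q] mono[OF that] s0 e al[of q] by (auto intro!: sin_monotone_2pi_le cos_monotone_0_pi_le)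
      then show ?thesis unfolding c_def
        using w_antimono[OF that] H_bounds(1)[of q] se cs w_bounds(3)[of s0] w_bounds(3)[of q]
        by (intro mult_mono) (auto intro: mult_nonneg_nonneg less_imp_le)
    qed
    define q where "q = s0 - ?Z s0 / c"
    have q: "q \<le> s0" using c Zpos[of s0] by (simp add: q_def)
    have "?Z q - c * q \<le> ?Z s0 - c * s0"
    proof (rule nondecreasing_of_deriv[OF q, where f = "\<lambda>s. ?Z s - c * s"])
      show "((\<lambda>s. ?Z s - c * s) has_real_derivative w r * H r * (sin (al r) * cos (al r)) - c) (at r)" for r
        by (rule DERIV_cong[OF DERIV_diff[OF Z_deriv[OF S] DERIV_cmult[OF DERIV_ident]]]) simp
      show "0 \<le> w r * H r * (sin (al r) * cos (al r)) - c" if "r \<le> s0" for r using Zd[OF that] by simp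
    qed
    moreover have "c * q = c * s0 - ?Z s0" using c by (simp add: q_def right_diff_distrib)
    ultimately show False using Zpos[of q] by linarith
  qed
  show ?thesis
  proof (rule order_tendstoI)
    show "eventually (\<lambda>s. a < al s) at_bot" if "a < 0" for a
      using order.strict_trans[OF that al(1)] by simp
    fix a :: real assume a: "0 < a"
    have m: "0 < min a (pi/4)" "min a (pi/4) < pi/2" using a pi_gt_zero by (auto simp: min_def)
    obtain s where s: "al s < min a (pi/4)" using small[OF m] by blast
    have "al q < a" if "q \<le> s" for q using mono[OF that] s by linarith
    then show "eventually (\<lambda>s. al s < a) at_bot" unfolding eventually_at_bot_linorder by blast
  qed
qed

text \<open>
The weight tends to \<open>0\<close> here, so the second case of the argument at \<open>-\<infinity>\<close> uses the function
\<open>be - (k - 1) al\<close> instead: its derivative is at most a negative constant, whereas it is bounded below.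
\<close>

lemma transit_top:
  assumes S: "sol al be" and be: "\<And>s. 0 < be s" and al: "\<And>s. 0 < al s" "\<And>s. al s < pi"
  shows "(al \<longlongrightarrow> pi) at_top"
proof -
  let ?Z = "\<lambda>s. w s * be s"
  have Zpos: "0 < ?Z s" for s by (rule mult_pos_pos[OF w_bounds(1) be])
  have Zbe: "?Z s \<le> be s" for s using mult_right_mono[OF w_bounds(2) less_imp_le[OF be], of s] by simp
  have mono: "al a \<le> al b" if "a \<le> b" for a b
    using sol_mono[OF S that] be by (simp add: less_imp_le)
  have sinp: "0 < sin (al s)" for s using al by (intro sin_gt_zero)
  obtain s0 where s0: "pi/2 < al s0"
  proof -
    have "\<exists>s. pi/2 < al s"
    proof (rule ccontr)
      assume "\<not> ?thesis"
      then have le: "al s \<le> pi/2" for s by (simp add: not_less)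
      have Zge: "?Z 0 \<le> ?Z s" if "0 \<le> s" for s
      proof (rule nondecreasing_of_deriv[OF that Z_deriv[OF S]])
        fix q
        have "0 \<le> cos (al q)" using le[of q] al[of q] by (intro cos_ge_zero) auto
        then show "0 \<le> w q * H q * (sin (al q) * cos (al q))"
          by (intro mult_nonneg_nonneg w_bounds H_bounds less_imp_le[OF sinp])
      qed
      define q where "q = pi / ?Z 0"
      have q: "0 \<le> q" using Zpos[of 0] by (simp add: q_def)
      have "al 0 - ?Z 0 * 0 \<le> al q - ?Z 0 * q"
      proof (rule nondecreasing_of_deriv[OF q, where f = "\<lambda>s. al s - ?Z 0 * s"])
        show "((\<lambda>s. al s - ?Z 0 * s) has_real_derivative be r - ?Z 0) (at r)" for r
          by (auto intro!: derivative_eq_intros sol_deriv[OF S])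
        show "0 \<le> be r - ?Z 0" if "0 \<le> r" for r using Zge[OF that] Zbe[of r] by linarith
      qed
      moreover have "?Z 0 * q = pi" using w_bounds(4)[of 0] be[of 0] by (simp add: q_def)
      ultimately show False using al(1)[of 0] al(2)[of q] by simp
    qed
    then show ?thesis using that by blast
  qed
  have large: "\<exists>s. pi - e < al s" if e: "0 < e" "e < pi/2" for e
  proof (rule ccontr)
    assume "\<not> ?thesis"
    then have le: "al s \<le> pi - e" for s by (simp add: not_less)
    define c where "c = 1/4 * (sin e * - cos (al s0))"
    have se: "0 < sin e" using e by (intro sin_gt_zero) auto
    have cs: "cos (al s0) < 0" using cos_gt_zero_pi[of "pi - al s0"] s0 al(2)[of s0] by auto
    have c: "0 < c" unfolding c_def using se cs by (intro mult_pos_pos) auto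
    have Hd: "c \<le> H q * (sin (al q) * - cos (al q))" if "s0 \<le> q" for q
    proof -
      have "sin e \<le> sin (pi - al q)"
        using le[of q] mono[OF that] s0 e by (intro sin_monotone_2pi_le) auto
      moreover have "cos (al q) \<le> cos (al s0)"
        using mono[OF that] al[of q] al[of s0] by (intro cos_monotone_0_pi_le) auto
      ultimately show ?thesis unfolding c_def
        using H_bounds(1)[of q] se cs
        by (intro mult_mono) (auto intro: mult_nonneg_nonneg less_imp_le mult_nonneg_nonpos)
    qed
    define q where "q = s0 + (be s0 + (real k - 1) * pi) / c"
    have q: "s0 \<le> q" using c be[of s0] rk2 by (simp add: q_def)
    have "(be q - (real k - 1) * al q) + c * q \<le> (be s0 - (real k - 1) * al s0) + c * s0"
    proof (rule nonincreasing_of_deriv[OF q, where f = "\<lambda>s. (be s - (real k - 1) * al s) + c * s"])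
      show "((\<lambda>s. (be s - (real k - 1) * al s) + c * s) has_real_derivative
          (((real k - 1) * logistic r * be r + H r * (sin (al r) * cos (al r))) - (real k - 1) * be r) + c) (at r)" for r
        by (auto intro!: derivative_eq_intros sol_deriv[OF S])
      fix r assume r: "s0 \<le> r"
      have "((real k - 1) * be r) * logistic r \<le> ((real k - 1) * be r) * 1"
        using rk2 be[of r] logistic_bounds[of r] by (intro mult_left_mono) auto
      then show "(((real k - 1) * logistic r * be r + H r * (sin (al r) * cos (al r))) - (real k - 1) * be r) + c \<le> 0"
        using Hd[OF r] by (simp add: mult_ac)
    qed
    moreover have "c * q = c * s0 + (be s0 + (real k - 1) * pi)" unfolding q_def distrib_left using c by simp
    moreover have "(real k - 1) * al q \<le> (real k - 1) * pi" using rk2 al(2)[of q] by (intro mult_left_mono) auto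
    moreover have "0 < (real k - 1) * al s0" using rk2 al(1)[of s0] by simp
    ultimately show False using be[of q] by linarith
  qed
  show ?thesis
  proof (rule order_tendstoI)
    show "eventually (\<lambda>s. al s < a) at_top" if "pi < a" for a
      using order.strict_trans[OF al(2) that] by simp
    fix a assume a: "a < pi"
    have m: "0 < min (pi - a) (pi/4)" "min (pi - a) (pi/4) < pi/2" using a pi_gt_zero by (auto simp: min_def)
    obtain s where s: "pi - min (pi - a) (pi/4) < al s" using large[OF m] by blast
    have "a < al q" if "s \<le> q" for q using mono[OF that] s by linarith
    then show "eventually (\<lambda>s. a < al s) at_top" unfolding eventually_at_top_linorder by blast
  qed
qed

lemma slope_tendsto_0:
  assumes slope: "\<And>s. (be s)\<^sup>2 \<le> H s * (sin (al s))\<^sup>2" and lim: "((\<lambda>s. sin (al s)) \<longlongrightarrow> 0) F"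
  shows "(be \<longlongrightarrow> 0) F"
proof (rule Lim_null_comparison)
  have "norm (be s) \<le> sqrt (real k) * \<bar>sin (al s)\<bar>" for s
  proof -
    have "(be s)\<^sup>2 \<le> real k * (sin (al s))\<^sup>2"
      using slope[of s] mult_right_mono[OF H_bounds(2)[of s], of "(sin (al s))\<^sup>2"] by simp
    then have "sqrt ((be s)\<^sup>2) \<le> sqrt (real k * (sin (al s))\<^sup>2)" by (rule real_sqrt_le_mono)
    then show ?thesis by (simp add: real_sqrt_mult)
  qed
  then show "eventually (\<lambda>s. norm (be s) \<le> sqrt (real k) * \<bar>sin (al s)\<bar>) F" by simp
  show "((\<lambda>s. sqrt (real k) * \<bar>sin (al s)\<bar>) \<longlongrightarrow> 0) F"
    using tendsto_mult_left[OF tendsto_rabs[OF lim], of "sqrt (real k)"] by simp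
qed

text \<open>
Here \<open>\<Psi> = \<surd>\<rho>\<close> is a supersolution with the decay of the linearised equation. The Wronskian with \<open>tan al\<close>
vanishes at \<open>-\<infinity>\<close> and increases, so \<open>tan al / \<Psi>\<close> is monotone.
\<close>

lemma quotient_limit_bot:
  assumes S: "sol al be" and be: "\<And>s. 0 < be s" and al: "\<And>s. 0 < al s" "\<And>s. al s < pi"
    and lim: "(al \<longlongrightarrow> 0) at_bot" "(be \<longlongrightarrow> 0) at_bot"
  obtains L where "((\<lambda>s. al s / sqrt (logistic s)) \<longlongrightarrow> L) at_bot"
proof -
  obtain s0 where s0: "\<And>s. s \<le> s0 \<Longrightarrow> al s < pi/2"
    using order_tendstoD(2)[OF lim(1), of "pi/2"] by (auto simp: eventually_at_bot_linorder)
  have cosp: "0 < cos (al s)" if "s \<le> s0" for s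
    using s0[OF that] al(1)[of s] by (intro cos_gt_zero_pi) auto
  have tanp: "0 < tan (al s)" if "s \<le> s0" for s
    using s0[OF that] al(1)[of s] by (intro tan_gt_zero) auto
  define \<Psi> where "\<Psi> s = sqrt (logistic s)" for s
  define \<Psi>1 where "\<Psi>1 s = \<Psi> s * (1 - logistic s) / 2" for s
  define \<Psi>2 where "\<Psi>2 s = \<Psi> s * ((1 - logistic s) * (1 - 3 * logistic s)) / 4" for s
  have Ppos: "0 < \<Psi> s" for s using logistic_bounds[of s] by (simp add: \<Psi>_def)
  have Psq: "\<Psi> s * \<Psi> s = logistic s" for s using logistic_bounds[of s] by (simp add: \<Psi>_def)
  have P: "(\<Psi> has_real_derivative \<Psi>1 s) (at s)" for s
  proof -
    have "(\<Psi> has_real_derivative (logistic s * (1 - logistic s)) * (inverse (sqrt (logistic s)) / 2)) (at s)"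
      unfolding \<Psi>_def[abs_def] using DERIV_chain2[OF DERIV_real_sqrt logistic_deriv] logistic_bounds(1)[of s]
      by (simp add: mult.commute)
    moreover have "(logistic s * (1 - logistic s)) * (inverse (sqrt (logistic s)) / 2) = \<Psi>1 s"
      unfolding \<Psi>1_def using Psq[of s, symmetric] Ppos[of s] by (simp add: \<Psi>_def[symmetric] field_simps)
    ultimately show ?thesis by simp
  qed
  have P1: "(\<Psi>1 has_real_derivative \<Psi>2 s) (at s)" for s
    unfolding \<Psi>1_def[abs_def]
    by (rule DERIV_cong[OF DERIV_cdivide[OF DERIV_mult[OF P DERIV_diff[OF DERIV_const logistic_deriv]]]])
      (simp add: \<Psi>1_def \<Psi>2_def field_simps)
  define W where "W s = w s * ((1 + (tan (al s))\<^sup>2) * be s * \<Psi> s - tan (al s) * \<Psi>1 s)" for s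
  have Wd: "(W has_real_derivative w s * tan (al s) * ((H s + 2 * (1 + (tan (al s))\<^sup>2) * (be s)\<^sup>2) * \<Psi> s - \<Psi>2 s
      + (real k - 1) * logistic s * \<Psi>1 s)) (at s)" if "s \<le> s0" for s
    unfolding W_def[abs_def] by (rule tan_wronskian_deriv[OF S _ P P1]) (use cosp[OF that] in simp)
  have Wmono: "W a \<le> W b" if "a \<le> b" "b \<le> s0" for a b
  proof (rule nondecreasing_of_deriv[OF that(1) Wd])
    fix s assume s: "a \<le> s" "s \<le> b"
    then show "s \<le> s0" using that by simp
    have l: "0 < logistic s" "logistic s < 1" using logistic_bounds by auto
    have "(1 - logistic s) * (1 - 3 * logistic s) \<le> 1 + (4 * real k - 1) * logistic s"
    proof -
      have "logistic s * logistic s \<le> logistic s * 1" using l by (intro mult_left_mono) auto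
      moreover have "0 \<le> real k * logistic s" using l by simp
      moreover have "(1 - logistic s) * (1 - 3 * logistic s) = 1 - 4 * logistic s + 3 * (logistic s * logistic s)"
        "1 + (4 * real k - 1) * logistic s = 1 + 4 * (real k * logistic s) - logistic s"
        by (simp_all add: algebra_simps)
      ultimately show ?thesis using l by linarith
    qed
    then have "\<Psi> s * ((1 - logistic s) * (1 - 3 * logistic s)) / 4 \<le> \<Psi> s * (1 + (4 * real k - 1) * logistic s) / 4"
      using Ppos[of s] by (intro divide_right_mono mult_left_mono) auto
    then have 1: "\<Psi>2 s \<le> H s * \<Psi> s" by (simp add: \<Psi>2_def H_def mult.commute)
    have 2: "0 \<le> (real k - 1) * logistic s * \<Psi>1 s"
      unfolding \<Psi>1_def using rk2 l Ppos[of s] by (intro mult_nonneg_nonneg divide_nonneg_nonneg) auto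
    have 3: "0 \<le> 2 * (1 + (tan (al s))\<^sup>2) * (be s)\<^sup>2 * \<Psi> s"
      using Ppos[of s] by (intro mult_nonneg_nonneg) auto
    have "0 \<le> (H s + 2 * (1 + (tan (al s))\<^sup>2) * (be s)\<^sup>2) * \<Psi> s - \<Psi>2 s + (real k - 1) * logistic s * \<Psi>1 s"
      using 1 2 3 by (simp add: distrib_right)
    then show "0 \<le> w s * tan (al s) * ((H s + 2 * (1 + (tan (al s))\<^sup>2) * (be s)\<^sup>2) * \<Psi> s - \<Psi>2 s
      + (real k - 1) * logistic s * \<Psi>1 s)"
      by (intro mult_nonneg_nonneg[OF mult_nonneg_nonneg[OF w_bounds(3) less_imp_le[OF tanp]]]) (use s that in auto)
  qed
  have tanlim: "((\<lambda>s. tan (al s)) \<longlongrightarrow> 0) at_bot" using tendsto_tan[OF lim(1)] by simp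
  have Plim: "(\<Psi> \<longlongrightarrow> 0) at_bot" unfolding \<Psi>_def[abs_def]
    using tendsto_real_sqrt[OF logistic_tendsto_bot] by simp
  have "(W \<longlongrightarrow> 1 * ((1 + 0\<^sup>2) * 0 * 0 - 0 * (0 * (1 - 0) / 2))) at_bot"
    unfolding W_def[abs_def] \<Psi>1_def[abs_def]
    by (intro tendsto_intros w_tendsto_bot tanlim Plim lim logistic_tendsto_bot) simp
  then have Wlim: "(W \<longlongrightarrow> 0) at_bot" by simp
  have Wnn: "0 \<le> W s" if "s \<le> s0" for s
  proof (rule tendsto_upperbound[OF Wlim])
    show "\<forall>\<^sub>F q in at_bot. W q \<le> W s" unfolding eventually_at_bot_linorder using Wmono that by blast
  qed simp
  have qd: "((\<lambda>s. tan (al s) / \<Psi> s) has_real_derivative W s / (w s * (\<Psi> s)\<^sup>2)) (at s)" if "s \<le> s0" for s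
    unfolding W_def using tan_quotient_deriv[where \<Psi> = \<Psi> and ?\<Psi>1.0 = \<Psi>1 and s = s, OF S _ Ppos P] cosp[OF that] by simp
  have qm: "tan (al a) / \<Psi> a \<le> tan (al b) / \<Psi> b" if "a \<le> b" "b \<le> s0" for a b
  proof (rule nondecreasing_of_deriv[OF that(1) qd])
    fix s assume s: "a \<le> s" "s \<le> b"
    then show s': "s \<le> s0" using that by simp
    show "0 \<le> W s / (w s * (\<Psi> s)\<^sup>2)"
      by (rule divide_nonneg_nonneg[OF Wnn[OF s'] mult_nonneg_nonneg[OF w_bounds(3) zero_le_power2]])
  qed
  obtain L where L: "((\<lambda>s. tan (al s) / \<Psi> s) \<longlongrightarrow> L) at_bot"
  proof (rule mono_bounded_tendsto_bot[of s0 "\<lambda>s. tan (al s) / \<Psi> s" 0])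
    show "0 \<le> tan (al s) / \<Psi> s" if "s \<le> s0" for s
      using divide_nonneg_pos[OF less_imp_le[OF tanp[OF that]] Ppos[of s]] .
  qed (use qm in auto)
  have "((\<lambda>s. al s / tan (al s)) \<longlongrightarrow> 1) at_bot"
    using al(1) by (intro div_tan_tendsto lim) (simp add: less_imp_neq[symmetric])
  from tendsto_mult[OF this L] have "((\<lambda>s. al s / tan (al s) * (tan (al s) / \<Psi> s)) \<longlongrightarrow> L) at_bot" by simp
  moreover have "eventually (\<lambda>s. al s / tan (al s) * (tan (al s) / \<Psi> s) = al s / sqrt (logistic s)) at_bot"
    unfolding eventually_at_bot_linorder
  proof (intro exI[of _ s0] allI impI)
    fix s assume "s \<le> s0"
    then show "al s / tan (al s) * (tan (al s) / \<Psi> s) = al s / sqrt (logistic s)"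
      using tanp[of s] by (simp add: \<Psi>_def)
  qed
  ultimately have "((\<lambda>s. al s / sqrt (logistic s)) \<longlongrightarrow> L) at_bot"
    by (rule Lim_transform_eventually)
  then show ?thesis by (rule that)
qed

text \<open>
The comparison function at this end is \<open>\<Psi> = 1 - \<rho>\<close>; the Wronskian vanishes at \<open>+\<infinity>\<close>.
\<close>

lemma quotient_limit_top:
  assumes S: "sol al be" and be: "\<And>s. 0 < be s" and al: "\<And>s. 0 < al s" "\<And>s. al s < pi"
    and lim: "(al \<longlongrightarrow> pi) at_top" "(be \<longlongrightarrow> 0) at_top"
  obtains L where "((\<lambda>s. (pi - al s) / (1 - logistic s)) \<longlongrightarrow> L) at_top"
proof -
  obtain s0 where s0: "\<And>s. s0 \<le> s \<Longrightarrow> pi/2 < al s"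
    using order_tendstoD(1)[OF lim(1), of "pi/2"] by (auto simp: eventually_at_top_linorder)
  have cosn: "cos (al s) < 0" if "s0 \<le> s" for s
    using s0[OF that] al(2)[of s] cos_gt_zero_pi[of "pi - al s"] by auto
  have tann: "tan (al s) < 0" if "s0 \<le> s" for s
    using cosn[OF that] sin_gt_zero[OF al] unfolding tan_def by (intro divide_pos_neg) auto
  define \<Psi> where "\<Psi> s = 1 - logistic s" for s
  define \<Psi>1 where "\<Psi>1 s = - (logistic s * (1 - logistic s))" for s
  define \<Psi>2 where "\<Psi>2 s = - (logistic s * (1 - logistic s) * (1 - 2 * logistic s))" for s
  have Ppos: "0 < \<Psi> s" for s using logistic_bounds[of s] by (simp add: \<Psi>_def)
  have P: "(\<Psi> has_real_derivative \<Psi>1 s) (at s)" for s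
    unfolding \<Psi>_def[abs_def] \<Psi>1_def using DERIV_diff[OF DERIV_const logistic_deriv] by simp
  have P1: "(\<Psi>1 has_real_derivative \<Psi>2 s) (at s)" for s
    unfolding \<Psi>1_def[abs_def]
    by (rule DERIV_cong[OF DERIV_minus[OF DERIV_mult[OF logistic_deriv DERIV_diff[OF DERIV_const logistic_deriv]]]])
      (simp add: \<Psi>2_def algebra_simps)
  define W where "W s = w s * ((1 + (tan (al s))\<^sup>2) * be s * \<Psi> s - tan (al s) * \<Psi>1 s)" for s
  have Wd: "(W has_real_derivative w s * tan (al s) * ((H s + 2 * (1 + (tan (al s))\<^sup>2) * (be s)\<^sup>2) * \<Psi> s - \<Psi>2 s
      + (real k - 1) * logistic s * \<Psi>1 s)) (at s)" if "s0 \<le> s" for s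
    unfolding W_def[abs_def] by (rule tan_wronskian_deriv[OF S _ P P1]) (use cosn[OF that] in simp)
  have Wmono: "W b \<le> W a" if "s0 \<le> a" "a \<le> b" for a b
  proof (rule nonincreasing_of_deriv[OF that(2) Wd])
    fix s assume s: "a \<le> s" "s \<le> b"
    then show "s0 \<le> s" using that by simp
    have l: "0 < logistic s" "logistic s < 1" using logistic_bounds by auto
    have "- (logistic s * (1 - 2 * logistic s)) + (real k - 1) * (logistic s * logistic s) \<le> H s"
    proof -
      have "(real k + 1) * (logistic s * logistic s) \<le> (real k + 1) * (logistic s * 1)"
        using rk2 l by (intro mult_left_mono) auto
      then show ?thesis using l unfolding H_def
        by (simp add: algebra_simps add_divide_distrib diff_divide_distrib)
    qed
    from mult_right_mono[OF this less_imp_le[OF Ppos[of s]]]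
    have 1: "0 \<le> H s * \<Psi> s - \<Psi>2 s + (real k - 1) * logistic s * \<Psi>1 s"
      by (simp add: \<Psi>2_def \<Psi>1_def \<Psi>_def algebra_simps)
    have 3: "0 \<le> 2 * (1 + (tan (al s))\<^sup>2) * (be s)\<^sup>2 * \<Psi> s"
      using Ppos[of s] by (intro mult_nonneg_nonneg) auto
    have "0 \<le> (H s + 2 * (1 + (tan (al s))\<^sup>2) * (be s)\<^sup>2) * \<Psi> s - \<Psi>2 s + (real k - 1) * logistic s * \<Psi>1 s"
      using 1 3 by (simp add: distrib_right)
    then show "w s * tan (al s) * ((H s + 2 * (1 + (tan (al s))\<^sup>2) * (be s)\<^sup>2) * \<Psi> s - \<Psi>2 s
      + (real k - 1) * logistic s * \<Psi>1 s) \<le> 0"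
      by (intro mult_nonpos_nonneg[OF mult_nonneg_nonpos[OF w_bounds(3) less_imp_le[OF tann]]]) (use s that in auto)
  qed
  have tanlim: "((\<lambda>s. tan (al s)) \<longlongrightarrow> 0) at_top" using tendsto_tan[OF lim(1)] by simp
  have "(W \<longlongrightarrow> 0 * ((1 + 0\<^sup>2) * 0 * (1 - 1) - 0 * (- (1 * (1 - 1))))) at_top"
    unfolding W_def[abs_def] \<Psi>1_def[abs_def] \<Psi>_def[abs_def]
    by (intro tendsto_intros w_tendsto_top tanlim lim logistic_tendsto_top)
  then have Wlim: "(W \<longlongrightarrow> 0) at_top" by simp
  have Wnn: "0 \<le> W s" if "s0 \<le> s" for s
  proof (rule tendsto_upperbound[OF Wlim])
    show "\<forall>\<^sub>F q in at_top. W q \<le> W s" unfolding eventually_at_top_linorder using Wmono that by blast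
  qed simp
  have qd: "((\<lambda>s. tan (al s) / \<Psi> s) has_real_derivative W s / (w s * (\<Psi> s)\<^sup>2)) (at s)" if "s0 \<le> s" for s
    unfolding W_def using tan_quotient_deriv[where \<Psi> = \<Psi> and ?\<Psi>1.0 = \<Psi>1 and s = s, OF S _ Ppos P] cosn[OF that] by simp
  have qm: "tan (al a) / \<Psi> a \<le> tan (al b) / \<Psi> b" if "s0 \<le> a" "a \<le> b" for a b
  proof (rule nondecreasing_of_deriv[OF that(2) qd])
    fix s assume s: "a \<le> s" "s \<le> b"
    then show s': "s0 \<le> s" using that by simp
    show "0 \<le> W s / (w s * (\<Psi> s)\<^sup>2)"
      by (rule divide_nonneg_nonneg[OF Wnn[OF s'] mult_nonneg_nonneg[OF w_bounds(3) zero_le_power2]])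
  qed
  obtain L where L: "((\<lambda>s. - (tan (al s) / \<Psi> s)) \<longlongrightarrow> L) at_top"
  proof (rule antimono_bounded_tendsto_top[of s0 "\<lambda>s. - (tan (al s) / \<Psi> s)" 0])
    show "0 \<le> - (tan (al s) / \<Psi> s)" if "s0 \<le> s" for s
      using divide_nonpos_pos[OF less_imp_le[OF tann[OF that]] Ppos[of s]] by simp
  qed (use qm in auto)
  have d: "((\<lambda>s. pi - al s) \<longlongrightarrow> 0) at_top" using tendsto_diff[OF tendsto_const lim(1), of pi] by simp
  have "((\<lambda>s. (pi - al s) / tan (pi - al s)) \<longlongrightarrow> 1) at_top"
    using al(2) by (intro div_tan_tendsto d) (simp add: less_imp_neq[symmetric])
  from tendsto_mult[OF this L]
  have "((\<lambda>s. (pi - al s) / tan (pi - al s) * - (tan (al s) / \<Psi> s)) \<longlongrightarrow> L) at_top" by simp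
  moreover have "eventually (\<lambda>s. (pi - al s) / tan (pi - al s) * - (tan (al s) / \<Psi> s)
      = (pi - al s) / (1 - logistic s)) at_top"
    unfolding eventually_at_top_linorder
  proof (intro exI[of _ s0] allI impI)
    fix s assume "s0 \<le> s"
    then have "tan (al s) \<noteq> 0" using tann[of s] by simp
    moreover have "tan (pi - al s) = - tan (al s)" by (simp add: tan_def)
    moreover have "A / (- t) * - (t / D) = A / D" if "t \<noteq> 0" for A t D :: real
      using that by (cases "D = 0") (auto simp: field_simps)
    ultimately show "(pi - al s) / tan (pi - al s) * - (tan (al s) / \<Psi> s) = (pi - al s) / (1 - logistic s)"
      unfolding \<Psi>_def by metis
  qed
  ultimately have "((\<lambda>s. (pi - al s) / (1 - logistic s)) \<longlongrightarrow> L) at_top"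
    by (rule Lim_transform_eventually)
  then show ?thesis by (rule that)
qed

end

section \<open>Functions of class C^k on subsets of the line\<close>

text \<open>
Derivatives are taken within \<open>S\<close>, so that closed intervals are allowed and one-sided derivatives occur at
their end points. This suffices for composition with a smooth function on an open set whose values lie
in \<open>S\<close>.
\<close>

primrec Ck_real :: "nat \<Rightarrow> (real \<Rightarrow> real) \<Rightarrow> real set \<Rightarrow> bool" where
  "Ck_real 0 f S \<longleftrightarrow> continuous_on S f"
| "Ck_real (Suc n) f S \<longleftrightarrow> (\<exists>f'. (\<forall>x\<in>S. (f has_real_derivative f' x) (at x within S)) \<and> Ck_real n f' S)"

lemma Ck_realI:
  "\<lbrakk>\<And>x. x \<in> S \<Longrightarrow> (f has_real_derivative f' x) (at x within S); Ck_real n f' S\<rbrakk> \<Longrightarrow> Ck_real (Suc n) f S"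
  by auto

lemma Ck_realE:
  assumes "Ck_real (Suc n) f S"
  obtains f' where "\<And>x. x \<in> S \<Longrightarrow> (f has_real_derivative f' x) (at x within S)" "Ck_real n f' S"
  using assms by auto

lemma has_real_derivative_transform:
  "\<lbrakk>x \<in> S; \<And>y. y \<in> S \<Longrightarrow> g y = f y; (f has_real_derivative D) (at x within S)\<rbrakk>
    \<Longrightarrow> (g has_real_derivative D) (at x within S)"
  unfolding has_field_derivative_def by (rule has_derivative_transform)

lemma Ck_real_continuous_on: "Ck_real n f S \<Longrightarrow> continuous_on S f"
  by (cases n) (auto intro: DERIV_continuous_on)

lemma Ck_real_Suc_imp: "Ck_real (Suc n) f S \<Longrightarrow> Ck_real n f S"
proof (induction n arbitrary: f)
  case 0
  then show ?case using Ck_real_continuous_on[of "Suc 0" f S] by (simp only: Ck_real.simps(1))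
next
  case (Suc n)
  then obtain f' where "\<forall>x\<in>S. (f has_real_derivative f' x) (at x within S)" "Ck_real (Suc n) f' S"
    by (metis Ck_real.simps(2))
  then show ?case using Suc.IH[of f'] by auto
qed

lemma Ck_real_cong:
  assumes "\<And>x. x \<in> S \<Longrightarrow> f x = g x" "Ck_real n f S"
  shows "Ck_real n g S"
proof (cases n)
  case 0
  then show ?thesis using assms continuous_on_cong[of S S f g] by simp
next
  case (Suc m)
  then obtain f' where f': "\<forall>x\<in>S. (f has_real_derivative f' x) (at x within S)" "Ck_real m f' S"
    using assms(2) by auto
  have "(g has_real_derivative f' x) (at x within S)" if "x \<in> S" for x
    using has_real_derivative_transform[OF that _ f'(1)[rule_format, OF that]] assms(1) by simp
  then show ?thesis using f'(2) Suc by auto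
qed

lemma Ck_real_subset: "Ck_real n f S \<Longrightarrow> T \<subseteq> S \<Longrightarrow> Ck_real n f T"
proof (induction n arbitrary: f)
  case 0
  then show ?case using continuous_on_subset by auto
next
  case (Suc n)
  then show ?case by simp (meson has_field_derivative_subset subsetD)
qed

lemma Ck_real_const: "Ck_real n (\<lambda>x. c) S"
proof (induction n arbitrary: c)
  case (Suc n)
  show ?case by (rule Ck_realI[OF _ Suc[of 0]]) simp
qed simp

lemma Ck_real_ident: "Ck_real n (\<lambda>x. x) S"
proof (cases n)
  case (Suc m)
  show ?thesis unfolding Suc by (rule Ck_realI[OF _ Ck_real_const[of m 1]]) (auto intro!: derivative_eq_intros)
qed simp

lemma Ck_real_add: "Ck_real n f S \<Longrightarrow> Ck_real n g S \<Longrightarrow> Ck_real n (\<lambda>x. f x + g x) S"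
proof (induction n arbitrary: f g)
  case 0
  then show ?case by (auto intro: continuous_on_add)
next
  case (Suc n)
  then obtain f' g' where "\<forall>x\<in>S. (f has_real_derivative f' x) (at x within S)" "Ck_real n f' S"
    "\<forall>x\<in>S. (g has_real_derivative g' x) (at x within S)" "Ck_real n g' S" by auto
  then show ?case by (intro Ck_realI[of S _ "\<lambda>x. f' x + g' x"] Suc.IH) (auto intro!: DERIV_add)
qed

lemma Ck_real_mult: "Ck_real n f S \<Longrightarrow> Ck_real n g S \<Longrightarrow> Ck_real n (\<lambda>x. f x * g x) S"
proof (induction n arbitrary: f g)
  case 0
  then show ?case by (auto intro: continuous_on_mult)
next
  case (Suc n)
  then obtain f' g' where "\<forall>x\<in>S. (f has_real_derivative f' x) (at x within S)" "Ck_real n f' S"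
    "\<forall>x\<in>S. (g has_real_derivative g' x) (at x within S)" "Ck_real n g' S" by auto
  then show ?case using Suc.prems[THEN Ck_real_Suc_imp]
    by (intro Ck_realI[of S _ "\<lambda>x. f' x * g x + g' x * f x"] Ck_real_add Suc.IH) (auto intro!: DERIV_mult)
qed

lemma Ck_real_minus: "Ck_real n f S \<Longrightarrow> Ck_real n (\<lambda>x. - f x) S"
  using Ck_real_mult[OF Ck_real_const[of n "-1"], of f S] by simp

lemma Ck_real_diff: "Ck_real n f S \<Longrightarrow> Ck_real n g S \<Longrightarrow> Ck_real n (\<lambda>x. f x - g x) S"
  using Ck_real_add[OF _ Ck_real_minus, of n f S g] by simp

lemma Ck_real_power: "Ck_real n f S \<Longrightarrow> Ck_real n (\<lambda>x. f x ^ m) S"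
  by (induction m) (auto intro: Ck_real_const Ck_real_mult)

lemma Ck_real_compose:
  "\<lbrakk>Ck_real n f T; Ck_real n g S; \<And>x. x \<in> S \<Longrightarrow> g x \<in> T\<rbrakk> \<Longrightarrow> Ck_real n (\<lambda>x. f (g x)) S"
proof (induction n arbitrary: f)
  case 0
  then show ?case by (auto intro: continuous_on_compose2[of T f])
next
  case (Suc n)
  then obtain f' g' where f: "\<forall>x\<in>T. (f has_real_derivative f' x) (at x within T)" "Ck_real n f' T"
    and g: "\<forall>x\<in>S. (g has_real_derivative g' x) (at x within S)" "Ck_real n g' S" by auto
  show ?case
  proof (rule Ck_realI[of S _ "\<lambda>x. f' (g x) * g' x"])
    fix x assume x: "x \<in> S"
    have "(f has_real_derivative f' (g x)) (at (g x) within g ` S)"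
      by (rule has_field_derivative_subset[OF f(1)[rule_format, OF Suc.prems(3)[OF x]]])
        (use Suc.prems(3) in blast)
    from DERIV_image_chain[OF this g(1)[rule_format, OF x]]
    show "((\<lambda>x. f (g x)) has_real_derivative f' (g x) * g' x) (at x within S)" by (simp add: o_def)
  next
    show "Ck_real n (\<lambda>x. f' (g x) * g' x) S"
      by (rule Ck_real_mult[OF Suc.IH[OF f(2) Ck_real_Suc_imp[OF Suc.prems(2)] Suc.prems(3)] g(2)])
  qed
qed

lemma Ck_real_inverse_on: "Ck_real n inverse (- {0})"
proof (induction n)
  case 0
  show ?case by (auto intro!: continuous_intros)
next
  case (Suc n)
  show ?case
  proof (rule Ck_realI[OF _ Ck_real_minus[OF Ck_real_mult[OF Suc Suc]]])
    fix x :: real assume "x \<in> - {0}"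
    then show "(inverse has_real_derivative - (inverse x * inverse x)) (at x within - {0})"
      using DERIV_inverse[of x "- {0}"] by (simp add: power2_eq_square)
  qed
qed

lemma Ck_real_divide:
  assumes "Ck_real n f S" "Ck_real n g S" "\<And>x. x \<in> S \<Longrightarrow> g x \<noteq> 0"
  shows "Ck_real n (\<lambda>x. f x / g x) S"
  unfolding divide_inverse
  by (intro Ck_real_mult assms Ck_real_compose[OF Ck_real_inverse_on]) (use assms(3) in auto)

lemma Ck_real_sqrt: "Ck_real n sqrt {0<..}"
proof (induction n)
  case 0
  show ?case by (auto intro!: continuous_intros)
next
  case (Suc n)
  show ?case
  proof (rule Ck_realI)
    fix x :: real assume "x \<in> {0<..}"
    then show "(sqrt has_real_derivative inverse (sqrt x) / 2) (at x within {0<..})"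
      using has_field_derivative_at_within[OF DERIV_real_sqrt[of x]] by simp
  next
    show "Ck_real n (\<lambda>x. inverse (sqrt x) / 2) {0<..}"
      by (intro Ck_real_divide Ck_real_const Ck_real_compose[OF Ck_real_inverse_on Suc]) auto
  qed
qed

lemma Ck_real_sin_cos: "Ck_real n sin S \<and> Ck_real n cos S"
proof (induction n)
  case 0
  show ?case by (auto intro!: continuous_intros)
next
  case (Suc n)
  have "Ck_real (Suc n) sin S" by (rule Ck_realI[of _ _ cos]) (use Suc in \<open>auto intro!: derivative_eq_intros\<close>)
  moreover have "Ck_real (Suc n) cos S"
    by (rule Ck_realI[of _ _ "\<lambda>x. - sin x"]) (use Suc in \<open>auto intro!: derivative_eq_intros Ck_real_minus\<close>)
  ultimately show ?case by blast
qed

text \<open>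
The derivatives within the two half-open intervals agree on the overlap because it is open.
\<close>

lemma Ck_real_glue:
  "\<lbrakk>Ck_real n f {0..<1}; Ck_real n f {0<..1}\<rbrakk> \<Longrightarrow> Ck_real n f {0..1}"
proof (induction n arbitrary: f)
  case 0
  have "isCont f x" if "0 < x" "x < 1" for x
    using continuous_on_interior[of "{0..<1}" f x] 0 that by simp
  show ?case unfolding Ck_real.simps continuous_on_eq_continuous_within
  proof
    fix x :: real assume x: "x \<in> {0..1}"
    show "continuous (at x within {0..1}) f"
    proof (cases "x < 1")
      case True
      then have "at x within {0..1} = at x within {0..<1}"
        by (intro at_within_nhd[of x "{..<1}"]) auto
      then show ?thesis using 0(1) x True by (simp add: continuous_on_eq_continuous_within)
    next
      case False
      then have "at x within {0..1} = at x within {0<..1}"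
        using x by (intro at_within_nhd[of x "{0<..}"]) auto
      then show ?thesis using 0(2) x False by (simp add: continuous_on_eq_continuous_within)
    qed
  qed
next
  case (Suc n)
  obtain l where l: "\<And>x. x \<in> {0..<1} \<Longrightarrow> (f has_real_derivative l x) (at x within {0..<1})" "Ck_real n l {0..<1}"
    using Suc.prems(1) by (rule Ck_realE) blast
  obtain r where r: "\<And>x. x \<in> {0<..1} \<Longrightarrow> (f has_real_derivative r x) (at x within {0<..1})" "Ck_real n r {0<..1}"
    using Suc.prems(2) by (rule Ck_realE) blast
  define f' where "f' x = (if x < 1 then l x else r x)" for x
  have eq: "l x = r x" if "0 < x" "x < 1" for x
  proof -
    have "at x within {0..<1} = at x" "at x within {0<..1} = at x"
      using that by (auto intro!: at_within_interior)
    then show ?thesis using l(1)[of x] r(1)[of x] that DERIV_unique by auto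
  qed
  show ?case
  proof (rule Ck_realI)
    show "Ck_real n f' {0..1}"
      by (rule Suc.IH) (rule Ck_real_cong[OF _ l(2)], simp add: f'_def, rule Ck_real_cong[OF _ r(2)], simp add: f'_def eq)
    fix x :: real assume x: "x \<in> {0..1}"
    show "(f has_real_derivative f' x) (at x within {0..1})"
    proof (cases "x < 1")
      case True
      then have "at x within {0..1} = at x within {0..<1}"
        by (intro at_within_nhd[of x "{..<1}"]) auto
      then show ?thesis using l(1)[of x] x True by (simp add: f'_def)
    next
      case False
      then have "at x within {0..1} = at x within {0<..1}"
        using x by (intro at_within_nhd[of x "{0<..}"]) auto
      then show ?thesis using r(1)[of x] x False by (simp add: f'_def)
    qed
  qed
qed

section \<open>Regular singular points\<close>

lemma Ck_real_power_series:
  assumes "\<And>x. summable (\<lambda>n. c n * x ^ n)"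
  shows "Ck_real k (\<lambda>x. \<Sum>n. c n * x ^ n) S"
  using assms
proof (induction k arbitrary: c)
  case 0
  have "continuous_on S (\<lambda>x. \<Sum>n. c n * x ^ n)"
    by (rule DERIV_continuous_on[OF has_field_derivative_at_within[OF termdiffs_strong_converges_everywhere[OF 0]]])
  then show ?case by simp
next
  case (Suc k)
  show ?case
    by (rule Ck_realI[OF has_field_derivative_at_within[OF termdiffs_strong_converges_everywhere[OF Suc.prems]]])
      (rule Suc.IH[OF termdiff_converges_all[OF Suc.prems]])
qed

text \<open>
The entire function \<open>(sin \<surd>y - \<surd>y) / (\<surd>y)\<^sup>3\<close>. It serves to write odd functions of \<open>\<alpha> = \<surd>\<rho> A\<close> as
\<open>\<surd>\<rho>\<close> times a smooth function of \<open>\<rho>\<close> and \<open>A\<close>.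
\<close>

definition sin_rem :: "real \<Rightarrow> real" where
  "sin_rem y = (\<Sum>n. (- 1) ^ Suc n / fact (2 * n + 3) * y ^ n)"

lemma sin_rem_summable: "summable (\<lambda>n. (- 1) ^ Suc n / fact (2 * n + 3) * x ^ n)" for x :: real
proof (rule summable_comparison_test[OF _ summable_exp[of "\<bar>x\<bar>"]], intro exI allI impI)
  fix n
  have "fact n \<le> (fact (2 * n + 3) :: real)" by (rule fact_mono) simp
  then have "\<bar>x\<bar> ^ n / fact (2 * n + 3) \<le> \<bar>x\<bar> ^ n / fact n" by (intro divide_left_mono) auto
  then show "norm ((- 1) ^ Suc n / fact (2 * n + 3) * x ^ n) \<le> inverse (fact n) * \<bar>x\<bar> ^ n"
    by (simp add: abs_mult power_abs divide_inverse mult.commute)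
qed

lemma Ck_real_sin_rem: "Ck_real k sin_rem S"
  unfolding sin_rem_def[abs_def] by (rule Ck_real_power_series[OF sin_rem_summable])

lemma sin_eq_sin_rem: "sin w = w + w ^ 3 * sin_rem (w\<^sup>2)"
proof -
  let ?f = "\<lambda>n. (- 1) ^ n / (fact (2 * n + 1)) * w ^ (2 * n + 1)"
  have s: "summable ?f" and eq: "sin w = suminf ?f" using sin_paired[of w] by (auto simp: sums_iff)
  have shift: "?f (Suc n) = w ^ 3 * ((- 1) ^ Suc n / fact (2 * n + 3) * (w\<^sup>2) ^ n)" for n
  proof -
    have "w ^ (2 * Suc n + 1) = w ^ 3 * (w\<^sup>2) ^ n"
      unfolding power_mult[symmetric] power_add[symmetric] by (rule arg_cong[of _ _ "power w"]) simp
    moreover have "2 * Suc n + 1 = 2 * n + 3" by simp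
    ultimately show ?thesis by (simp only: mult_ac)
  qed
  have "suminf ?f = ?f 0 + (\<Sum>n. ?f (Suc n))" using suminf_split_head[OF s] by simp
  also have "(\<Sum>n. ?f (Suc n)) = w ^ 3 * sin_rem (w\<^sup>2)"
    unfolding shift sin_rem_def by (rule suminf_mult[OF sin_rem_summable])
  finally show ?thesis using eq by simp
qed

lemma moment_integral_continuous:
  assumes "continuous_on {0..<1} F"
  shows "continuous_on ({0..<1} \<times> cbox 0 1) (\<lambda>(x, \<tau>). \<tau> ^ m * F (\<tau> * x :: real) :: real)"
proof -
  have "continuous_on ({0..<1} \<times> cbox 0 1) (\<lambda>p. F (snd p * fst p))"
    by (rule continuous_on_compose2[OF assms])
      (auto intro!: continuous_intros mult_nonneg_nonneg intro: le_less_trans[OF mult_left_le_one_le])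
  then show ?thesis unfolding case_prod_unfold by (intro continuous_intros)
qed

lemma Ck_real_moment_integral:
  "Ck_real n F {0..<1} \<Longrightarrow> Ck_real n (\<lambda>x. integral {0..1} (\<lambda>\<tau>. \<tau> ^ m * F (\<tau> * x))) {0..<1}"
proof (induction n arbitrary: F m)
  case 0
  have "continuous_on {0..<1} (\<lambda>x. integral (cbox 0 1) (\<lambda>\<tau>. \<tau> ^ m * F (\<tau> * x)))"
    by (rule integral_continuous_on_param) (use moment_integral_continuous[of F m] 0 in simp)
  then show ?case by simp
next
  case (Suc n)
  obtain F' where F': "\<And>x. x \<in> {0..<1} \<Longrightarrow> (F has_real_derivative F' x) (at x within {0..<1})"
    "Ck_real n F' {0..<1}" using Suc.prems by (rule Ck_realE) blast
  have Fc: "continuous_on {0..<1} F" using Suc.prems by (rule Ck_real_continuous_on)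
  show ?case
  proof (rule Ck_realI[OF _ Suc.IH[OF F'(2), of "Suc m"]])
    fix x0 :: real assume x0: "x0 \<in> {0..<1}"
    have "((\<lambda>x. integral (cbox 0 1) (\<lambda>\<tau>. \<tau> ^ m * F (\<tau> * x))) has_field_derivative
        integral (cbox 0 1) (\<lambda>\<tau>. \<tau> ^ Suc m * F' (\<tau> * x0))) (at x0 within {0..<1})"
    proof (rule leibniz_rule_field_derivative[where fx = "\<lambda>x \<tau>. \<tau> ^ Suc m * F' (\<tau> * x)"])
      fix x \<tau> :: real assume x: "x \<in> {0..<1}" and t: "\<tau> \<in> cbox 0 1"
      have in1: "\<tau> * y \<in> {0..<1}" if "y \<in> {0..<1}" for y
        using that t mult_left_le_one_le[of y \<tau>] by auto
      have "((F \<circ> (\<lambda>x. \<tau> * x)) has_real_derivative F' (\<tau> * x) * \<tau>) (at x within {0..<1})"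
      proof (rule DERIV_image_chain)
        show "(F has_real_derivative F' (\<tau> * x)) (at (\<tau> * x) within (*) \<tau> ` {0..<1})"
          by (rule has_field_derivative_subset[OF F'(1)[OF in1[OF x]]]) (use in1 in auto)
        show "((*) \<tau> has_real_derivative \<tau>) (at x within {0..<1})" by (auto intro!: derivative_eq_intros)
      qed
      from DERIV_cmult[OF this, of "\<tau> ^ m"]
      show "((\<lambda>x. \<tau> ^ m * F (\<tau> * x)) has_field_derivative \<tau> ^ Suc m * F' (\<tau> * x)) (at x within {0..<1})"
        by (simp add: o_def mult_ac)
    next
      fix x :: real assume x: "x \<in> {0..<1}"
      have "continuous_on {0..1} (\<lambda>\<tau>. F (\<tau> * x))"
        by (rule continuous_on_compose2[OF Fc])
          (use x in \<open>auto intro!: continuous_intros mult_nonneg_nonneg intro: le_less_trans[OF mult_left_le_one_le]\<close>)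
      then show "(\<lambda>\<tau>. \<tau> ^ m * F (\<tau> * x)) integrable_on cbox 0 1"
        by (intro integrable_continuous) (auto intro!: continuous_intros)
    next
      show "continuous_on ({0..<1} \<times> cbox 0 1) (\<lambda>(x, \<tau>). \<tau> ^ Suc m * F' (\<tau> * x))"
        by (rule moment_integral_continuous[OF Ck_real_continuous_on[OF F'(2)]])
    qed (use x0 in auto)
    then show "((\<lambda>x. integral {0..1} (\<lambda>\<tau>. \<tau> ^ m * F (\<tau> * x))) has_real_derivative
        integral {0..1} (\<lambda>\<tau>. \<tau> ^ Suc m * F' (\<tau> * x0))) (at x0 within {0..<1})" by simp
  qed
qed

text \<open>
Integration of \<open>q' = x\<^sup>m \<Phi>\<close> from \<open>0\<close> and the substitution \<open>s = \<tau> x\<close> give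
\<open>f' = (1/\<omega>) \<integral> \<tau>\<^sup>m \<Phi>(\<tau> x) d\<tau>\<close> over \<open>0 \<le> \<tau> \<le> 1\<close>. The right-hand side has no singularity left and is as smooth
as \<open>\<Phi>\<close>. In applications \<open>\<Phi>(x) = F(x, f(x))\<close> with smooth \<open>F\<close>, so each step gains one derivative.
\<close>

lemma singular_regularity:
  fixes f q \<Phi> \<omega> :: "real \<Rightarrow> real"
  assumes f: "continuous_on {0..<1} f"
    and \<omega>: "\<And>n. Ck_real n \<omega> {0..<1}" "\<And>x. x \<in> {0..<1} \<Longrightarrow> \<omega> x \<noteq> 0"
    and df: "\<And>x. 0 < x \<Longrightarrow> x < 1 \<Longrightarrow> (f has_real_derivative q x / (x ^ Suc m * \<omega> x)) (at x)"
    and dq: "\<And>x. 0 < x \<Longrightarrow> x < 1 \<Longrightarrow> (q has_real_derivative x ^ m * \<Phi> x) (at x)"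
    and q0: "(q \<longlongrightarrow> 0) (at_right 0)"
    and boot: "\<And>n. Ck_real n f {0..<1} \<Longrightarrow> Ck_real n \<Phi> {0..<1}"
  shows "Ck_real n f {0..<1}"
proof -
  define M where "M x = integral {0..1} (\<lambda>\<tau>. \<tau> ^ m * \<Phi> (\<tau> * x))" for x
  have MC: "Ck_real n M {0..<1}" if "Ck_real n f {0..<1}" for n
    unfolding M_def[abs_def] by (rule Ck_real_moment_integral[OF boot[OF that]])
  have Mc: "continuous_on {0..<1} M" using MC[of 0] f by simp
  have \<omega>c: "continuous_on {0..<1} \<omega>" using \<omega>(1)[of 0] by simp
  have qM: "q x = x ^ Suc m * M x" if x: "0 < x" "x < 1" for x
  proof -
    define Q where "Q s = (if s = 0 then 0 else q s)" for s
    have Qd: "(Q has_real_derivative s ^ m * \<Phi> s) (at s)" if "0 < s" "s < 1" for s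
      by (rule DERIV_cong_ev[THEN iffD1, OF refl _ refl dq[OF that]])
        (auto simp: Q_def eventually_nhds_metric dist_real_def intro!: exI[of _ s] that)
    have "continuous_on {0..x} Q" unfolding continuous_on_eq_continuous_within
    proof
      fix s assume s: "s \<in> {0..x}"
      show "continuous (at s within {0..x}) Q"
      proof (cases "s = 0")
        case True
        have "(Q \<longlongrightarrow> 0) (at_right 0)"
          by (rule Lim_transform_eventually[OF q0]) (auto simp: Q_def eventually_at_filter)
        moreover have "at 0 within {0..x} = at_right 0"
          using x(1) by (metis at_within_Icc_at_right)
        ultimately show ?thesis using True by (simp add: continuous_within Q_def)
      next
        case False
        then show ?thesis using Qd[of s] s x by (auto intro: continuous_at_imp_continuous_at_within DERIV_isCont)
      qed
    qed
    then have "((\<lambda>s. s ^ m * \<Phi> s) has_integral (Q x - Q 0)) {0..x}"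
      using x Qd by (intro fundamental_theorem_of_calculus_interior)
        (auto simp flip: has_real_derivative_iff_has_vector_derivative)
    then have "((\<lambda>s. s ^ m * \<Phi> s) has_integral q x) {0..x}" using x by (simp add: Q_def)
    from has_integral_stretch_real[OF this, of x]
    have "((\<lambda>\<tau>. (x * \<tau>) ^ m * \<Phi> (x * \<tau>)) has_integral (q x / x)) ((\<lambda>t. t / x) ` {0..x})" using x by simp
    moreover have "(\<lambda>t. t / x) ` {0..x} = {0..1}" using x by (simp add: image_divide_atLeastAtMost)
    ultimately have "((\<lambda>\<tau>. x ^ m * (\<tau> ^ m * \<Phi> (\<tau> * x))) has_integral (q x / x)) {0..1}"
      by (simp add: power_mult_distrib mult_ac)
    from has_integral_mult_right[OF this, of "1 / x ^ m"]
    have "((\<lambda>\<tau>. \<tau> ^ m * \<Phi> (\<tau> * x)) has_integral (q x / x ^ Suc m)) {0..1}" using x by (simp add: mult_ac)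
    then have "M x = q x / x ^ Suc m" unfolding M_def by (rule integral_unique)
    then show ?thesis using x by simp
  qed
  define D where "D x = M x / \<omega> x" for x
  have Dc: "continuous_on {0..<1} D" unfolding D_def by (intro continuous_on_divide Mc \<omega>c) (use \<omega>(2) in auto)
  have dfD: "(f has_real_derivative D x) (at x)" if "0 < x" "x < 1" for x
  proof -
    have "q x / (x ^ Suc m * \<omega> x) = D x" using that \<omega>(2)[of x] by (simp add: qM[OF that] D_def)
    then show ?thesis using df[OF that] by simp
  qed
  have fD: "(f has_real_derivative D x) (at x within {0..<1})" if x: "x \<in> {0..<1}" for x
  proof -
    obtain b where b: "x < b" "b < 1" using x dense[of x 1] by auto
    have eq: "f y = f 0 + integral {0..y} D" if "y \<in> {0..b}" for y
    proof -
      have "(D has_integral f y - f 0) {0..y}"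
      proof (rule fundamental_theorem_of_calculus_interior)
        show "0 \<le> y" using that by simp
        show "continuous_on {0..y} f" by (rule continuous_on_subset[OF f]) (use that b in auto)
        show "(f has_vector_derivative D z) (at z)" if "z \<in> {0<..<y}" for z
          using dfD[of z] that \<open>y \<in> {0..b}\<close> b
          by (simp flip: has_real_derivative_iff_has_vector_derivative)
      qed
      then show ?thesis by (simp add: integral_unique)
    qed
    have "((\<lambda>u. integral {0..u} D) has_real_derivative D x) (at x within {0..b})"
    proof (rule integral_has_real_derivative)
      show "continuous_on {0..b} D" by (rule continuous_on_subset[OF Dc]) (use b in auto)
    qed (use x b in auto)
    then have "((\<lambda>u. f 0 + integral {0..u} D) has_real_derivative D x) (at x within {0..b})"
      by (auto intro!: derivative_eq_intros)
    then have "(f has_real_derivative D x) (at x within {0..b})"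
      by (rule has_real_derivative_transform[rotated 2, OF _ _ eq]) (use x b in auto)
    moreover have "at x within {0..b} = at x within {0..<1}"
      by (rule at_within_nhd[of x "{..<b}"]) (use b in auto)
    ultimately show ?thesis by simp
  qed
  show ?thesis
  proof (induction n)
    case 0
    show ?case using f by simp
  next
    case (Suc n)
    show ?case
    proof (rule Ck_realI[OF fD])
      show "Ck_real n D {0..<1}" unfolding D_def[abs_def]
        by (rule Ck_real_divide[OF MC[OF Suc] \<omega>])
    qed
  qed
qed

section \<open>Smooth profiles on the closed interval\<close>

lemma sin_cos_eq_sin_rem: "sin t * cos t = t + 4 * t ^ 3 * sin_rem (4 * t\<^sup>2)" for t :: real
  using sin_eq_sin_rem[of "2 * t"] by (simp add: sin_double power_mult_distrib)

lemma cos_eq_sin_rem: "cos t = 1 - t\<^sup>2 / 2 * (1 + t\<^sup>2 / 4 * sin_rem (t\<^sup>2 / 4))\<^sup>2" for t :: real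
proof -
  have "cos t = 1 - 2 * (sin (t / 2))\<^sup>2" using cos_double_sin[of "t / 2"] by simp
  also have "sin (t / 2) = t / 2 * (1 + t\<^sup>2 / 4 * sin_rem (t\<^sup>2 / 4))"
    using sin_eq_sin_rem[of "t / 2"] by (simp add: power_divide algebra_simps power2_eq_square power3_eq_cube)
  finally show ?thesis by (simp add: power_mult_distrib power_divide)
qed

lemma logit_tendsto_right_0: "filterlim (\<lambda>x. ln (x / (1 - x))) at_bot (at_right (0::real))"
proof (rule filterlim_compose[OF ln_at_0])
  have "((\<lambda>x::real. x / (1 - x)) \<longlongrightarrow> 0 / (1 - 0)) (at_right 0)" by (intro tendsto_intros) auto
  moreover have "eventually (\<lambda>x::real. 0 < x / (1 - x)) (at_right 0)"
    unfolding eventually_at_right_field by (intro exI[of _ 1]) auto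
  ultimately show "LIM x at_right 0. x / (1 - x) :> at_right (0::real)"
    by (intro tendsto_imp_filterlim_at_right) auto
qed

lemma logit_tendsto_left_1: "filterlim (\<lambda>y. ln ((1 - y) / y)) at_top (at_right (0::real))"
proof -
  have fl: "filterlim (\<lambda>x. - ln (x / (1 - x))) at_top (at_right (0::real))"
    using logit_tendsto_right_0 by (simp add: filterlim_uminus_at_top)
  have ev: "eventually (\<lambda>x::real. - ln (x / (1 - x)) = ln ((1 - x) / x)) (at_right 0)"
    unfolding eventually_at_right_field by (intro exI[of _ 1]) (auto simp: ln_div)
  show ?thesis by (rule filterlim_cong[OF refl refl ev, THEN iffD1, OF fl])
qed

lemma at_within_left_end: "at (0::real) within {0..<1} = at_right 0"
proof -
  have "at (0::real) within {0..<1} = at 0 within {0..}" by (rule at_within_nhd[of 0 "{..<1}"]) auto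
  also have "\<dots> = at_right 0"
    by (rule filter_eqI) (auto simp: eventually_at_filter less_le elim: eventually_mono)
  finally show ?thesis .
qed

context profile_ode begin

text \<open>
The solution on the line in the variable \<open>x = logistic s\<close>, where \<open>d/ds = x (1 - x) d/dx\<close>.
\<close>

lemma profile_angle:
  obtains \<theta> T :: "real \<Rightarrow> real" and L0 L1 :: real where
    "\<And>x. 0 < x \<Longrightarrow> x < 1 \<Longrightarrow> 0 < \<theta> x \<and> \<theta> x < pi"
    "\<And>x. 0 < x \<Longrightarrow> x < 1 \<Longrightarrow> (\<theta> has_real_derivative T x / (x * (1 - x))) (at x)"
    "\<And>x. 0 < x \<Longrightarrow> x < 1 \<Longrightarrow> (T has_real_derivative ((real k - 1) * x * T x
        + (1 + (4 * real k - 1) * x) / 4 * (sin (\<theta> x) * cos (\<theta> x))) / (x * (1 - x))) (at x)"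
    "(\<theta> \<longlongrightarrow> 0) (at_right 0)" "(T \<longlongrightarrow> 0) (at_right 0)" "((\<lambda>x. \<theta> x / sqrt x) \<longlongrightarrow> L0) (at_right 0)"
    "((\<lambda>y. \<theta> (1 - y)) \<longlongrightarrow> pi) (at_right 0)" "((\<lambda>y. T (1 - y)) \<longlongrightarrow> 0) (at_right 0)"
    "((\<lambda>y. (pi - \<theta> (1 - y)) / y) \<longlongrightarrow> L1) (at_right 0)"
proof -
  obtain al be where S: "sol al be" and be: "\<And>s. 0 < be s" and al: "\<And>s. 0 < al s" "\<And>s. al s < pi"
    and slope: "\<And>s. (be s)\<^sup>2 \<le> H s * (sin (al s))\<^sup>2"
    using entire_solution by metis
  have lim0: "(al \<longlongrightarrow> 0) at_bot" by (rule transit_bot[OF S be al])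
  have lim1: "(al \<longlongrightarrow> pi) at_top" by (rule transit_top[OF S be al])
  have be0: "(be \<longlongrightarrow> 0) at_bot"
    by (rule slope_tendsto_0[OF slope]) (use tendsto_sin[OF lim0] in simp)
  have be1: "(be \<longlongrightarrow> 0) at_top"
    by (rule slope_tendsto_0[OF slope]) (use tendsto_sin[OF lim1] in simp)
  obtain L0 where L0: "((\<lambda>s. al s / sqrt (logistic s)) \<longlongrightarrow> L0) at_bot"
    using quotient_limit_bot[OF S be al lim0 be0] .
  obtain L1 where L1: "((\<lambda>s. (pi - al s) / (1 - logistic s)) \<longlongrightarrow> L1) at_top"
    using quotient_limit_top[OF S be al lim1 be1] .
  define \<sigma> where "\<sigma> x = ln (x / (1 - x))" for x :: real
  have \<sigma>: "logistic (\<sigma> x) = x" if "0 < x" "x < 1" for x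
    unfolding \<sigma>_def using logistic_logit[OF that] .
  have d\<sigma>: "(\<sigma> has_real_derivative 1 / (x * (1 - x))) (at x)" if "0 < x" "x < 1" for x
  proof -
    have "((\<lambda>x. ln x - ln (1 - x)) has_real_derivative 1 / (x * (1 - x))) (at x)"
      using that by (auto intro!: derivative_eq_intros simp: field_simps)
    then show ?thesis
      by (rule has_field_derivative_transform_within_open[of _ _ _ "{0<..<1}"])
        (use that in \<open>auto simp: \<sigma>_def ln_div\<close>)
  qed
  have \<sigma>0: "filterlim \<sigma> at_bot (at_right 0)" unfolding \<sigma>_def[abs_def] by (rule logit_tendsto_right_0)
  have \<sigma>1: "filterlim (\<lambda>y. \<sigma> (1 - y)) at_top (at_right 0)"
    unfolding \<sigma>_def[abs_def] using logit_tendsto_left_1 by simp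
  show ?thesis
  proof (rule that[of "\<lambda>x. al (\<sigma> x)" "\<lambda>x. be (\<sigma> x)" L0 L1])
    fix x :: real assume x: "0 < x" "x < 1"
    show "0 < al (\<sigma> x) \<and> al (\<sigma> x) < pi" using al by simp
    show "((\<lambda>x. al (\<sigma> x)) has_real_derivative be (\<sigma> x) / (x * (1 - x))) (at x)"
      using DERIV_chain2[OF sol_deriv(1)[OF S] d\<sigma>[OF x]] by simp
    show "((\<lambda>x. be (\<sigma> x)) has_real_derivative ((real k - 1) * x * be (\<sigma> x)
        + (1 + (4 * real k - 1) * x) / 4 * (sin (al (\<sigma> x)) * cos (al (\<sigma> x)))) / (x * (1 - x))) (at x)"
      using DERIV_chain2[OF sol_deriv(2)[OF S] d\<sigma>[OF x]] by (simp add: \<sigma>[OF x] H_def)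
  next
    show "((\<lambda>x. al (\<sigma> x)) \<longlongrightarrow> 0) (at_right 0)" "((\<lambda>x. be (\<sigma> x)) \<longlongrightarrow> 0) (at_right 0)"
      using filterlim_compose[OF lim0 \<sigma>0] filterlim_compose[OF be0 \<sigma>0] .
    show "((\<lambda>y. al (\<sigma> (1 - y))) \<longlongrightarrow> pi) (at_right 0)" "((\<lambda>y. be (\<sigma> (1 - y))) \<longlongrightarrow> 0) (at_right 0)"
      using filterlim_compose[OF lim1 \<sigma>1] filterlim_compose[OF be1 \<sigma>1] .
    show "((\<lambda>x. al (\<sigma> x) / sqrt x) \<longlongrightarrow> L0) (at_right 0)"
      by (rule Lim_transform_eventually[OF filterlim_compose[OF L0 \<sigma>0]])
        (auto simp: eventually_at_right_field \<sigma> intro!: exI[of _ 1])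
    show "((\<lambda>y. (pi - al (\<sigma> (1 - y))) / y) \<longlongrightarrow> L1) (at_right 0)"
      by (rule Lim_transform_eventually[OF filterlim_compose[OF L1 \<sigma>1]])
        (auto simp: eventually_at_right_field \<sigma> intro!: exI[of _ 1])
  qed
qed

lemma continuous_extension_at_0:
  fixes f :: "real \<Rightarrow> real"
  assumes "\<And>x. 0 < x \<Longrightarrow> x < 1 \<Longrightarrow> isCont f x" "(f \<longlongrightarrow> L) (at_right 0)"
  shows "continuous_on {0..<1} (\<lambda>x. if x = 0 then L else f x)" (is "continuous_on _ ?g")
  unfolding continuous_on_eq_continuous_within
proof
  fix x :: real assume x: "x \<in> {0..<1}"
  show "continuous (at x within {0..<1}) ?g"
  proof (cases "x = 0")
    case True
    have "(?g \<longlongrightarrow> L) (at_right 0)"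
      by (rule Lim_transform_eventually[OF assms(2)]) (auto simp: eventually_at_filter)
    then show ?thesis using True by (simp add: continuous_within at_within_left_end)
  next
    case False
    then have c: "isCont f x" using x assms(1) by simp
    have "eventually (\<lambda>y. f y = ?g y) (nhds x)"
      unfolding eventually_nhds using False by (intro exI[of _ "- {0}"]) auto
    from isCont_cong[OF this, THEN iffD1, OF c]
    have "isCont ?g x" .
    then show ?thesis by (rule continuous_at_imp_continuous_at_within)
  qed
qed

text \<open>
For \<open>\<theta> = \<surd>x A\<close> the equation takes the divergence form \<open>(x\<^sup>2 (1 - x)\<^sup>k A')' = x P\<close>, in which the
first-order terms have disappeared; the term \<open>P\<close> is smooth at \<open>0\<close> because the lowest-order contributions
of \<open>sin \<theta> cos \<theta>\<close> and of \<open>\<surd>x\<close> cancel.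
\<close>

lemma left_regular:
  fixes \<theta> T :: "real \<Rightarrow> real"
  assumes d\<theta>: "\<And>x. 0 < x \<Longrightarrow> x < 1 \<Longrightarrow> (\<theta> has_real_derivative T x / (x * (1 - x))) (at x)"
    and dT: "\<And>x. 0 < x \<Longrightarrow> x < 1 \<Longrightarrow> (T has_real_derivative ((real k - 1) * x * T x
        + (1 + (4 * real k - 1) * x) / 4 * (sin (\<theta> x) * cos (\<theta> x))) / (x * (1 - x))) (at x)"
    and lim: "(\<theta> \<longlongrightarrow> 0) (at_right 0)" "(T \<longlongrightarrow> 0) (at_right 0)" "((\<lambda>x. \<theta> x / sqrt x) \<longlongrightarrow> L) (at_right 0)"
  shows "Ck_real n (\<lambda>x. if x = 0 then L else \<theta> x / sqrt x) {0..<1}"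
proof -
  define A where "A x = (if x = 0 then L else \<theta> x / sqrt x)" for x
  define m where "m = k - 2"
  have km: "k = m + 2" "real k = real m + 2" using k2 by (auto simp: m_def)
  define q where "q x = sqrt x * ((1 - x) ^ (m + 1) * T x - (1 - x) ^ (m + 2) * \<theta> x / 2)" for x
  define P where "P x = (1 - x) ^ m * (A x * ((4 * real k + 1 - x) / 4 + real k / 2 * (1 - x))
      + (1 + (4 * real k - 1) * x) * A x ^ 3 * sin_rem (4 * x * (A x)\<^sup>2))" for x
  have A: "\<theta> x = sqrt x * A x" if "0 < x" for x using that by (simp add: A_def)
  have "Ck_real n A {0..<1}"
  proof (rule singular_regularity[where q = q and \<Phi> = P and \<omega> = "\<lambda>x. (1 - x) ^ (m + 2)" and m = 1])
    have "isCont (\<lambda>x. \<theta> x / sqrt x) x" if "0 < x" "x < 1" for x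
      using that DERIV_isCont[OF d\<theta>[OF that]] by (intro continuous_intros) auto
    then show "continuous_on {0..<1} A" unfolding A_def[abs_def]
      by (rule continuous_extension_at_0) (use lim in auto)
    show "Ck_real n (\<lambda>x. (1 - x) ^ (m + 2)) {0..<1}" for n
      by (intro Ck_real_power Ck_real_diff Ck_real_const Ck_real_ident)
    show "(1 - x) ^ (m + 2) \<noteq> 0" if "x \<in> {0..<1}" for x :: real using that by simp
    have "(q \<longlongrightarrow> sqrt 0 * ((1 - 0) ^ (m + 1) * 0 - (1 - 0) ^ (m + 2) * 0 / 2)) (at_right 0)"
      unfolding q_def by (intro tendsto_intros lim) auto
    then show "(q \<longlongrightarrow> 0) (at_right 0)" by simp
    show "Ck_real n P {0..<1}" if "Ck_real n A {0..<1}" for n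
      unfolding P_def
      by (intro Ck_real_mult Ck_real_add Ck_real_diff Ck_real_power Ck_real_const Ck_real_ident
          Ck_real_divide Ck_real_compose[OF Ck_real_sin_rem[of n UNIV]] that) auto
  next
    fix x :: real assume x: "0 < x" "x < 1"
    define u where "u = sqrt x"
    have u: "u > 0" "x = u * u" using x by (auto simp: u_def)
    have du: "(sqrt has_real_derivative 1 / (2 * u)) (at x)"
      using DERIV_real_sqrt[OF x(1)] by (simp add: u_def inverse_eq_divide mult.commute)
    have dd: "((\<lambda>x. \<theta> x / sqrt x) has_real_derivative
        (T x / (x * (1 - x)) * u - \<theta> x * (1 / (2 * u))) / (u * u)) (at x)"
    proof -
      have "sqrt x \<noteq> 0" using x by simp
      from DERIV_divide[OF d\<theta>[OF x] du this] show ?thesis by (simp only: u_def)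
    qed
    have "(T x / (x * (1 - x)) * u - \<theta> x * (1 / (2 * u))) / (u * u) = q x / (x ^ Suc 1 * (1 - x) ^ (m + 2))"
    proof -
      have gen: "(t / (u * u * Y) * u - a * (1 / (2 * u))) / (u * u)
          = u * (Y * M * t - Y * Y * M * a / 2) / (u * u * (u * u) * (Y * Y * M))"
        if "Y \<noteq> 0" "M \<noteq> 0" for t a Y M :: real
        using that u(1) by (simp add: field_simps)
      have "(1 - x) ^ (m + 1) = (1 - x) * (1 - x) ^ m" "(1 - x) ^ (m + 2) = (1 - x) * (1 - x) * (1 - x) ^ m"
        "x ^ Suc 1 = x * x" by simp_all
      moreover have "1 - x \<noteq> 0" "(1 - x) ^ m \<noteq> 0" using x by simp_all
      ultimately show ?thesis
        using gen[of "1 - x" "(1 - x) ^ m" "T x" "\<theta> x"]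
        unfolding q_def u_def[symmetric] u(2)[symmetric] by (simp add: mult.assoc)
    qed
    with dd have "((\<lambda>x. \<theta> x / sqrt x) has_real_derivative q x / (x ^ Suc 1 * (1 - x) ^ (m + 2))) (at x)" by simp
    then show "(A has_real_derivative q x / (x ^ Suc 1 * (1 - x) ^ (m + 2))) (at x)"
      by (rule has_field_derivative_transform_within_open[of _ _ _ "{0<..<1}"])
        (use x in \<open>auto simp: A_def\<close>)
    let ?sc = "sin (\<theta> x) * cos (\<theta> x)" and ?h = "(1 + (4 * real k - 1) * x) / 4"
    have dp: "((\<lambda>x. (1 - x) ^ j) has_real_derivative real j * (1 - x) ^ (j - 1) * (- 1)) (at x)" for j
      by (auto intro!: derivative_eq_intros)
    have d1: "((\<lambda>x. (1 - x) ^ (m + 1) * T x - (1 - x) ^ (m + 2) * \<theta> x / 2) has_real_derivative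
        (1 - x) ^ m * ?h * ?sc / x + (real m + 2) / 2 * (1 - x) ^ (m + 1) * \<theta> x
         - (1 - x) ^ (m + 1) * T x / (2 * x)) (at x)"
    proof (rule DERIV_cong[OF DERIV_diff[OF DERIV_mult[OF dp[of "m + 1"] dT[OF x]]
        DERIV_cdivide[OF DERIV_mult[OF dp[of "m + 2"] d\<theta>[OF x]], of 2]]])
      define Y where "Y = 1 - x"
      have Y: "Y \<noteq> 0" "x \<noteq> 0" using x by (auto simp: Y_def)
      have "real (m + 1) * Y ^ m * - 1 * T x + ((real m + 1) * x * T x + ?h * ?sc) / (x * Y) * (Y * Y ^ m)
          - (real (m + 2) * (Y * Y ^ m) * - 1 * \<theta> x + T x / (x * Y) * (Y * (Y * Y ^ m))) / 2
        = Y ^ m * ?h * ?sc / x + (real m + 2) / 2 * (Y * Y ^ m) * \<theta> x - (Y * Y ^ m) * T x / (2 * x)"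
        using Y by (simp add: field_simps)
      then show "real (m + 1) * (1 - x) ^ (m + 1 - 1) * - 1 * T x +
        ((real k - 1) * x * T x + ?h * ?sc) / (x * (1 - x)) * (1 - x) ^ (m + 1) -
        (real (m + 2) * (1 - x) ^ (m + 2 - 1) * - 1 * \<theta> x + T x / (x * (1 - x)) * (1 - x) ^ (m + 2)) / 2
        = (1 - x) ^ m * ?h * ?sc / x + (real m + 2) / 2 * (1 - x) ^ (m + 1) * \<theta> x - (1 - x) ^ (m + 1) * T x / (2 * x)"
        unfolding Y_def[symmetric] km(2) using Y by (simp add: add.commute)
    qed
    show "(q has_real_derivative x ^ 1 * P x) (at x)"
      unfolding q_def[abs_def]
    proof (rule DERIV_cong[OF DERIV_mult[OF du d1]])
      define Y where "Y = 1 - x"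
      define c where "c = sin_rem (4 * x * (A x)\<^sup>2)"
      have th: "\<theta> x = u * A x" using A[OF x(1)] by (simp add: u_def)
      have sc: "?sc = u * (A x + 4 * x * A x ^ 3 * c)"
        unfolding sin_cos_eq_sin_rem th c_def
        by (simp add: power_mult_distrib u(2) power2_eq_square power3_eq_cube algebra_simps)
      have "1 / (2 * u) * (Y * Y ^ m * T x - Y * Y * Y ^ m * (u * A x) / 2)
          + (Y ^ m * ?h * (u * (A x + 4 * x * A x ^ 3 * c)) / x + (real m + 2) / 2 * (Y * Y ^ m) * (u * A x)
            - Y * Y ^ m * T x / (2 * x)) * u
        = Y ^ m * (?h * (A x + 4 * x * A x ^ 3 * c) + (real m + 2) / 2 * Y * x * A x - Y * Y * A x / 4)"
        using u(1) unfolding u(2) by (simp add: field_simps)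
      also have "\<dots> = x * (Y ^ m * (A x * ((4 * real k + 1 - x) / 4 + real k / 2 * Y)
          + (1 + (4 * real k - 1) * x) * A x ^ 3 * c))"
        unfolding km(2) Y_def by (simp add: field_simps)
      finally show "1 / (2 * u) * ((1 - x) ^ (m + 1) * T x - (1 - x) ^ (m + 2) * \<theta> x / 2) +
          ((1 - x) ^ m * ?h * ?sc / x + (real m + 2) / 2 * (1 - x) ^ (m + 1) * \<theta> x
            - (1 - x) ^ (m + 1) * T x / (2 * x)) * sqrt x = x ^ 1 * P x"
        unfolding P_def c_def[symmetric] u_def[symmetric] th sc[unfolded th] Y_def[symmetric]
        by (simp add: mult.assoc)
    qed
  qed
  then show ?thesis unfolding A_def[abs_def] .
qed

text \<open>
With \<open>y = 1 - x\<close> and \<open>\<pi> - \<theta> = y B\<close> the divergence form is \<open>(y\<^bsup>k+2\<^esup> (1 - y) B')' = y\<^bsup>k+1\<^esup> P\<close>.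
\<close>

lemma right_regular:
  fixes \<theta> T :: "real \<Rightarrow> real"
  assumes d\<theta>: "\<And>x. 0 < x \<Longrightarrow> x < 1 \<Longrightarrow> (\<theta> has_real_derivative T x / (x * (1 - x))) (at x)"
    and dT: "\<And>x. 0 < x \<Longrightarrow> x < 1 \<Longrightarrow> (T has_real_derivative ((real k - 1) * x * T x
        + (1 + (4 * real k - 1) * x) / 4 * (sin (\<theta> x) * cos (\<theta> x))) / (x * (1 - x))) (at x)"
    and lim: "((\<lambda>y. \<theta> (1 - y)) \<longlongrightarrow> pi) (at_right 0)" "((\<lambda>y. T (1 - y)) \<longlongrightarrow> 0) (at_right 0)"
      "((\<lambda>y. (pi - \<theta> (1 - y)) / y) \<longlongrightarrow> L) (at_right 0)"
  shows "Ck_real n (\<lambda>y. if y = 0 then L else (pi - \<theta> (1 - y)) / y) {0..<1}"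
proof -
  define B where "B y = (if y = 0 then L else (pi - \<theta> (1 - y)) / y)" for y
  define m where "m = k - 2"
  have km: "k = m + 2" "real k = real m + 2" using k2 by (auto simp: m_def)
  define q where "q y = y ^ (m + 2) * T (1 - y) - (1 - y) * y ^ (m + 2) * (pi - \<theta> (1 - y))" for y
  define P where "P y = B y * (1 / (4 * (1 - y)) + real k + 1)
      + (4 * real k - (4 * real k - 1) * y) / (1 - y) * y * B y ^ 3 * sin_rem (4 * (y\<^sup>2 * (B y)\<^sup>2))" for y
  have B: "pi - \<theta> (1 - y) = y * B y" if "0 < y" for y using that by (simp add: B_def)
  have dch: "((\<lambda>y. f (1 - y)) has_real_derivative - D) (at y)"
    if "(f has_real_derivative D) (at (1 - y))" for f D and y :: real
  proof -
    have "((\<lambda>y. 1 - y) has_real_derivative - 1) (at y)" by (auto intro!: derivative_eq_intros)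
    from DERIV_chain2[where g = "\<lambda>y. 1 - y" and x = y, OF that this] show ?thesis by simp
  qed
  have "Ck_real n B {0..<1}"
  proof (rule singular_regularity[where q = q and \<Phi> = P and \<omega> = "\<lambda>y. 1 - y" and m = "m + 3"])
    have "isCont (\<lambda>y. (pi - \<theta> (1 - y)) / y) y" if "0 < y" "y < 1" for y
      using that DERIV_isCont[OF dch[OF d\<theta>[of "1 - y"]]] by (intro continuous_intros) auto
    then show "continuous_on {0..<1} B" unfolding B_def[abs_def]
      by (rule continuous_extension_at_0) (use lim in auto)
    show "Ck_real n (\<lambda>y. 1 - y) {0..<1}" for n
      by (intro Ck_real_diff Ck_real_const Ck_real_ident)
    show "1 - y \<noteq> 0" if "y \<in> {0..<1}" for y :: real using that by simp
    have "(q \<longlongrightarrow> 0 ^ (m + 2) * 0 - (1 - 0) * 0 ^ (m + 2) * (pi - pi)) (at_right 0)"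
      unfolding q_def by (intro tendsto_intros lim)
    then show "(q \<longlongrightarrow> 0) (at_right 0)" by simp
    show "Ck_real n P {0..<1}" if "Ck_real n B {0..<1}" for n
      unfolding P_def
      by (intro Ck_real_mult Ck_real_add Ck_real_diff Ck_real_power Ck_real_const Ck_real_ident
          Ck_real_divide Ck_real_compose[OF Ck_real_sin_rem[of n UNIV]] that) auto
  next
    fix y :: real assume y: "0 < y" "y < 1"
    define Y where "Y = 1 - y"
    have Y: "Y \<noteq> 0" "y \<noteq> 0" "0 < 1 - y" "1 - y < 1" using y by (auto simp: Y_def)
    have db: "((\<lambda>y. pi - \<theta> (1 - y)) has_real_derivative T Y / (Y * y)) (at y)"
      using DERIV_diff[OF DERIV_const[of pi] dch[OF d\<theta>[OF Y(3,4)]]] by (simp add: Y_def)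
    have "((\<lambda>y. (pi - \<theta> (1 - y)) / y) has_real_derivative
        (T Y / (Y * y) * y - (pi - \<theta> Y) * 1) / (y * y)) (at y)"
      using DERIV_divide[OF db DERIV_ident Y(2)] by (simp add: Y_def)
    moreover have "(T Y / (Y * y) * y - (pi - \<theta> Y) * 1) / (y * y) = q y / (y ^ Suc (m + 3) * (1 - y))"
    proof -
      have gen: "(t / (Y * y) * y - d * 1) / (y * y) = (y * y * M * t - Y * (y * y * M) * d) / (y * y * y * y * M * Y)"
        if "M \<noteq> 0" for t d M :: real
        using that Y by (simp add: field_simps)
      have "y ^ (m + 2) = y * y * y ^ m" "y ^ Suc (m + 3) = y * y * y * y * y ^ m"
        by (simp_all add: numeral_3_eq_3)
      then show ?thesis
        unfolding q_def Y_def[symmetric] using gen[of "y ^ m" "T Y" "pi - \<theta> Y"] Y(2) by simp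
    qed
    ultimately have "((\<lambda>y. (pi - \<theta> (1 - y)) / y) has_real_derivative q y / (y ^ Suc (m + 3) * (1 - y))) (at y)" by simp
    then show "(B has_real_derivative q y / (y ^ Suc (m + 3) * (1 - y))) (at y)"
      by (rule has_field_derivative_transform_within_open[of _ _ _ "{0<..<1}"])
        (use y in \<open>auto simp: B_def\<close>)
    let ?sc = "sin (\<theta> Y) * cos (\<theta> Y)" and ?h = "(1 + (4 * real k - 1) * Y) / 4"
    have dp: "((\<lambda>y. y ^ (m + 2)) has_real_derivative (real m + 2) * (y * y ^ m)) (at y)"
      by (rule DERIV_cong[OF DERIV_pow]) simp
    have rk1: "real k - 1 = real m + 1" using km(2) by simp
    have dT': "((\<lambda>y. T (1 - y)) has_real_derivative - (((real m + 1) * Y * T Y + ?h * ?sc) / (Y * y))) (at y)"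
      using dch[OF dT[OF Y(3,4)]] rk1 by (simp only: Y_def) simp
    have dl: "((\<lambda>y. (1 - y) * y ^ (m + 2)) has_real_derivative
        (- 1) * y ^ (m + 2) + (real m + 2) * (y * y ^ m) * Y) (at y)"
      by (rule DERIV_cong[OF DERIV_mult[OF DERIV_diff[OF DERIV_const DERIV_ident] dp]]) (simp add: Y_def)
    show "(q has_real_derivative y ^ (m + 3) * P y) (at y)"
      unfolding q_def[abs_def]
    proof (rule DERIV_cong[OF DERIV_diff[OF DERIV_mult[OF dp dT'] DERIV_mult[OF dl db]]])
      define M where "M = y ^ m"
      define b where "b = B y"
      define c where "c = sin_rem (4 * (y\<^sup>2 * b\<^sup>2))"
      have th: "pi - \<theta> Y = y * b" using B[OF y(1)] by (simp add: Y_def b_def)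
      have "?sc = - (sin (pi - \<theta> Y) * cos (pi - \<theta> Y))" by simp
      then have sc: "?sc = - (y * b + 4 * y ^ 3 * b ^ 3 * c)"
        unfolding sin_cos_eq_sin_rem th c_def by (simp add: power_mult_distrib)
      have "(real m + 2) * (y * M) * T Y + - (((real m + 1) * Y * T Y + ?h * ?sc) / (Y * y)) * (y * (y * M))
          - ((- 1 * (y * (y * M)) + (real m + 2) * (y * M) * Y) * (y * b) + T Y / (Y * y) * (Y * (y * (y * M))))
        = - ?h * ?sc * y * M / Y - (- 1 * (y * (y * M)) + (real m + 2) * (y * M) * Y) * (y * b)"
        using Y by (simp add: field_simps)
      also have "\<dots> = y * (y * M) * (?h / Y * (b + 4 * y\<^sup>2 * b ^ 3 * c) + (y - (real m + 2) * Y) * b)"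
        unfolding sc using Y(1) by (simp add: field_simps power2_eq_square power3_eq_cube)
      also have "?h / Y * (b + 4 * y\<^sup>2 * b ^ 3 * c) + (y - (real m + 2) * Y) * b
          = y * (b * (1 / (4 * Y) + real k + 1) + (4 * real k - (4 * real k - 1) * y) / Y * y * b ^ 3 * c)"
      proof -
        have y1: "y = 1 - Y" by (simp add: Y_def)
        show ?thesis unfolding km(2) y1 using Y(1)
          by (simp add: field_simps power2_eq_square power3_eq_cube)
      qed
      finally show "(real m + 2) * (y * y ^ m) * T (1 - y) + - (((real m + 1) * Y * T Y + ?h * ?sc) / (Y * y)) * y ^ (m + 2) -
        ((- 1 * y ^ (m + 2) + (real m + 2) * (y * y ^ m) * Y) * (pi - \<theta> (1 - y)) +
         T Y / (Y * y) * ((1 - y) * y ^ (m + 2))) = y ^ (m + 3) * P y"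
        unfolding P_def b_def[symmetric] c_def[symmetric] Y_def[symmetric] th
        by (simp add: M_def power_add numeral_3_eq_3 mult_ac)
    qed
  qed
  then show ?thesis unfolding B_def[abs_def] .
qed

end

lemma deriv_unique_on_open:
  assumes "(f has_real_derivative D) (at x)" "(g has_real_derivative D') (at x)" "open S" "x \<in> S"
    "\<And>y. y \<in> S \<Longrightarrow> f y = g y"
  shows "D = D'"
  using DERIV_unique[OF has_field_derivative_transform_within_open[OF assms(1,3,4,5)] assms(2)] by simp

section \<open>The tension equation for the profile\<close>

text \<open>
The equation for \<open>\<theta>\<close>, rewritten for \<open>a = sin \<theta> / f\<close> and \<open>b = - cos \<theta>\<close> with \<open>f = \<surd>x (1 - x)\<close>. Here \<open>s\<close>, \<open>c\<close>
are sine and cosine of \<open>\<theta>\<close>, \<open>d\<close>, \<open>d2\<close> the derivatives of \<open>\<theta>\<close>, and \<open>p = f'/f\<close>. The conclusion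
has the form \<open>b L = a M\<close>, where \<open>(L N, M)\<close> is the ambient tension vector of the map \<open>(a N, b)\<close>; it says that
the two are parallel.
\<close>

lemma tension_algebra:
  fixes x :: real
  assumes x: "0 < x" "x < 1" and f: "f \<noteq> 0"
    and p: "p = 1 / (2 * x) - 1 / (1 - x)" "p' = - 1 / (2 * x\<^sup>2) - 1 / (1 - x)\<^sup>2"
    and s: "s = f * a" and c: "c * d = f * p * a + f * a1"
    and cc: "c * d2 - s * d\<^sup>2 = f * (p\<^sup>2 + p') * a + 2 * f * p * a1 + f * a2"
    and sc: "s\<^sup>2 + c\<^sup>2 = 1"
    and ode: "4 * x * (1 - x) * d2 + (4 - 4 * (K + 1) * x) * d = (1 + (4 * K - 1) * x) * (s * c) / (x * (1 - x))"
  shows "(- c) * (4 * x * (1 - x) * a2 + (8 - (4 * K + 16) * x) * a1 - (6 * K + 9) * a)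
    = a * (4 * x * (1 - x) * (c * d\<^sup>2 + s * d2) + (4 - 4 * (K + 1) * x) * (s * d))"
proof -
  define Y where "Y = 1 - x"
  define q r where "q = 1 / x" and "r = 1 / Y"
  have xq: "x * q = 1" and Yr: "Y * r = 1" and Y: "Y = 1 - x"
    using x by (auto simp: q_def r_def Y_def)
  have p1: "p = q / 2 - r" and p2: "p' = - q\<^sup>2 / 2 - r\<^sup>2"
    by (simp_all add: p q_def r_def Y_def power_divide)
  have i1: "8 - (4 * K + 16) * x - 8 * x * Y * p = 4 - 4 * (K + 1) * x"
    unfolding p1 using xq Yr Y by algebra
  have i2: "4 * x * Y * (p\<^sup>2 - p') - (8 - (4 * K + 16) * x) * p - (6 * K + 9) = - (1 + (4 * K - 1) * x) * (q * r)"
  proof -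
    have yq: "Y * q = q - 1" and xr: "x * r = r - 1" and qr: "q * r = q + r"
      using xq Yr Y by algebra+
    have e1: "x * Y * q\<^sup>2 = Y * q" and e2: "x * Y * r\<^sup>2 = x * r" and e3: "x * Y * (q * r) = 1"
      using xq Yr by algebra+
    have "4 * x * Y * (p\<^sup>2 - p') = 3 * (x * Y * q\<^sup>2) - 4 * (x * Y * (q * r)) + 8 * (x * Y * r\<^sup>2)"
      unfolding p1 p2 by (simp add: field_simps power2_eq_square)
    then have f1: "4 * x * Y * (p\<^sup>2 - p') = 3 * q + 8 * r - 15" unfolding e1 e2 e3 yq xr by simp
    have "(8 - (4 * K + 16) * x) * p = 4 * q - 8 * r - (2 * K + 8) * (x * q) + (4 * K + 16) * (x * r)"
      unfolding p1 by (simp add: field_simps)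
    then have f2: "(8 - (4 * K + 16) * x) * p = 4 * q - 8 * r - (2 * K + 8) + (4 * K + 16) * (r - 1)"
      unfolding xq xr by simp
    have "(1 + (4 * K - 1) * x) * (q * r) = q * r + (4 * K - 1) * (x * q) * r" by (simp add: algebra_simps)
    then have f3: "(1 + (4 * K - 1) * x) * (q * r) = q + r + (4 * K - 1) * r" unfolding xq qr by simp
    show ?thesis unfolding mult_minus_left f1 f2 f3 by (simp add: algebra_simps)
  qed
  have o: "4 * x * Y * d2 + (4 - 4 * (K + 1) * x) * d = (1 + (4 * K - 1) * x) * (s * c) * (q * r)"
    using ode by (simp add: q_def r_def Y_def)
  have fa1: "f * a1 = c * d - p * s" using c s by algebra
  have fa2: "f * a2 = c * d2 - s * d\<^sup>2 - (p\<^sup>2 + p') * s - 2 * p * (c * d - p * s)"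
    using cc fa1 s by algebra
  have "f * (4 * x * Y * a2 + (8 - (4 * K + 16) * x) * a1 - (6 * K + 9) * a)
    = 4 * x * Y * (f * a2) + (8 - (4 * K + 16) * x) * (f * a1) - (6 * K + 9) * s"
    unfolding s by (simp add: algebra_simps)
  also have "\<dots> = 4 * x * Y * (c * d2 - s * d\<^sup>2) + (8 - (4 * K + 16) * x - 8 * x * Y * p) * (c * d)
      + (4 * x * Y * (p\<^sup>2 - p') - (8 - (4 * K + 16) * x) * p - (6 * K + 9)) * s"
    unfolding fa1 fa2 by (simp add: algebra_simps power2_eq_square)
  also have "\<dots> = 4 * x * Y * (c * d2 - s * d\<^sup>2) + (4 - 4 * (K + 1) * x) * (c * d) - (1 + (4 * K - 1) * x) * (q * r) * s"
    unfolding i1 i2 by (simp add: algebra_simps)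
  finally have L: "f * (4 * x * Y * a2 + (8 - (4 * K + 16) * x) * a1 - (6 * K + 9) * a) = \<dots>" .
  have "f * ((- c) * (4 * x * Y * a2 + (8 - (4 * K + 16) * x) * a1 - (6 * K + 9) * a))
      = (- c) * (4 * x * Y * (c * d2 - s * d\<^sup>2) + (4 - 4 * (K + 1) * x) * (c * d) - (1 + (4 * K - 1) * x) * (q * r) * s)"
    unfolding L[symmetric] by simp
  also have "\<dots> = s * (4 * x * Y * (c * d\<^sup>2 + s * d2) + (4 - 4 * (K + 1) * x) * (s * d))
      - (s\<^sup>2 + c\<^sup>2) * (4 * x * Y * d2 + (4 - 4 * (K + 1) * x) * d) + (1 + (4 * K - 1) * x) * (s * c) * (q * r)"
    by (simp add: algebra_simps power2_eq_square)
  also have "\<dots> = s * (4 * x * Y * (c * d\<^sup>2 + s * d2) + (4 - 4 * (K + 1) * x) * (s * d))"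
    unfolding sc o by simp
  also have "\<dots> = f * (a * (4 * x * Y * (c * d\<^sup>2 + s * d2) + (4 - 4 * (K + 1) * x) * (s * d)))"
    by (subst (1) s) (rule mult.assoc)
  finally show ?thesis using f unfolding Y_def by (simp only: mult_cancel_left) simp
qed

context profile_ode begin

text \<open>
Near \<open>0\<close> both functions are smooth expressions in \<open>x\<close> and \<open>A = \<theta>/\<surd>x\<close>, near \<open>1\<close> in \<open>x\<close> and
\<open>B = (\<pi> - \<theta>)/(1 - x)\<close>. The differential identity is proved on the open interval and extends to the end
points by continuity.
\<close>

lemma profile_exists:
  obtains a b :: "real \<Rightarrow> real" where
    "\<And>n. Ck_real n a {0..1}" "\<And>n. Ck_real n b {0..1}"
    "\<And>x. x \<in> {0..1} \<Longrightarrow> x * (1 - x)\<^sup>2 * (a x)\<^sup>2 + (b x)\<^sup>2 = 1"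
    "b 0 = - 1" "b 1 = 1" "\<And>x. 0 < x \<Longrightarrow> x < 1 \<Longrightarrow> 0 < a x"
    "\<And>a1 a2 b1 b2 x. \<lbrakk>\<And>x. x \<in> {0..1} \<Longrightarrow> (a has_real_derivative a1 x) (at x within {0..1});
        \<And>x. x \<in> {0..1} \<Longrightarrow> (a1 has_real_derivative a2 x) (at x within {0..1});
        \<And>x. x \<in> {0..1} \<Longrightarrow> (b has_real_derivative b1 x) (at x within {0..1});
        \<And>x. x \<in> {0..1} \<Longrightarrow> (b1 has_real_derivative b2 x) (at x within {0..1});
        continuous_on {0..1} a2; continuous_on {0..1} b2; x \<in> {0..1}\<rbrakk> \<Longrightarrow>
      b x * (4 * x * (1 - x) * a2 x + (8 - (4 * real k + 16) * x) * a1 x - (6 * real k + 9) * a x)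
      = a x * (4 * x * (1 - x) * b2 x + (4 - 4 * (real k + 1) * x) * b1 x)"
proof -
  obtain \<theta> T :: "real \<Rightarrow> real" and L0 L1 where
    th: "\<And>x. 0 < x \<Longrightarrow> x < 1 \<Longrightarrow> 0 < \<theta> x \<and> \<theta> x < pi"
    and d\<theta>: "\<And>x. 0 < x \<Longrightarrow> x < 1 \<Longrightarrow> (\<theta> has_real_derivative T x / (x * (1 - x))) (at x)"
    and dT: "\<And>x. 0 < x \<Longrightarrow> x < 1 \<Longrightarrow> (T has_real_derivative ((real k - 1) * x * T x
        + (1 + (4 * real k - 1) * x) / 4 * (sin (\<theta> x) * cos (\<theta> x))) / (x * (1 - x))) (at x)"
    and lim0: "(\<theta> \<longlongrightarrow> 0) (at_right 0)" "(T \<longlongrightarrow> 0) (at_right 0)" "((\<lambda>x. \<theta> x / sqrt x) \<longlongrightarrow> L0) (at_right 0)"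
    and lim1: "((\<lambda>y. \<theta> (1 - y)) \<longlongrightarrow> pi) (at_right 0)" "((\<lambda>y. T (1 - y)) \<longlongrightarrow> 0) (at_right 0)"
      "((\<lambda>y. (pi - \<theta> (1 - y)) / y) \<longlongrightarrow> L1) (at_right 0)"
    using profile_angle by blast
  define A where "A x = (if x = 0 then L0 else \<theta> x / sqrt x)" for x
  define B where "B y = (if y = 0 then L1 else (pi - \<theta> (1 - y)) / y)" for y
  have AC: "Ck_real n A {0..<1}" for n unfolding A_def[abs_def] by (rule left_regular[OF d\<theta> dT lim0])
  have BC0: "Ck_real n B {0..<1}" for n unfolding B_def[abs_def] by (rule right_regular[OF d\<theta> dT lim1])
  have BC: "Ck_real n (\<lambda>x. B (1 - x)) {0<..1}" for n
    by (rule Ck_real_compose[OF BC0 Ck_real_diff[OF Ck_real_const Ck_real_ident]]) auto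
  define a where "a x = (if x = 0 then L0 else if x = 1 then L1 else sin (\<theta> x) / (sqrt x * (1 - x)))" for x
  define b where "b x = (if x = 0 then - 1 else if x = 1 then 1 else - cos (\<theta> x))" for x
  have a_left: "a x = A x * (1 + x * (A x)\<^sup>2 * sin_rem (x * (A x)\<^sup>2)) / (1 - x)" if "x \<in> {0..<1}" for x
  proof (cases "x = 0")
    case False
    define u where "u = sqrt x"
    have u: "u \<noteq> 0" "u * u = x" using that False by (auto simp: u_def)
    have t: "\<theta> x = u * A x" using False u by (simp add: A_def u_def)
    have e: "(u * A x)\<^sup>2 = x * (A x)\<^sup>2" using u(2) by (simp add: power_mult_distrib power2_eq_square)
    have "(u * A x) ^ 3 = u * A x * (u * A x)\<^sup>2" by (simp add: power2_eq_square power3_eq_cube)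
    then have e3: "(u * A x) ^ 3 = u * A x * (x * (A x)\<^sup>2)" unfolding e .
    have "sin (\<theta> x) = u * (A x * (1 + x * (A x)\<^sup>2 * sin_rem (x * (A x)\<^sup>2)))"
      unfolding t sin_eq_sin_rem[of "u * A x"] e e3 by (simp add: algebra_simps)
    then show ?thesis using that False u(1) by (simp add: a_def u_def[symmetric])
  qed (simp add: a_def A_def)
  have b_left: "b x = - (1 - x * (A x)\<^sup>2 / 2 * (1 + x * (A x)\<^sup>2 / 4 * sin_rem (x * (A x)\<^sup>2 / 4))\<^sup>2)" if "x \<in> {0..<1}" for x
  proof (cases "x = 0")
    case False
    have t: "(\<theta> x)\<^sup>2 = x * (A x)\<^sup>2" using that False by (simp add: A_def power_divide)
    have "b x = - cos (\<theta> x)" using that False by (simp add: b_def)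
    also have "\<dots> = - (1 - (\<theta> x)\<^sup>2 / 2 * (1 + (\<theta> x)\<^sup>2 / 4 * sin_rem ((\<theta> x)\<^sup>2 / 4))\<^sup>2)"
      by (simp only: cos_eq_sin_rem)
    finally show ?thesis unfolding t .
  qed (simp add: b_def)
  have a_right: "a x = B (1 - x) * (1 + ((1 - x) * B (1 - x))\<^sup>2 * sin_rem (((1 - x) * B (1 - x))\<^sup>2)) / sqrt x" if "x \<in> {0<..1}" for x
  proof (cases "x = 1")
    case False
    define w where "w = (1 - x) * B (1 - x)"
    have t: "pi - \<theta> x = w" using False by (simp add: B_def w_def)
    have "sin (\<theta> x) = sin w" by (simp flip: t)
    also have "\<dots> = w * (1 + w\<^sup>2 * sin_rem (w\<^sup>2))"
      unfolding sin_eq_sin_rem[of w] by (simp add: power2_eq_square power3_eq_cube algebra_simps)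
    finally have "sin (\<theta> x) = (1 - x) * (B (1 - x) * (1 + w\<^sup>2 * sin_rem (w\<^sup>2)))" by (simp add: w_def)
    then show ?thesis using that False by (simp add: a_def w_def[symmetric])
  qed (simp add: a_def B_def)
  have b_right: "b x = cos ((1 - x) * B (1 - x))" if "x \<in> {0<..1}" for x
  proof (cases "x = 1")
    case False
    have "pi - \<theta> x = (1 - x) * B (1 - x)" using False by (simp add: B_def)
    then have "cos ((1 - x) * B (1 - x)) = cos (pi - \<theta> x)" by simp
    then show ?thesis using that False by (simp add: b_def)
  qed (simp add: b_def)
  have aC: "Ck_real n a {0..1}" for n
  proof (rule Ck_real_glue)
    have "Ck_real n (\<lambda>x. A x * (1 + x * (A x)\<^sup>2 * sin_rem (x * (A x)\<^sup>2)) / (1 - x)) {0..<1}"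
      by (intro Ck_real_divide Ck_real_mult Ck_real_add Ck_real_diff Ck_real_power Ck_real_const Ck_real_ident
          Ck_real_compose[OF Ck_real_sin_rem[of n UNIV]] AC) auto
    then show "Ck_real n a {0..<1}" by (rule Ck_real_cong[rotated]) (simp add: a_left)
    have "Ck_real n (\<lambda>x. B (1 - x) * (1 + ((1 - x) * B (1 - x))\<^sup>2 * sin_rem (((1 - x) * B (1 - x))\<^sup>2)) / sqrt x) {0<..1}"
      by (intro Ck_real_divide Ck_real_mult Ck_real_add Ck_real_diff Ck_real_power Ck_real_const Ck_real_ident
          Ck_real_compose[OF Ck_real_sin_rem[of n UNIV]] Ck_real_subset[OF Ck_real_sqrt] BC) auto
    then show "Ck_real n a {0<..1}" by (rule Ck_real_cong[rotated]) (simp add: a_right)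
  qed
  have bC: "Ck_real n b {0..1}" for n
  proof (rule Ck_real_glue)
    have "Ck_real n (\<lambda>x. - (1 - x * (A x)\<^sup>2 / 2 * (1 + x * (A x)\<^sup>2 / 4 * sin_rem (x * (A x)\<^sup>2 / 4))\<^sup>2)) {0..<1}"
      by (intro Ck_real_minus Ck_real_divide Ck_real_mult Ck_real_add Ck_real_diff Ck_real_power Ck_real_const Ck_real_ident
          Ck_real_compose[OF Ck_real_sin_rem[of n UNIV]] AC) auto
    then show "Ck_real n b {0..<1}" by (rule Ck_real_cong[rotated]) (simp add: b_left)
    have "Ck_real n (\<lambda>x. cos ((1 - x) * B (1 - x))) {0<..1}"
      by (rule Ck_real_compose[where f = cos and T = UNIV])
        (auto intro!: Ck_real_mult Ck_real_diff Ck_real_const Ck_real_ident BC simp: Ck_real_sin_cos)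
    then show "Ck_real n b {0<..1}" by (rule Ck_real_cong[rotated]) (simp add: b_right)
  qed
  have ab: "a x = sin (\<theta> x) / (sqrt x * (1 - x))" "b x = - cos (\<theta> x)" if "0 < x" "x < 1" for x
    using that by (auto simp: a_def b_def)
  show ?thesis
  proof (rule that[OF aC bC])
    show "x * (1 - x)\<^sup>2 * (a x)\<^sup>2 + (b x)\<^sup>2 = 1" if "x \<in> {0..1}" for x
    proof (cases "x = 0 \<or> x = 1")
      case True
      then show ?thesis by (auto simp: b_def)
    next
      case False
      then have x: "0 < x" "x < 1" using that by auto
      then have "x * (1 - x)\<^sup>2 * (a x)\<^sup>2 = (sin (\<theta> x))\<^sup>2"
        by (simp add: ab power_divide power_mult_distrib)
      then show ?thesis using x by (simp add: ab)
    qed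
    show "b 0 = - 1" "b 1 = 1" by (simp_all add: b_def)
    show "0 < a x" if x: "0 < x" "x < 1" for x
      using th[OF x] x by (simp add: ab sin_gt_zero)
    fix a1 a2 b1 b2 :: "real \<Rightarrow> real" and x0 :: real
    assume da: "\<And>x. x \<in> {0..1} \<Longrightarrow> (a has_real_derivative a1 x) (at x within {0..1})"
      and da1: "\<And>x. x \<in> {0..1} \<Longrightarrow> (a1 has_real_derivative a2 x) (at x within {0..1})"
      and db: "\<And>x. x \<in> {0..1} \<Longrightarrow> (b has_real_derivative b1 x) (at x within {0..1})"
      and db1: "\<And>x. x \<in> {0..1} \<Longrightarrow> (b1 has_real_derivative b2 x) (at x within {0..1})"
      and c2: "continuous_on {0..1} a2" "continuous_on {0..1} b2" and x0: "x0 \<in> {0..1}"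
    define F where "F x = b x * (4 * x * (1 - x) * a2 x + (8 - (4 * real k + 16) * x) * a1 x - (6 * real k + 9) * a x)
      - a x * (4 * x * (1 - x) * b2 x + (4 - 4 * (real k + 1) * x) * b1 x)" for x
    have zero: "F x = 0" if x: "x \<in> {0<..<1}" for x
    proof -
      have at: "at y within {0..1} = at y" if "y \<in> {0<..<1}" for y :: real
        using that by (intro at_within_interior) auto
      have Da: "(a has_real_derivative a1 y) (at y)" "(a1 has_real_derivative a2 y) (at y)"
        "(b has_real_derivative b1 y) (at y)" "(b1 has_real_derivative b2 y) (at y)" if "y \<in> {0<..<1}" for y
        using da[of y] da1[of y] db[of y] db1[of y] at[OF that] that by auto
      define d where "d y = T y / (y * (1 - y))" for y
      define d2 where "d2 y = (((real k - 1) * y * T y + (1 + (4 * real k - 1) * y) / 4 * (sin (\<theta> y) * cos (\<theta> y))) / (y * (1 - y))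
          * (y * (1 - y)) - T y * (1 - 2 * y)) / ((y * (1 - y)) * (y * (1 - y)))" for y
      have Dt: "(\<theta> has_real_derivative d y) (at y)" if "y \<in> {0<..<1}" for y
        using d\<theta>[of y] that by (simp add: d_def)
      have Dd: "(d has_real_derivative d2 y) (at y)" if "y \<in> {0<..<1}" for y
        unfolding d_def[abs_def] d2_def
      proof (rule DERIV_divide[OF dT])
        show "((\<lambda>y. y * (1 - y)) has_real_derivative 1 - 2 * y) (at y)" by (auto intro!: derivative_eq_intros)
      qed (use that in auto)
      define f where "f y = sqrt y * (1 - y)" for y :: real
      define p where "p y = 1 / (2 * y) - 1 / (1 - y)" for y :: real
      define p' where "p' y = - 1 / (2 * y\<^sup>2) - 1 / (1 - y)\<^sup>2" for y :: real
      have Df: "(f has_real_derivative f y * p y) (at y)" if "y \<in> {0<..<1}" for y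
      proof -
        define u where "u = sqrt y"
        have u: "u \<noteq> 0" "u * u = y" using that by (auto simp: u_def)
        have "(f has_real_derivative inverse u / 2 * (1 - y) + (0 - 1) * u) (at y)"
          unfolding f_def[abs_def] u_def
          by (rule DERIV_mult[OF DERIV_real_sqrt DERIV_diff[OF DERIV_const DERIV_ident]]) (use that in auto)
        moreover have "inverse u / 2 * (1 - y) + (0 - 1) * u = f y * p y"
        proof -
          have n1: "1 / (2 * y) * u = inverse u / 2" unfolding u(2)[symmetric] using u(1) by (simp add: field_simps)
          have n2: "f y * p y = u * (1 - y) * (1 / (2 * y)) - u * (1 - y) * (1 / (1 - y))"
            unfolding f_def p_def u_def[symmetric] by (rule right_diff_distrib)
          have n3: "u * (1 - y) * (1 / (1 - y)) = u" using that by simp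
          have n4: "u * (1 - y) * (1 / (2 * y)) = 1 / (2 * y) * u * (1 - y)" by (simp only: mult_ac)
          show ?thesis unfolding n2 n3 n4 n1 by simp
        qed
        ultimately show ?thesis by simp
      qed
      have Dp: "(p has_real_derivative p' y) (at y)" if "y \<in> {0<..<1}" for y
      proof -
        have "((\<lambda>y. 1 / (2 * y) - 1 / (1 - y)) has_real_derivative
            (0 * (2 * y) - 1 * 2) / ((2 * y) * (2 * y)) - (0 * (1 - y) - 1 * (0 - 1)) / ((1 - y) * (1 - y))) (at y)"
          by (intro DERIV_diff DERIV_divide DERIV_const DERIV_ident DERIV_cmult_Id) (use that in auto)
        then show ?thesis unfolding p_def[abs_def] p'_def by (simp add: power2_eq_square)
      qed
      have S: "sin (\<theta> y) = f y * a y" if "y \<in> {0<..<1}" for y using that by (simp add: ab f_def)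
      have e1: "cos (\<theta> y) * d y = f y * p y * a y + f y * a1 y" if "y \<in> {0<..<1}" for y
      proof (rule deriv_unique_on_open[OF _ _ open_greaterThanLessThan that S])
        show "((\<lambda>y. sin (\<theta> y)) has_real_derivative cos (\<theta> y) * d y) (at y)"
          by (rule DERIV_chain2[OF DERIV_sin Dt[OF that]])
        show "((\<lambda>y. f y * a y) has_real_derivative f y * p y * a y + f y * a1 y) (at y)"
          using DERIV_mult[OF Df[OF that] Da(1)[OF that]] by (simp add: mult.commute)
      qed
      have e2: "cos (\<theta> x) * d2 x - sin (\<theta> x) * (d x)\<^sup>2 = f x * ((p x)\<^sup>2 + p' x) * a x + 2 * f x * p x * a1 x + f x * a2 x"
      proof (rule deriv_unique_on_open[OF _ _ open_greaterThanLessThan x e1])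
        show "((\<lambda>y. cos (\<theta> y) * d y) has_real_derivative cos (\<theta> x) * d2 x - sin (\<theta> x) * (d x)\<^sup>2) (at x)"
          by (rule DERIV_cong[OF DERIV_mult[OF DERIV_chain2[OF DERIV_cos Dt[OF x]] Dd[OF x]]])
            (simp add: power2_eq_square algebra_simps)
        show "((\<lambda>y. f y * p y * a y + f y * a1 y) has_real_derivative
            f x * ((p x)\<^sup>2 + p' x) * a x + 2 * f x * p x * a1 x + f x * a2 x) (at x)"
          by (rule DERIV_cong[OF DERIV_add[OF DERIV_mult[OF DERIV_mult[OF Df[OF x] Dp[OF x]] Da(1)[OF x]]
              DERIV_mult[OF Df[OF x] Da(2)[OF x]]]])
            (simp add: power2_eq_square algebra_simps)
      qed
      have f1: "b1 y = sin (\<theta> y) * d y" if "y \<in> {0<..<1}" for y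
      proof (rule deriv_unique_on_open[OF Da(3)[OF that] _ open_greaterThanLessThan that])
        show "((\<lambda>y. - cos (\<theta> y)) has_real_derivative sin (\<theta> y) * d y) (at y)"
          using DERIV_minus[OF DERIV_chain2[OF DERIV_cos Dt[OF that]]] by simp
      qed (simp add: ab)
      have f2: "b2 x = cos (\<theta> x) * (d x)\<^sup>2 + sin (\<theta> x) * d2 x"
      proof (rule deriv_unique_on_open[OF Da(4)[OF x] _ open_greaterThanLessThan x f1])
        show "((\<lambda>y. sin (\<theta> y) * d y) has_real_derivative cos (\<theta> x) * (d x)\<^sup>2 + sin (\<theta> x) * d2 x) (at x)"
          by (rule DERIV_cong[OF DERIV_mult[OF DERIV_chain2[OF DERIV_sin Dt[OF x]] Dd[OF x]]])
            (simp add: power2_eq_square algebra_simps)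
      qed
      have ode: "4 * x * (1 - x) * d2 x + (4 - 4 * (real k + 1) * x) * d x
          = (1 + (4 * real k - 1) * x) * (sin (\<theta> x) * cos (\<theta> x)) / (x * (1 - x))"
      proof -
        define Y where "Y = 1 - x"
        have n: "x \<noteq> 0" "Y \<noteq> 0" using x by (auto simp: Y_def)
        have "4 * x * Y * ((((real k - 1) * x * T x + h / 4) / (x * Y) * (x * Y) - T x * (1 - 2 * x)) / ((x * Y) * (x * Y)))
            = (4 * ((real k - 1) * x * T x - T x * (1 - 2 * x)) + h) / (x * Y)" for h
          using n by (simp add: field_simps)
        from this[of "(1 + (4 * real k - 1) * x) * (sin (\<theta> x) * cos (\<theta> x))"]
        have e: "4 * x * Y * d2 x = (4 * ((real k - 1) * x * T x - T x * (1 - 2 * x)) + (1 + (4 * real k - 1) * x) * (sin (\<theta> x) * cos (\<theta> x))) / (x * Y)"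
          unfolding d2_def Y_def[symmetric] by simp
        have dx: "(4 - 4 * (real k + 1) * x) * d x = (4 - 4 * (real k + 1) * x) * T x / (x * Y)"
          by (simp add: d_def Y_def)
        show ?thesis unfolding Y_def[symmetric] e dx add_divide_distrib[symmetric]
          by (rule arg_cong[of _ _ "\<lambda>z. z / (x * Y)"]) (simp add: algebra_simps)
      qed
      have fne: "f x \<noteq> 0" using x by (simp add: f_def)
      have "(- cos (\<theta> x)) * (4 * x * (1 - x) * a2 x + (8 - (4 * real k + 16) * x) * a1 x - (6 * real k + 9) * a x)
        = a x * (4 * x * (1 - x) * (cos (\<theta> x) * (d x)\<^sup>2 + sin (\<theta> x) * d2 x) + (4 - 4 * (real k + 1) * x) * (sin (\<theta> x) * d x))"
        by (rule tension_algebra[OF _ _ fne p_def p'_def S[OF x] e1[OF x] e2 sin_cos_squared_add ode]) (use x in auto)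
      then show ?thesis using x unfolding F_def by (simp add: ab f1[OF x] f2)
    qed
    have "continuous_on {0..1} a1" "continuous_on {0..1} b1" "continuous_on {0..1} a" "continuous_on {0..1} b"
      using da da1 db db1 by (meson DERIV_continuous_on)+
    then have "continuous_on {0..1} F" unfolding F_def by (intro continuous_intros c2)
    then have "continuous_on (closure {0<..<1}) F" by simp
    then have "F x0 = 0" by (rule continuous_constant_on_closure) (use zero x0 in auto)
    then show "b x0 * (4 * x0 * (1 - x0) * a2 x0 + (8 - (4 * real k + 16) * x0) * a1 x0 - (6 * real k + 9) * a x0)
      = a x0 * (4 * x0 * (1 - x0) * b2 x0 + (4 - 4 * (real k + 1) * x0) * b1 x0)" by (simp add: F_def)
  qed
qed

end

section \<open>Functions of class C^k on open sets\<close>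

lemma Ck_on_cong:
  "\<lbrakk>open U; \<And>x. x \<in> U \<Longrightarrow> f x = g x; Ck_on k f U\<rbrakk> \<Longrightarrow> Ck_on k g U"
proof (induction k arbitrary: f g)
  case 0
  then show ?case using continuous_on_cong[of U U f g] by simp
next
  case (Suc k)
  have d: "g differentiable at x" and e: "frechet_derivative f (at x) = frechet_derivative g (at x)" if x: "x \<in> U" for x
  proof -
    have fd: "f differentiable at x" using Suc.prems(3) x by simp
    then show "frechet_derivative f (at x) = frechet_derivative g (at x)"
      by (rule frechet_derivative_transform_within_open[OF _ Suc.prems(1) x Suc.prems(2)])
    from fd obtain D where "(f has_derivative D) (at x)" by (auto simp: differentiable_def)
    then have "(g has_derivative D) (at x)"
      by (rule has_derivative_transform_within_open[OF _ Suc.prems(1) x Suc.prems(2)])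
    then show "g differentiable at x" by (auto simp: differentiable_def)
  qed
  have "Ck_on k (\<lambda>x. frechet_derivative g (at x) v) U" for v
    by (rule Suc.IH[OF Suc.prems(1), of "\<lambda>x. frechet_derivative f (at x) v"])
      (use e Suc.prems(3) in simp_all)
  then show ?case using d by simp
qed

text \<open>
Any family of derivatives may stand in for the Frechet derivative chosen in the definition.
\<close>

lemma Ck_on_SucI:
  assumes "open U" "\<And>x. x \<in> U \<Longrightarrow> (f has_derivative D x) (at x)" "\<And>v. Ck_on k (\<lambda>x. D x v) U"
  shows "Ck_on (Suc k) f U"
proof -
  have "Ck_on k (\<lambda>x. frechet_derivative f (at x) v) U" for v
    by (rule Ck_on_cong[OF assms(1) _ assms(3)[of v]]) (simp add: frechet_derivative_at[OF assms(2)])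
  moreover have "f differentiable at x" if "x \<in> U" for x
    using assms(2)[OF that] by (auto simp: differentiable_def)
  ultimately show ?thesis by simp
qed

lemma Ck_on_SucD:
  assumes "Ck_on (Suc k) f U" "x \<in> U"
  shows "(f has_derivative frechet_derivative f (at x)) (at x)"
  using assms by (simp add: frechet_derivative_works[symmetric])

lemma Ck_on_lower: "Ck_on (Suc k) f U \<Longrightarrow> Ck_on k f U"
proof (induction k arbitrary: f)
  case 0
  then show ?case
    by (auto intro!: continuous_at_imp_continuous_on differentiable_imp_continuous_within)
next
  case (Suc k)
  then show ?case by (metis Ck_on.simps(2))
qed

lemma Ck_on_const: "open U \<Longrightarrow> Ck_on k (\<lambda>x. c) U"
proof (induction k arbitrary: c)
  case (Suc k)
  show ?case by (rule Ck_on_SucI[OF Suc.prems, of _ "\<lambda>x v. 0"]) (use Suc in auto)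
qed simp

lemma Ck_on_linear:
  assumes "open U" "bounded_linear L"
  shows "Ck_on k L U"
proof (cases k)
  case 0
  then show ?thesis using bounded_linear.continuous_on[OF assms(2) continuous_on_id] by simp
next
  case (Suc m)
  show ?thesis unfolding Suc
    by (rule Ck_on_SucI[OF assms(1), of _ "\<lambda>x v. L v"])
      (auto intro: bounded_linear_imp_has_derivative assms Ck_on_const)
qed

lemma Ck_on_compose_linear:
  assumes "open U" "bounded_linear L"
  shows "Ck_on k f U \<Longrightarrow> Ck_on k (\<lambda>x. L (f x)) U"
proof (induction k arbitrary: f)
  case 0
  then show ?case using bounded_linear.continuous_on[OF assms(2)] by simp
next
  case (Suc k)
  show ?case
  proof (rule Ck_on_SucI[OF assms(1)])
    show "((\<lambda>x. L (f x)) has_derivative (\<lambda>v. L (frechet_derivative f (at x) v))) (at x)" if "x \<in> U" for x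
      by (rule bounded_linear.has_derivative[OF assms(2) Ck_on_SucD[OF Suc.prems that]])
    show "Ck_on k (\<lambda>x. L (frechet_derivative f (at x) v)) U" for v
      by (rule Suc.IH) (use Suc.prems in simp)
  qed
qed

lemma Ck_on_add:
  assumes "open U"
  shows "Ck_on k f U \<Longrightarrow> Ck_on k g U \<Longrightarrow> Ck_on k (\<lambda>x. f x + g x) U"
proof (induction k arbitrary: f g)
  case 0
  then show ?case by (auto intro: continuous_on_add)
next
  case (Suc k)
  show ?case
  proof (rule Ck_on_SucI[OF assms])
    show "((\<lambda>x. f x + g x) has_derivative (\<lambda>v. frechet_derivative f (at x) v + frechet_derivative g (at x) v)) (at x)"
      if "x \<in> U" for x
      by (rule has_derivative_add[OF Ck_on_SucD[OF Suc.prems(1) that] Ck_on_SucD[OF Suc.prems(2) that]])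
    show "Ck_on k (\<lambda>x. frechet_derivative f (at x) v + frechet_derivative g (at x) v) U" for v
      by (rule Suc.IH) (use Suc.prems in simp_all)
  qed
qed

lemma Ck_on_bilinear:
  assumes "open U" "bounded_bilinear h"
  shows "Ck_on k f U \<Longrightarrow> Ck_on k g U \<Longrightarrow> Ck_on k (\<lambda>x. h (f x) (g x)) U"
proof (induction k arbitrary: f g)
  case 0
  then show ?case using bounded_bilinear.continuous_on[OF assms(2)] by simp
next
  case (Suc k)
  show ?case
  proof (rule Ck_on_SucI[OF assms(1)])
    show "((\<lambda>x. h (f x) (g x)) has_derivative
        (\<lambda>v. h (f x) (frechet_derivative g (at x) v) + h (frechet_derivative f (at x) v) (g x))) (at x)"
      if "x \<in> U" for x
      by (rule bounded_bilinear.FDERIV[OF assms(2) Ck_on_SucD[OF Suc.prems(1) that] Ck_on_SucD[OF Suc.prems(2) that]])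
    show "Ck_on k (\<lambda>x. h (f x) (frechet_derivative g (at x) v) + h (frechet_derivative f (at x) v) (g x)) U" for v
      by (intro Ck_on_add[OF assms(1)] Suc.IH Ck_on_lower[OF Suc.prems(1)] Ck_on_lower[OF Suc.prems(2)])
        (use Suc.prems in simp_all)
  qed
qed

lemma Ck_on_Pair:
  assumes "open U" "Ck_on k f U" "Ck_on k g U"
  shows "Ck_on k (\<lambda>x. (f x, g x)) U"
proof -
  have "Ck_on k (\<lambda>x. (f x, 0) + (0, g x)) U"
    by (intro Ck_on_add assms Ck_on_compose_linear[OF assms(1) _ assms(2)] Ck_on_compose_linear[OF assms(1) _ assms(3)]
        bounded_linear_Pair bounded_linear_ident bounded_linear_zero)
  then show ?thesis by simp
qed

text \<open>
The chain rule needs the derivative of \<open>F\<close> within \<open>S\<close> only, because \<open>r\<close> takes its values in \<open>S\<close>; they may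
be boundary points.
\<close>

lemma Ck_on_compose_real:
  assumes "open U" "\<And>x. x \<in> U \<Longrightarrow> r x \<in> S"
  shows "Ck_real k F S \<Longrightarrow> Ck_on k r U \<Longrightarrow> Ck_on k (\<lambda>x. F (r x)) U"
proof (induction k arbitrary: F)
  case 0
  then show ?case using continuous_on_compose2[of S F U r] assms(2) by auto
next
  case (Suc k)
  obtain F' where F': "\<And>x. x \<in> S \<Longrightarrow> (F has_real_derivative F' x) (at x within S)" "Ck_real k F' S"
    using Suc.prems(1) by (rule Ck_realE) blast
  show ?case
  proof (rule Ck_on_SucI[OF assms(1)])
    fix x assume x: "x \<in> U"
    have "(F has_derivative (\<lambda>h. F' (r x) * h)) (at (r x) within r ` U)"
      by (rule has_derivative_subset[of _ _ _ S])
        (use F'(1)[OF assms(2)[OF x]] assms(2) in \<open>auto simp: has_field_derivative_def\<close>)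
    from has_derivative_in_compose[OF has_derivative_at_withinI[OF Ck_on_SucD[OF Suc.prems(2) x]] this]
    show "((\<lambda>x. F (r x)) has_derivative (\<lambda>v. F' (r x) * frechet_derivative r (at x) v)) (at x)"
      by (simp add: at_within_open[OF x assms(1)])
  next
    show "Ck_on k (\<lambda>x. F' (r x) * frechet_derivative r (at x) v) U" for v
      by (rule Ck_on_bilinear[OF assms(1) bounded_bilinear_mult Suc.IH[OF F'(2) Ck_on_lower[OF Suc.prems(2)]]])
        (use Suc.prems(2) in simp)
  qed
qed

section \<open>Traces over tangent spaces of the sphere\<close>

text \<open>
Adding \<open>X\<close> to \<open>B\<close> gives an orthonormal basis of the whole space, and the trace of a bilinear form does not
depend on the orthonormal basis.
\<close>

lemma trace_tangent_space:
  fixes T :: "'v::euclidean_space \<Rightarrow> 'v \<Rightarrow> 'w::real_vector"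
  assumes T: "bilinear T" and X: "norm X = 1" and B: "orthonormal_basis_of (sphere_tangent_space X) B"
  shows "finite B" "(\<Sum>e\<in>B. T e e) = (\<Sum>i\<in>Basis. T i i) - T X X"
proof -
  have B': "\<And>e. e \<in> B \<Longrightarrow> e \<bullet> X = 0" "span B = {v. v \<bullet> X = 0}" "pairwise orthogonal B" "\<And>e. e \<in> B \<Longrightarrow> norm e = 1"
    using B by (auto simp: orthonormal_basis_of_def sphere_tangent_space_def)
  have XX: "X \<bullet> X = 1" using X by (simp add: dot_square_norm)
  define C where "C = insert X B"
  have XB: "X \<notin> B" using B'(1) XX by auto
  have orth: "pairwise orthogonal C"
    unfolding C_def using B'(1,3) by (auto simp: pairwise_insert orthogonal_def inner_commute)
  have nrm: "norm e = 1" if "e \<in> C" for e using that B'(4) X by (auto simp: C_def)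
  have "0 \<notin> B" using B'(4) by force
  then show fin: "finite B" using B'(3) pairwise_orthogonal_independent independent_imp_finite by blast
  then have finC: "finite C" by (simp add: C_def)
  have "v \<in> span C" for v
  proof -
    have "v - (v \<bullet> X) *\<^sub>R X \<in> span B" unfolding B'(2) using XX by (simp add: inner_diff_left)
    then have "v - (v \<bullet> X) *\<^sub>R X \<in> span C" using span_mono[of B C] by (auto simp: C_def)
    moreover have "X \<in> C" by (simp add: C_def)
    ultimately have "(v - (v \<bullet> X) *\<^sub>R X) + (v \<bullet> X) *\<^sub>R X \<in> span C"
      by (intro span_add span_scale) (auto intro: span_base)
    then show ?thesis by simp
  qed
  then have expand: "(\<Sum>e\<in>C. (v \<bullet> e) *\<^sub>R e) = v" for v
    using orthonormal_basis_expand[OF orth nrm _ finC] by blast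
  have bt: "T (\<Sum>e\<in>C. p e *\<^sub>R e) (\<Sum>e\<in>C. q e *\<^sub>R e) = (\<Sum>e\<in>C. \<Sum>e'\<in>C. (p e * q e') *\<^sub>R T e e')" for p q
    unfolding bilinear_sum[OF T] sum.cartesian_product
    by (simp add: bilinear_lmul[OF T] bilinear_rmul[OF T] case_prod_unfold mult.commute)
  have ip: "(e \<bullet> e') *\<^sub>R t = (\<Sum>i\<in>Basis. ((i \<bullet> e) * (i \<bullet> e')) *\<^sub>R t)" for e e' :: 'v and t :: 'w
    unfolding scaleR_sum_left[symmetric] by (subst euclidean_inner) (simp only: inner_commute)
  have "(\<Sum>i\<in>Basis. T i i) = (\<Sum>i\<in>Basis. \<Sum>e\<in>C. \<Sum>e'\<in>C. ((i \<bullet> e) * (i \<bullet> e')) *\<^sub>R T e e')"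
    using bt[of "\<lambda>e. i \<bullet> e" "\<lambda>e. i \<bullet> e" for i] unfolding expand by simp
  also have "\<dots> = (\<Sum>e\<in>C. \<Sum>e'\<in>C. \<Sum>i\<in>Basis. ((i \<bullet> e) * (i \<bullet> e')) *\<^sub>R T e e')"
    by (subst sum.swap, rule sum.cong[OF refl], subst sum.swap, rule refl)
  also have "\<dots> = (\<Sum>e\<in>C. \<Sum>e'\<in>C. (e \<bullet> e') *\<^sub>R T e e')"
    by (intro sum.cong refl ip[symmetric])
  also have "\<dots> = (\<Sum>e\<in>C. T e e)"
  proof (rule sum.cong[OF refl])
    fix e assume e: "e \<in> C"
    have "(e \<bullet> e') *\<^sub>R T e e' = (if e = e' then T e e' else 0)" if "e' \<in> C" for e'
      using orth nrm[OF e] e that by (auto simp: pairwise_def orthogonal_def dot_square_norm)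
    then have "(\<Sum>e'\<in>C. (e \<bullet> e') *\<^sub>R T e e') = (\<Sum>e'\<in>C. if e = e' then T e e' else 0)" by (rule sum.cong[OF refl])
    then show "(\<Sum>e'\<in>C. (e \<bullet> e') *\<^sub>R T e e') = T e e" using finC e by (simp add: sum.delta)
  qed
  also have "\<dots> = T X X + (\<Sum>e\<in>B. T e e)" unfolding C_def using fin XB by simp
  finally show "(\<Sum>e\<in>B. T e e) = (\<Sum>i\<in>Basis. T i i) - T X X" by (simp add: algebra_simps)
qed

lemma sum_Basis_prod:
  fixes F :: "'a::euclidean_space \<times> 'b::euclidean_space \<Rightarrow> 'c::comm_monoid_add"
  shows "sum F Basis = (\<Sum>i\<in>Basis. F (i, 0)) + (\<Sum>j\<in>Basis. F (0, j))"
proof -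
  have "inj_on (\<lambda>u. (u::'a, 0::'b)) Basis" "inj_on (\<lambda>u. (0::'a, u::'b)) Basis"
    by (auto intro!: inj_onI)
  then show ?thesis unfolding Basis_prod_def
    by (subst sum.union_disjoint) (auto simp: Basis_prod_def sum.reindex)
qed

section \<open>The join of two orthogonal multiplications\<close>

locale hopf_join =
  fixes f :: "'b::euclidean_space \<Rightarrow> 'b \<Rightarrow> 'c::euclidean_space"
    and g :: "'a::euclidean_space \<Rightarrow> 'c \<times> real \<Rightarrow> 'd::euclidean_space"
  assumes of: "orthogonal_multiplication f" and og: "orthogonal_multiplication g"
begin

text \<open>
The polarisation of the Hopf map, normalised by \<open>P y y = 2 H(y)\<close>.
\<close>

definition P :: "'b \<times> 'b \<Rightarrow> 'b \<times> 'b \<Rightarrow> 'c \<times> real" where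
  "P y e = (2 *\<^sub>R (f (fst y) (snd e) + f (fst e) (snd y)), 2 * (fst y \<bullet> fst e - snd y \<bullet> snd e))"

definition N :: "'a \<times> 'b \<times> 'b \<Rightarrow> 'd" where
  "N X = g (fst X) (hopf_of_mult f (snd X))"

lemma bf: "bilinear f" and bg: "bilinear g" and nf: "norm (f u v) = norm u * norm v"
  and ng: "norm (g x z) = norm x * norm z"
  using of og unfolding orthogonal_multiplication_def by blast+

lemmas f_simps = bilinear_ladd[OF bf] bilinear_radd[OF bf] bilinear_lmul[OF bf] bilinear_rmul[OF bf]
  bilinear_lzero[OF bf] bilinear_rzero[OF bf]
lemmas g_simps = bilinear_ladd[OF bg] bilinear_radd[OF bg] bilinear_lmul[OF bg] bilinear_rmul[OF bg]
  bilinear_lzero[OF bg] bilinear_rzero[OF bg]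

lemma hopf_eq: "hopf_of_mult f y = (2 *\<^sub>R f (fst y) (snd y), fst y \<bullet> fst y - snd y \<bullet> snd y)"
  by (simp add: hopf_of_mult_def case_prod_unfold power2_norm_eq_inner)

lemma bP: "bilinear P"
  unfolding bilinear_def P_def
  by (auto intro!: linearI simp: f_simps inner_add_left inner_add_right algebra_simps)

lemmas P_simps = bilinear_ladd[OF bP] bilinear_radd[OF bP] bilinear_lmul[OF bP] bilinear_rmul[OF bP]
  bilinear_lzero[OF bP] bilinear_rzero[OF bP]

lemma P_self: "P y y = 2 *\<^sub>R hopf_of_mult f y"
  by (simp add: P_def hopf_eq flip: scaleR_2)

lemma hopf_expand:
  "hopf_of_mult f (c *\<^sub>R y + s *\<^sub>R e) = c\<^sup>2 *\<^sub>R hopf_of_mult f y + (c * s) *\<^sub>R P y e + s\<^sup>2 *\<^sub>R hopf_of_mult f e"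
  by (simp add: hopf_eq P_def f_simps inner_add_left inner_add_right inner_commute algebra_simps power2_eq_square)

lemma norm_hopf: "norm (hopf_of_mult f y) = (norm y)\<^sup>2"
proof -
  have "(norm (hopf_of_mult f y))\<^sup>2 = (2 * (norm (fst y) * norm (snd y)))\<^sup>2 + ((norm (fst y))\<^sup>2 - (norm (snd y))\<^sup>2)\<^sup>2"
    by (simp add: hopf_of_mult_def case_prod_unfold norm_Pair nf power_mult_distrib)
  also have "\<dots> = ((norm (fst y))\<^sup>2 + (norm (snd y))\<^sup>2)\<^sup>2" by (simp add: power2_eq_square algebra_simps)
  also have "\<dots> = ((norm y)\<^sup>2)\<^sup>2" by (simp add: norm_prod_def)
  finally show ?thesis by (rule power2_eq_imp_eq) auto
qed

lemma norm_N: "norm (N X) = norm (fst X) * (norm (snd X))\<^sup>2"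
  by (simp add: N_def ng norm_hopf)

text \<open>
The Hopf map is harmonic: the traces of \<open>|y\<^sub>1|\<^sup>2\<close> and \<open>|y\<^sub>2|\<^sup>2\<close> cancel, and \<open>f(y\<^sub>1, y\<^sub>2)\<close> is bilinear in
separate variables.
\<close>

lemma trace_P: "(\<Sum>j\<in>Basis. P j j) = 0"
  unfolding sum_Basis_prod P_def by (simp add: f_simps zero_prod_def[symmetric] sum_Basis_prod sum_prod)

lemma sum_g_right: "(\<Sum>j\<in>S. g x (h j)) = g x (\<Sum>j\<in>S. h j)"
  using linear_sum[of "g x" h S] bg by (simp add: bilinear_def)

lemma sum_g_left: "(\<Sum>i\<in>Basis. (x \<bullet> i) *\<^sub>R g i z) = g x z"
proof -
  have "linear (\<lambda>x. g x z)" using bg unfolding bilinear_def by blast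
  from linear_sum[OF this, of "\<lambda>i. (x \<bullet> i) *\<^sub>R i" Basis] show ?thesis
    by (simp only: euclidean_representation g_simps)
qed

lemma Ck_on_N:
  assumes "open U" shows "Ck_on n N U"
proof -
  have bbf: "bounded_bilinear f" and bbg: "bounded_bilinear g"
    using bf bg bilinear_conv_bounded_bilinear by blast+
  have 1: "Ck_on n (\<lambda>X. L X) U" if "bounded_linear L" for L :: "'a \<times> 'b \<times> 'b \<Rightarrow> 'b"
    by (rule Ck_on_linear[OF assms that])
  have l: "bounded_linear (\<lambda>X :: 'a \<times> 'b \<times> 'b. fst (snd X))" "bounded_linear (\<lambda>X :: 'a \<times> 'b \<times> 'b. snd (snd X))"
    "bounded_linear (\<lambda>X :: 'a \<times> 'b \<times> 'b. fst X)"
    by (auto intro: bounded_linear_compose[OF bounded_linear_fst] bounded_linear_compose[OF bounded_linear_snd]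
        bounded_linear_fst bounded_linear_snd)
  have "Ck_on n (\<lambda>X. 2 *\<^sub>R f (fst (snd X)) (snd (snd X))) U"
    by (rule Ck_on_compose_linear[OF assms bounded_linear_scaleR_right])
      (intro Ck_on_bilinear[OF assms bbf] 1 l)
  moreover have "Ck_on n (\<lambda>X. fst (snd X) \<bullet> fst (snd X) + - (snd (snd X) \<bullet> snd (snd X))) U"
    by (intro Ck_on_add[OF assms] Ck_on_compose_linear[OF assms bounded_linear_minus[OF bounded_linear_ident]]
        Ck_on_bilinear[OF assms bounded_bilinear_inner] 1 l)
  ultimately have "Ck_on n (\<lambda>X. hopf_of_mult f (snd X)) U"
    unfolding hopf_eq by (intro Ck_on_Pair[OF assms]) simp_all
  then show ?thesis unfolding N_def[abs_def]
    by (intro Ck_on_bilinear[OF assms bbg] Ck_on_linear[OF assms l(3)])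
qed

text \<open>
Homogeneity of degree \<open>0\<close> keeps the values in the unit interval on all of the complement of the origin, so
that profiles need to be smooth on the closed unit interval only.
\<close>

definition lat :: "'a \<times> 'b \<times> 'b \<Rightarrow> real" where
  "lat X = (fst X \<bullet> fst X) * inverse (X \<bullet> X)"

lemma lat_range: "lat X \<in> {0..1}"
proof (cases "X = 0")
  case False
  have "fst X \<bullet> fst X \<le> X \<bullet> X" by (cases X) simp
  then show ?thesis using False by (simp add: lat_def divide_simps flip: divide_inverse)
qed (simp add: lat_def)

lemma lat_sphere: "norm X = 1 \<Longrightarrow> lat X = fst X \<bullet> fst X"
  by (simp add: lat_def dot_square_norm)

lemma Ck_on_lat: "Ck_on n lat (- {0})"
proof -
  have o: "open (- {0 :: 'a \<times> 'b \<times> 'b})" by auto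
  have "Ck_on n (\<lambda>X :: 'a \<times> 'b \<times> 'b. X \<bullet> X) (- {0})"
    by (intro Ck_on_bilinear[OF o bounded_bilinear_inner] Ck_on_linear[OF o bounded_linear_ident])
  then have "Ck_on n (\<lambda>X :: 'a \<times> 'b \<times> 'b. inverse (X \<bullet> X)) (- {0})"
    by (intro Ck_on_compose_real[OF o _ Ck_real_inverse_on]) auto
  then show ?thesis unfolding lat_def[abs_def]
    by (intro Ck_on_bilinear[OF o bounded_bilinear_mult] Ck_on_bilinear[OF o bounded_bilinear_inner]
        Ck_on_linear[OF o bounded_linear_fst])
qed

text \<open>
On the unit sphere this is \<open>(sin \<alpha> h, - cos \<alpha>)\<close> if \<open>a = sin \<alpha> / (\<surd>\<rho> (1 - \<rho>))\<close> and \<open>b = - cos \<alpha>\<close> as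
functions of \<open>\<rho> = sin\<^sup>2 t\<close>.
\<close>

definition join_map :: "(real \<Rightarrow> real) \<Rightarrow> (real \<Rightarrow> real) \<Rightarrow> 'a \<times> 'b \<times> 'b \<Rightarrow> 'd \<times> real" where
  "join_map a b X = (a (lat X) *\<^sub>R N X, b (lat X))"

lemma join_map_smooth:
  assumes "\<And>n. Ck_real n a {0..1}" "\<And>n. Ck_real n b {0..1}"
  shows "smooth_map_on (sphere 0 1) (join_map a b)"
proof -
  have o: "open (- {0 :: 'a \<times> 'b \<times> 'b})" by auto
  have c: "Ck_on n (\<lambda>X. F (lat X)) (- {0})" if "Ck_real n F {0..1}" for n F
    by (rule Ck_on_compose_real[OF o lat_range that Ck_on_lat])
  have "Ck_on n (join_map a b) (- {0})" for n
    unfolding join_map_def[abs_def]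
    by (intro Ck_on_Pair[OF o] Ck_on_bilinear[OF o bounded_bilinear_scaleR] c assms Ck_on_N[OF o])
  then show ?thesis unfolding smooth_map_on_def
    by (intro exI[of _ "- {0}"] exI[of _ "join_map a b"]) auto
qed

lemma norm_join_map:
  assumes "norm X = 1" "lat X * (1 - lat X)\<^sup>2 * (a (lat X))\<^sup>2 + (b (lat X))\<^sup>2 = 1"
  shows "(norm (N X))\<^sup>2 = lat X * (1 - lat X)\<^sup>2" "norm (join_map a b X) = 1"
proof -
  have "(norm (fst X))\<^sup>2 = lat X" by (simp add: lat_sphere[OF assms(1)] power2_norm_eq_inner)
  moreover have "(norm (fst X))\<^sup>2 + (norm (snd X))\<^sup>2 = 1" using assms(1) by (simp add: norm_prod_def)
  ultimately have "(norm (snd X))\<^sup>2 = 1 - lat X" by simp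
  with \<open>(norm (fst X))\<^sup>2 = lat X\<close> show N: "(norm (N X))\<^sup>2 = lat X * (1 - lat X)\<^sup>2"
    by (simp add: norm_N power_mult_distrib)
  have "(norm (join_map a b X))\<^sup>2 = (a (lat X))\<^sup>2 * (norm (N X))\<^sup>2 + (b (lat X))\<^sup>2"
    by (simp add: join_map_def norm_Pair power_mult_distrib)
  also have "\<dots> = 1" unfolding N using assms(2) by (simp add: mult_ac)
  finally have "(norm (join_map a b X))\<^sup>2 = 1\<^sup>2" by simp
  then show "norm (join_map a b X) = 1" by (rule power2_eq_imp_eq) auto
qed

lemma N_great_circle:
  "N (c *\<^sub>R X + s *\<^sub>R e) = c ^ 3 *\<^sub>R N X + (c\<^sup>2 * s) *\<^sub>R (g (fst e) (hopf_of_mult f (snd X)) + g (fst X) (P (snd X) (snd e)))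
    + (c * s\<^sup>2) *\<^sub>R (g (fst e) (P (snd X) (snd e)) + g (fst X) (hopf_of_mult f (snd e))) + s ^ 3 *\<^sub>R N e"
  by (simp add: N_def hopf_expand g_simps scaleR_add_right power2_eq_square power3_eq_cube mult_ac)

text \<open>
Along the great circle \<open>cos t X + sin t e\<close> both \<open>\<rho>\<close> and \<open>N\<close> are explicit trigonometric polynomials. \<open>N1\<close>
and \<open>N2\<close> are the parts of \<open>N\<close> that are linear and quadratic in \<open>e\<close>; the second derivative of
\<open>cos\<^sup>3 t N(X)\<close> contributes \<open>- 3 N(X)\<close>.
\<close>

lemma second_fundamental_form_join_map:
  fixes X e :: "'a \<times> 'b \<times> 'b"
  assumes X: "norm X = 1" and e: "norm e = 1" "e \<bullet> X = 0"
    and da: "\<And>x. x \<in> {0..1} \<Longrightarrow> (a has_real_derivative a1 x) (at x within {0..1})"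
      "\<And>x. x \<in> {0..1} \<Longrightarrow> (a1 has_real_derivative a2 x) (at x within {0..1})"
      "\<And>x. x \<in> {0..1} \<Longrightarrow> (b has_real_derivative b1 x) (at x within {0..1})"
      "\<And>x. x \<in> {0..1} \<Longrightarrow> (b1 has_real_derivative b2 x) (at x within {0..1})"
  defines "\<rho> \<equiv> fst X \<bullet> fst X" and "\<sigma> \<equiv> fst X \<bullet> fst e" and "\<tau> \<equiv> fst e \<bullet> fst e"
  defines "N1 \<equiv> g (fst e) (hopf_of_mult f (snd X)) + g (fst X) (P (snd X) (snd e))"
    and "N2 \<equiv> g (fst e) (P (snd X) (snd e)) + g (fst X) (hopf_of_mult f (snd e))"
  defines "W \<equiv> ((a2 \<rho> * (2 * \<sigma>)\<^sup>2 + a1 \<rho> * (2 * \<tau> - 2 * \<rho>)) *\<^sub>R N X + (4 * a1 \<rho> * \<sigma>) *\<^sub>R N1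
      + a \<rho> *\<^sub>R (2 *\<^sub>R N2 - 3 *\<^sub>R N X), b2 \<rho> * (2 * \<sigma>)\<^sup>2 + b1 \<rho> * (2 * \<tau> - 2 * \<rho>))"
  shows "second_fundamental_form (join_map a b) X e = W - (W \<bullet> join_map a b X) *\<^sub>R join_map a b X"
proof -
  define c where "c t = cos t *\<^sub>R X + sin t *\<^sub>R e" for t
  have cc: "c t \<bullet> c t = 1" for t
  proof -
    have "X \<bullet> X = 1" "e \<bullet> e = 1" "X \<bullet> e = 0" using X e by (auto simp: dot_square_norm inner_commute)
    then show ?thesis using e(2) by (simp add: c_def inner_add_left inner_add_right sin_cos_squared_add3)
  qed
  have c0: "c 0 = X" by (simp add: c_def)
  have nc: "norm (c t) = 1" for t using cc[of t] by (simp add: norm_eq_sqrt_inner)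
  define r where "r t = (cos t)\<^sup>2 * \<rho> + 2 * (sin t * cos t) * \<sigma> + (sin t)\<^sup>2 * \<tau>" for t
  have rc: "lat (c t) = r t" for t
  proof -
    have "lat (c t) = fst (c t) \<bullet> fst (c t)" by (rule lat_sphere[OF nc])
    also have "\<dots> = r t" unfolding c_def r_def \<rho>_def \<sigma>_def \<tau>_def
      by (simp add: inner_add_left inner_add_right inner_commute power2_eq_square algebra_simps)
    finally show ?thesis .
  qed
  have r01: "r t \<in> {0..1}" for t using lat_range[of "c t"] by (simp add: rc)
  define r' where "r' t = - 2 * (cos t * sin t) * \<rho> + 2 * ((cos t)\<^sup>2 - (sin t)\<^sup>2) * \<sigma> + 2 * (sin t * cos t) * \<tau>" for t
  have dr: "(r has_real_derivative r' t) (at t)" for t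
    unfolding r_def[abs_def] r'_def
    by (auto intro!: derivative_eq_intros simp: power2_eq_square algebra_simps)
  have dr': "(r' has_real_derivative 2 * \<tau> - 2 * \<rho>) (at 0)"
    unfolding r'_def[abs_def] by (auto intro!: derivative_eq_intros)
  have r0: "r 0 = \<rho>" "r' 0 = 2 * \<sigma>" by (simp_all add: r_def r'_def)
  have ch: "((\<lambda>t. F (r t)) has_real_derivative F' (r t) * r' t) (at t)"
    if "\<And>x. x \<in> {0..1} \<Longrightarrow> (F has_real_derivative F' x) (at x within {0..1})" for F F' t
  proof -
    have "(F has_real_derivative F' (r t)) (at (r t) within r ` UNIV)"
      by (rule has_field_derivative_subset[OF that[OF r01]]) (use r01 in auto)
    from DERIV_image_chain[OF this dr[of t]] show ?thesis by (simp add: o_def)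
  qed
  define M where "M t = (cos t) ^ 3 *\<^sub>R N X + ((cos t)\<^sup>2 * sin t) *\<^sub>R N1 + (cos t * (sin t)\<^sup>2) *\<^sub>R N2 + (sin t) ^ 3 *\<^sub>R N e" for t
  have Nc: "N (c t) = M t" for t unfolding c_def N_great_circle M_def N1_def N2_def ..
  define M' where "M' t = (- 3 * (cos t)\<^sup>2 * sin t) *\<^sub>R N X + ((cos t) ^ 3 - 2 * cos t * (sin t)\<^sup>2) *\<^sub>R N1
    + (2 * (cos t)\<^sup>2 * sin t - (sin t) ^ 3) *\<^sub>R N2 + (3 * (sin t)\<^sup>2 * cos t) *\<^sub>R N e" for t
  have sc: "((\<lambda>t. p t *\<^sub>R v) has_vector_derivative p' *\<^sub>R v) (at t)"
    if "(p has_real_derivative p') (at t)" for p p' t and v :: 'd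
    using has_vector_derivative_scaleR[OF that has_vector_derivative_const[of v]] by simp
  have dM: "(M has_vector_derivative M' t) (at t)" for t
    unfolding M_def[abs_def] M'_def
    by (intro has_vector_derivative_add sc)
      (auto intro!: derivative_eq_intros simp: power2_eq_square power3_eq_cube algebra_simps)
  have "(M' has_vector_derivative (- 3) *\<^sub>R N X + 0 *\<^sub>R N1 + 2 *\<^sub>R N2 + 0 *\<^sub>R N e) (at 0)"
    unfolding M'_def[abs_def]
    by (intro has_vector_derivative_add sc) (auto intro!: derivative_eq_intros)
  then have dM': "(M' has_vector_derivative 2 *\<^sub>R N2 - 3 *\<^sub>R N X) (at 0)" by simp
  have M0: "M 0 = N X" "M' 0 = N1" by (simp_all add: M_def M'_def)
  define D where "D t = (a (r t) *\<^sub>R M' t + (a1 (r t) * r' t) *\<^sub>R M t, b1 (r t) * r' t)" for t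
  have jm: "join_map a b (c t) = (a (r t) *\<^sub>R M t, b (r t))" for t
    by (simp add: join_map_def rc Nc)
  have chb: "((\<lambda>t. b (r t)) has_vector_derivative b1 (r t) * r' t) (at t)" for t
    using ch[OF da(3), of t] unfolding has_real_derivative_iff_has_vector_derivative .
  have chb1: "((\<lambda>t. b1 (r t) * r' t) has_vector_derivative
      b2 (r 0) * r' 0 * r' 0 + (2 * \<tau> - 2 * \<rho>) * b1 (r 0)) (at 0)"
    using DERIV_mult[OF ch[OF da(4), of 0] dr'] unfolding has_real_derivative_iff_has_vector_derivative .
  have "((\<lambda>t. join_map a b (c t)) has_vector_derivative D t) (at t)" for t
    unfolding jm D_def
    by (intro has_vector_derivative_Pair has_vector_derivative_scaleR ch[OF da(1)] dM chb)
  then have v1: "vector_derivative (\<lambda>t. join_map a b (c t)) (at t) = D t" for t by (rule vector_derivative_at)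
  have "(D has_vector_derivative
      ((a (r 0) *\<^sub>R (2 *\<^sub>R N2 - 3 *\<^sub>R N X) + (a1 (r 0) * r' 0) *\<^sub>R M' 0)
        + ((a1 (r 0) * r' 0) *\<^sub>R M' 0 + (a2 (r 0) * r' 0 * r' 0 + (2 * \<tau> - 2 * \<rho>) * a1 (r 0)) *\<^sub>R M 0),
       b2 (r 0) * r' 0 * r' 0 + (2 * \<tau> - 2 * \<rho>) * b1 (r 0))) (at 0)"
    unfolding D_def[abs_def]
    by (intro has_vector_derivative_Pair has_vector_derivative_add has_vector_derivative_scaleR
        ch[OF da(1)] ch[OF da(2)] DERIV_mult dM dM' dr' chb1)
  moreover have "((a (r 0) *\<^sub>R (2 *\<^sub>R N2 - 3 *\<^sub>R N X) + (a1 (r 0) * r' 0) *\<^sub>R M' 0)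
        + ((a1 (r 0) * r' 0) *\<^sub>R M' 0 + (a2 (r 0) * r' 0 * r' 0 + (2 * \<tau> - 2 * \<rho>) * a1 (r 0)) *\<^sub>R M 0),
       b2 (r 0) * r' 0 * r' 0 + (2 * \<tau> - 2 * \<rho>) * b1 (r 0)) = W"
    unfolding r0 M0 W_def by (simp add: algebra_simps power2_eq_square flip: scaleR_add_left)
  ultimately have "(D has_vector_derivative W) (at 0)" by simp
  then have "vector_derivative D (at 0) = W" by (rule vector_derivative_at)
  then show ?thesis
    unfolding second_fundamental_form_def sphere_acceleration_def Let_def c_def[symmetric] v1 c0 by simp
qed

text \<open>
Every term of the second fundamental form is a bilinear form in \<open>e\<close>, so its sum over \<open>B\<close> is the full trace
minus the value at \<open>X\<close>. The full trace of \<open>N2\<close> vanishes, since \<open>N\<close> is harmonic in \<open>y\<close> and linear in \<open>x\<close>; by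
homogeneity, the values at \<open>X\<close> are multiples of \<open>N(X)\<close>.
\<close>

lemma tension_field_join_map:
  fixes X :: "'a \<times> 'b \<times> 'b"
  assumes dim: "DIM('a) = 2" and X: "norm X = 1" and B: "orthonormal_basis_of (sphere_tangent_space X) B"
    and da: "\<And>x. x \<in> {0..1} \<Longrightarrow> (a has_real_derivative a1 x) (at x within {0..1})"
      "\<And>x. x \<in> {0..1} \<Longrightarrow> (a1 has_real_derivative a2 x) (at x within {0..1})"
      "\<And>x. x \<in> {0..1} \<Longrightarrow> (b has_real_derivative b1 x) (at x within {0..1})"
      "\<And>x. x \<in> {0..1} \<Longrightarrow> (b1 has_real_derivative b2 x) (at x within {0..1})"
  defines "\<rho> \<equiv> lat X" and "k \<equiv> real DIM('b)"
  defines "S \<equiv> ((4 * \<rho> * (1 - \<rho>) * a2 \<rho> + (8 - (4 * k + 16) * \<rho>) * a1 \<rho> - (6 * k + 9) * a \<rho>) *\<^sub>R N X,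
      4 * \<rho> * (1 - \<rho>) * b2 \<rho> + (4 - 4 * (k + 1) * \<rho>) * b1 \<rho>)"
  shows "(\<Sum>e\<in>B. second_fundamental_form (join_map a b) X e) = S - (S \<bullet> join_map a b X) *\<^sub>R join_map a b X"
proof -
  define x where "x = fst X"
  define y where "y = snd X"
  define U where "U = join_map a b X"
  have rho: "x \<bullet> x = \<rho>" by (simp add: \<rho>_def lat_sphere[OF X] x_def)
  have XX: "X \<bullet> X = 1" using X by (simp add: dot_square_norm)
  have NX: "N X = g x (hopf_of_mult f y)" by (simp add: N_def x_def y_def)
  define T0 T1 T2 :: "'a \<times> 'b \<times> 'b \<Rightarrow> 'a \<times> 'b \<times> 'b \<Rightarrow> real"
    where "T0 = (\<lambda>e e'. e \<bullet> e')" and "T1 = (\<lambda>e e'. (x \<bullet> fst e) * (x \<bullet> fst e'))" and "T2 = (\<lambda>e e'. fst e \<bullet> fst e')"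
  define T3 T4 :: "'a \<times> 'b \<times> 'b \<Rightarrow> 'a \<times> 'b \<times> 'b \<Rightarrow> 'd"
    where "T3 = (\<lambda>e e'. (x \<bullet> fst e) *\<^sub>R (g (fst e') (hopf_of_mult f y) + g x (P y (snd e'))))"
      and "T4 = (\<lambda>e e'. g (fst e) (P y (snd e')) + (1/2) *\<^sub>R g x (P (snd e) (snd e')))"
  have bil: "bilinear T0" "bilinear T1" "bilinear T2" "bilinear T3" "bilinear T4"
    unfolding bilinear_def T0_def T1_def T2_def T3_def T4_def
    by (intro conjI allI linearI;
        simp add: inner_add_left inner_add_right g_simps P_simps algebra_simps)+
  note tr = trace_tangent_space(2)[OF _ X B]
  have fin: "finite B" by (rule trace_tangent_space(1)[OF bil(1) X B])
  have eB: "norm e = 1" "e \<bullet> X = 0" if "e \<in> B" for e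
    using B that by (auto simp: orthonormal_basis_of_def sphere_tangent_space_def)
  have s0: "(\<Sum>e\<in>B. T0 e e) = 2 * k + 1"
    unfolding tr[OF bil(1)] using XX dim by (simp add: T0_def k_def)
  have "(\<Sum>e\<in>B. T0 e e) = (\<Sum>e\<in>B. 1)"
    by (rule sum.cong) (auto simp: T0_def dot_square_norm eB)
  then have card: "real (card B) = 2 * k + 1" using s0 by simp
  have s1: "(\<Sum>e\<in>B. T1 e e) = \<rho> - \<rho>\<^sup>2"
    unfolding tr[OF bil(2)] sum_Basis_prod
    by (simp add: T1_def x_def[symmetric] rho power2_eq_square flip: euclidean_inner)
  have s2: "(\<Sum>e\<in>B. T2 e e) = 2 - \<rho>"
    unfolding tr[OF bil(3)] sum_Basis_prod using dim by (simp add: T2_def x_def[symmetric] rho)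
  have s3: "(\<Sum>e\<in>B. T3 e e) = (1 - 3 * \<rho>) *\<^sub>R N X"
    unfolding tr[OF bil(4)] sum_Basis_prod
    by (simp add: T3_def x_def[symmetric] y_def[symmetric] rho P_simps g_simps sum_g_left P_self NX
        algebra_simps flip: scaleR_add_left)
  have s4: "(\<Sum>e\<in>B. T4 e e) = (- 3) *\<^sub>R N X"
  proof -
    have "(\<Sum>j\<in>Basis. (1/2) *\<^sub>R g x (P j j)) = (1/2) *\<^sub>R g x (\<Sum>j\<in>Basis. P j j)"
      by (simp add: sum_g_right flip: scaleR_sum_right)
    then have "(\<Sum>j\<in>Basis. (1/2) *\<^sub>R g x (P j j)) = 0" by (simp add: trace_P g_simps)
    then have "(\<Sum>i\<in>Basis. T4 i i) = 0"
      unfolding sum_Basis_prod[of "\<lambda>i. T4 i i"] by (simp add: T4_def P_simps g_simps)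
    moreover have "T4 X X = 2 *\<^sub>R N X + 1 *\<^sub>R N X"
      by (simp add: T4_def x_def[symmetric] y_def[symmetric] g_simps P_self NX)
    then have "T4 X X = 3 *\<^sub>R N X" unfolding scaleR_add_left[symmetric] by simp
    ultimately show ?thesis unfolding tr[OF bil(5)] by simp
  qed
  define W where "W e = ((4 * a2 \<rho> * T1 e e + a1 \<rho> * (2 * T2 e e - 2 * \<rho>)) *\<^sub>R N X + (4 * a1 \<rho>) *\<^sub>R T3 e e
      + a \<rho> *\<^sub>R (2 *\<^sub>R T4 e e - 3 *\<^sub>R N X), 4 * b2 \<rho> * T1 e e + b1 \<rho> * (2 * T2 e e - 2 * \<rho>))" for e
  have sff: "second_fundamental_form (join_map a b) X e = W e - (W e \<bullet> U) *\<^sub>R U" if "e \<in> B" for e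
  proof -
    have "W e = ((a2 (fst X \<bullet> fst X) * (2 * (fst X \<bullet> fst e))\<^sup>2 + a1 (fst X \<bullet> fst X) * (2 * (fst e \<bullet> fst e) - 2 * (fst X \<bullet> fst X))) *\<^sub>R N X
        + (4 * a1 (fst X \<bullet> fst X) * (fst X \<bullet> fst e)) *\<^sub>R (g (fst e) (hopf_of_mult f (snd X)) + g (fst X) (P (snd X) (snd e)))
        + a (fst X \<bullet> fst X) *\<^sub>R (2 *\<^sub>R (g (fst e) (P (snd X) (snd e)) + g (fst X) (hopf_of_mult f (snd e))) - 3 *\<^sub>R N X),
        b2 (fst X \<bullet> fst X) * (2 * (fst X \<bullet> fst e))\<^sup>2 + b1 (fst X \<bullet> fst X) * (2 * (fst e \<bullet> fst e) - 2 * (fst X \<bullet> fst X)))"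
      unfolding x_def[symmetric] y_def[symmetric] rho W_def T1_def T2_def T3_def T4_def P_self
      by (simp add: power2_eq_square g_simps mult_ac)
    then show ?thesis
      unfolding U_def by (simp only: second_fundamental_form_join_map[OF X eB[OF that] da])
  qed
  have "(\<Sum>e\<in>B. W e) = S"
  proof -
    have "(\<Sum>e\<in>B. (4 * a2 \<rho> * T1 e e + a1 \<rho> * (2 * T2 e e - 2 * \<rho>)))
        = 4 * a2 \<rho> * (\<rho> - \<rho>\<^sup>2) + a1 \<rho> * (2 * (2 - \<rho>) - 2 * \<rho> * (2 * k + 1))"
      for a1 a2 :: "real \<Rightarrow> real"
      unfolding s1[symmetric] s2[symmetric] card[symmetric]
      by (simp add: sum.distrib sum_subtractf sum_distrib_left sum_distrib_right algebra_simps)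
    note c = this
    have d: "(\<Sum>e\<in>B. 2 *\<^sub>R T4 e e - 3 *\<^sub>R N X) = (- (6 * k + 9)) *\<^sub>R N X"
    proof -
      have "(\<Sum>e\<in>B. 2 *\<^sub>R T4 e e - 3 *\<^sub>R N X) = 2 *\<^sub>R (\<Sum>e\<in>B. T4 e e) - real (card B) *\<^sub>R (3 *\<^sub>R N X)"
        by (simp add: sum_subtractf scaleR_sum_right sum_constant_scaleR)
      also have "\<dots> = (- (6 * k + 9)) *\<^sub>R N X" unfolding s4 card by (simp add: algebra_simps flip: scaleR_add_left scaleR_diff_left)
      finally show ?thesis .
    qed
    have "(\<Sum>e\<in>B. W e) = ((4 * a2 \<rho> * (\<rho> - \<rho>\<^sup>2) + a1 \<rho> * (2 * (2 - \<rho>) - 2 * \<rho> * (2 * k + 1))) *\<^sub>R N X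
        + (4 * a1 \<rho>) *\<^sub>R ((1 - 3 * \<rho>) *\<^sub>R N X) + a \<rho> *\<^sub>R ((- (6 * k + 9)) *\<^sub>R N X),
        4 * b2 \<rho> * (\<rho> - \<rho>\<^sup>2) + b1 \<rho> * (2 * (2 - \<rho>) - 2 * \<rho> * (2 * k + 1)))"
      unfolding W_def sum_prod c[symmetric] s3[symmetric] d[symmetric]
      by (simp only: scaleR_sum_left scaleR_sum_right) (simp only: sum.distrib)
    also have "\<dots> = S"
      unfolding S_def by (simp add: power2_eq_square algebra_simps flip: scaleR_add_left scaleR_diff_left)
    finally show ?thesis .
  qed
  moreover have "(\<Sum>e\<in>B. W e - (W e \<bullet> U) *\<^sub>R U) = (\<Sum>e\<in>B. W e) - ((\<Sum>e\<in>B. W e) \<bullet> U) *\<^sub>R U"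
    by (simp add: sum_subtractf inner_sum_left scaleR_sum_left)
  ultimately show ?thesis using sff by (simp add: U_def)
qed

text \<open>
The differential identity states that the ambient tension vector is parallel to the map, hence normal to
the target sphere; its tangential part is the tension field.
\<close>

lemma harmonic_join_map:
  assumes dim: "DIM('a) = 2"
    and aC: "\<And>n. Ck_real n a {0..1}" and bC: "\<And>n. Ck_real n b {0..1}"
    and unit: "\<And>x. x \<in> {0..1} \<Longrightarrow> x * (1 - x)\<^sup>2 * (a x)\<^sup>2 + (b x)\<^sup>2 = 1"
    and eq: "\<And>a1 a2 b1 b2 x. \<lbrakk>\<And>x. x \<in> {0..1} \<Longrightarrow> (a has_real_derivative a1 x) (at x within {0..1});
        \<And>x. x \<in> {0..1} \<Longrightarrow> (a1 has_real_derivative a2 x) (at x within {0..1});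
        \<And>x. x \<in> {0..1} \<Longrightarrow> (b has_real_derivative b1 x) (at x within {0..1});
        \<And>x. x \<in> {0..1} \<Longrightarrow> (b1 has_real_derivative b2 x) (at x within {0..1});
        continuous_on {0..1} a2; continuous_on {0..1} b2; x \<in> {0..1}\<rbrakk> \<Longrightarrow>
      b x * (4 * x * (1 - x) * a2 x + (8 - (4 * real DIM('b) + 16) * x) * a1 x - (6 * real DIM('b) + 9) * a x)
      = a x * (4 * x * (1 - x) * b2 x + (4 - 4 * (real DIM('b) + 1) * x) * b1 x)"
  shows "harmonic_sphere_map (join_map a b)"
proof -
  obtain a1 where a1: "\<And>x. x \<in> {0..1} \<Longrightarrow> (a has_real_derivative a1 x) (at x within {0..1})" "Ck_real (Suc 0) a1 {0..1}"
    using aC[of "Suc (Suc 0)"] by (rule Ck_realE) blast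
  obtain a2 where a2: "\<And>x. x \<in> {0..1} \<Longrightarrow> (a1 has_real_derivative a2 x) (at x within {0..1})" "Ck_real 0 a2 {0..1}"
    using a1(2) by (rule Ck_realE) blast
  obtain b1 where b1: "\<And>x. x \<in> {0..1} \<Longrightarrow> (b has_real_derivative b1 x) (at x within {0..1})" "Ck_real (Suc 0) b1 {0..1}"
    using bC[of "Suc (Suc 0)"] by (rule Ck_realE) blast
  obtain b2 where b2: "\<And>x. x \<in> {0..1} \<Longrightarrow> (b1 has_real_derivative b2 x) (at x within {0..1})" "Ck_real 0 b2 {0..1}"
    using b1(2) by (rule Ck_realE) blast
  show ?thesis unfolding harmonic_sphere_map_def
  proof (intro conjI ballI allI impI)
    show "smooth_map_on (sphere 0 1) (join_map a b)" by (rule join_map_smooth[OF aC bC])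
    show "join_map a b ` sphere 0 1 \<subseteq> sphere 0 1"
    proof (intro image_subsetI)
      fix X :: "'a \<times> 'b \<times> 'b" assume "X \<in> sphere 0 1"
      then show "join_map a b X \<in> sphere 0 1"
        using norm_join_map(2)[of X a b] unit[OF lat_range[of X]] by simp
    qed
    fix X :: "'a \<times> 'b \<times> 'b" and B
    assume "X \<in> sphere 0 1" and B: "orthonormal_basis_of (sphere_tangent_space X) B"
    then have X: "norm X = 1" by simp
    define \<rho> where "\<rho> = lat X"
    define p where "p = 4 * \<rho> * (1 - \<rho>) * a2 \<rho> + (8 - (4 * real DIM('b) + 16) * \<rho>) * a1 \<rho> - (6 * real DIM('b) + 9) * a \<rho>"
    define q where "q = 4 * \<rho> * (1 - \<rho>) * b2 \<rho> + (4 - 4 * (real DIM('b) + 1) * \<rho>) * b1 \<rho>"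
    define n where "n = (norm (N X))\<^sup>2"
    have pq: "b \<rho> * p = a \<rho> * q" unfolding p_def q_def
      by (rule eq[OF a1(1) a2(1) b1(1) b2(1)]) (use a2(2) b2(2) lat_range in \<open>auto simp: \<rho>_def\<close>)
    have u1: "n * (a \<rho>)\<^sup>2 + (b \<rho>)\<^sup>2 = 1"
      using unit[OF lat_range[of X]] norm_join_map(1)[of X a b, OF X unit[OF lat_range[of X]]] by (simp add: n_def \<rho>_def)
    have U: "join_map a b X = (a \<rho> *\<^sub>R N X, b \<rho>)" by (simp add: join_map_def \<rho>_def)
    have i: "(p *\<^sub>R N X, q) \<bullet> (a \<rho> *\<^sub>R N X, b \<rho>) = p * a \<rho> * n + q * b \<rho>"
      by (simp add: n_def power2_norm_eq_inner)
    have e: "(p * a \<rho> * n + q * b \<rho>) * a \<rho> = p" "(p * a \<rho> * n + q * b \<rho>) * b \<rho> = q"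
      using pq u1 by algebra+
    have 0: "(p *\<^sub>R N X, q) - ((p *\<^sub>R N X, q) \<bullet> join_map a b X) *\<^sub>R join_map a b X = 0"
      unfolding U i scaleR_Pair diff_Pair scaleR_scaleR real_scaleR_def e by (simp add: zero_prod_def)
    have "(\<Sum>e\<in>B. second_fundamental_form (join_map a b) X e)
        = (p *\<^sub>R N X, q) - ((p *\<^sub>R N X, q) \<bullet> join_map a b X) *\<^sub>R join_map a b X"
      unfolding p_def q_def \<rho>_def
      by (rule tension_field_join_map[OF dim X B a1(1) a2(1) b1(1) b2(1)])
    then show "(\<Sum>e\<in>B. second_fundamental_form (join_map a b) X e) = 0" using 0 by (rule trans)
  qed
qed

end

section \<open>The homotopy\<close>

text \<open>
The segment between two points of the sphere that are not antipodal avoids the origin and can be projected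
radially.
\<close>

lemma homotopic_if_not_antipodal:
  fixes F U :: "'a::topological_space \<Rightarrow> 'b::euclidean_space"
  assumes "continuous_on S F" "continuous_on S U"
    and F: "\<And>x. x \<in> S \<Longrightarrow> norm (F x) = 1" and U: "\<And>x. x \<in> S \<Longrightarrow> norm (U x) = 1"
    and ne: "\<And>x. x \<in> S \<Longrightarrow> F x \<noteq> - U x"
  shows "homotopic_with_canon (\<lambda>_. True) S (sphere 0 1) F U"
proof -
  have seg: "closed_segment (F x) (U x) \<subseteq> - {0}" if x: "x \<in> S" for x
  proof
    fix z assume "z \<in> closed_segment (F x) (U x)"
    then obtain t where t: "0 \<le> t" "t \<le> 1" "z = (1 - t) *\<^sub>R F x + t *\<^sub>R U x" by (auto simp: in_segment)
    show "z \<in> - {0}"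
    proof (rule ccontr)
      assume "z \<notin> - {0}"
      then have e: "(1 - t) *\<^sub>R F x = - (t *\<^sub>R U x)" using t(3) by (simp add: eq_neg_iff_add_eq_0)
      then have "norm ((1 - t) *\<^sub>R F x) = norm (t *\<^sub>R U x)" by simp
      then have "t = 1/2" using t(1,2) F[OF x] U[OF x] by simp
      then have "(1/2) *\<^sub>R F x = - ((1/2) *\<^sub>R U x)" using e by (simp only:) simp
      from arg_cong[OF this, of "\<lambda>v. 2 *\<^sub>R v"] have "F x = - U x" by simp
      then show False using ne[OF x] by simp
    qed
  qed
  have "homotopic_with_canon (\<lambda>_. True) S (- {0}) F U"
    by (rule homotopic_with_linear[OF assms(1,2) seg])
  then have "homotopic_with_canon (\<lambda>_. True) S (sphere 0 1) (sgn \<circ> F) (sgn \<circ> U)"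
    by (rule homotopic_with_compose_continuous_left)
      (auto intro!: continuous_intros simp: norm_sgn)
  then show ?thesis
    by (rule homotopic_with_eq) (auto simp: sgn_div_norm F U)
qed

context hopf_join
begin

text \<open>
Extends \<open>|y| H(y/|y|)\<close> continuously by \<open>0\<close>, which makes the Hopf construction visibly continuous where \<open>y\<close>
vanishes.
\<close>

definition hopf_unit :: "'b \<times> 'b \<Rightarrow> 'c \<times> real" where
  "hopf_unit y = inverse (norm y) *\<^sub>R hopf_of_mult f y"

lemma norm_hopf_unit: "norm (hopf_unit y) = norm y"
  by (cases "y = 0") (simp_all add: hopf_unit_def norm_hopf power2_eq_square)

lemma continuous_hopf_unit: "continuous_on UNIV hopf_unit"
  unfolding continuous_on_eq_continuous_within
proof
  fix y :: "'b \<times> 'b"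
  have bbf: "bounded_bilinear f" using bf bilinear_conv_bounded_bilinear by blast
  show "isCont hopf_unit y"
  proof (cases "y = 0")
    case True
    have "(hopf_unit \<longlongrightarrow> 0) (at 0)"
      by (rule Lim_null_comparison[of _ norm]) (auto simp: norm_hopf_unit tendsto_norm_zero)
    then show ?thesis using True norm_hopf_unit[of 0] by (simp add: isCont_def)
  next
    case False
    then show ?thesis unfolding hopf_unit_def[abs_def] hopf_eq
      by (intro continuous_intros bounded_bilinear.continuous[OF bbf]) auto
  qed
qed

lemma hopf_construction_eq:
  assumes h: "\<And>x y. norm x = 1 \<Longrightarrow> norm y = 1 \<Longrightarrow> h x y = g x (hopf_of_mult f y)"
  shows "hopf_construction h X = (2 *\<^sub>R g (fst X) (hopf_unit (snd X)), (norm (fst X))\<^sup>2 - (norm (snd X))\<^sup>2)"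
proof (cases "fst X = 0 \<or> snd X = 0")
  case True
  moreover have "hopf_unit 0 = 0" using norm_hopf_unit[of 0] by simp
  ultimately show ?thesis by (auto simp: hopf_construction_def case_prod_unfold g_simps)
next
  case False
  then have n: "norm (sgn (fst X)) = 1" "norm (sgn (snd X)) = 1" by (auto simp: norm_sgn)
  have "hopf_of_mult f (sgn (snd X)) = (inverse (norm (snd X)))\<^sup>2 *\<^sub>R hopf_of_mult f (snd X)"
    using hopf_expand[of "inverse (norm (snd X))" "snd X" 0 0] by (simp add: sgn_div_norm)
  then have "h (sgn (fst X)) (sgn (snd X)) = (inverse (norm (fst X)) * (inverse (norm (snd X)))\<^sup>2) *\<^sub>R N X"
    unfolding h[OF n] by (simp add: sgn_div_norm g_simps N_def mult.commute)
  moreover have "g (fst X) (hopf_unit (snd X)) = inverse (norm (snd X)) *\<^sub>R N X"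
    by (simp add: hopf_unit_def g_simps N_def)
  ultimately show ?thesis
    using False by (simp add: hopf_construction_def case_prod_unfold power2_eq_square field_simps)
qed

text \<open>
Both maps have first component a nonnegative multiple of \<open>N\<close>. Antipodal values would therefore force
\<open>N = 0\<close>, that is \<open>\<rho> = 0\<close> or \<open>\<rho> = 1\<close>, and there the two maps agree.
\<close>

lemma homotopic_join_map:
  assumes h: "\<And>x y. norm x = 1 \<Longrightarrow> norm y = 1 \<Longrightarrow> h x y = g x (hopf_of_mult f y)"
    and ab: "\<And>n. Ck_real n a {0..1}" "\<And>n. Ck_real n b {0..1}"
    and unit: "\<And>x. x \<in> {0..1} \<Longrightarrow> x * (1 - x)\<^sup>2 * (a x)\<^sup>2 + (b x)\<^sup>2 = 1"
    and ends: "b 0 = - 1" "b 1 = 1" and pos: "\<And>x. 0 < x \<Longrightarrow> x < 1 \<Longrightarrow> 0 < a x"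
  shows "homotopic_with_canon (\<lambda>_. True) (sphere 0 1) (sphere 0 1) (hopf_construction h) (join_map a b)"
proof (rule homotopic_if_not_antipodal)
  have bbg: "bounded_bilinear g" using bg bilinear_conv_bounded_bilinear by blast
  have Fe: "hopf_construction h = (\<lambda>X. (2 *\<^sub>R g (fst X) (hopf_unit (snd X)), (norm (fst X))\<^sup>2 - (norm (snd X))\<^sup>2))"
    using hopf_construction_eq[OF h] by (rule ext)
  show "continuous_on (sphere 0 1) (hopf_construction h)"
    unfolding Fe by (intro continuous_intros bounded_bilinear.continuous_on[OF bbg]
        continuous_on_compose2[OF continuous_hopf_unit]) auto
  have o: "open (- {0 :: 'a \<times> 'b \<times> 'b})" by auto
  have "continuous_on (- {0}) (join_map a b)"
  proof -
    have l: "continuous_on (- {0}) lat" using Ck_on_lat[of 0] by simp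
    have N: "continuous_on (- {0}) N" using Ck_on_N[OF o, of 0] by simp
    have c: "continuous_on (- {0 :: 'a \<times> 'b \<times> 'b}) (\<lambda>X. F (lat X))" if "Ck_real 0 F {0..1}" for F
      by (rule continuous_on_compose2[of "{0..1}" F]) (use that l lat_range in auto)
    show ?thesis unfolding join_map_def[abs_def] by (intro continuous_intros c ab N)
  qed
  then show "continuous_on (sphere 0 1) (join_map a b)" by (rule continuous_on_subset) auto
  fix X :: "'a \<times> 'b \<times> 'b" assume "X \<in> sphere 0 1"
  then have X: "norm X = 1" by simp
  define \<rho> where "\<rho> = lat X"
  have nu: "(norm (fst X))\<^sup>2 = \<rho>" by (simp add: \<rho>_def lat_sphere[OF X] power2_norm_eq_inner)
  have nuv: "(norm (fst X))\<^sup>2 + (norm (snd X))\<^sup>2 = 1" using X by (simp add: norm_prod_def)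
  then have nv: "(norm (snd X))\<^sup>2 = 1 - \<rho>" using nu by simp
  show "norm (join_map a b X) = 1" by (rule norm_join_map(2)[of X a b, OF X unit[OF lat_range[of X]]])
  have "(norm (hopf_construction h X))\<^sup>2 = (2 * (norm (fst X) * norm (snd X)))\<^sup>2 + ((norm (fst X))\<^sup>2 - (norm (snd X))\<^sup>2)\<^sup>2"
    unfolding Fe by (simp add: norm_Pair ng norm_hopf_unit power_mult_distrib)
  also have "\<dots> = ((norm (fst X))\<^sup>2 + (norm (snd X))\<^sup>2)\<^sup>2" by (simp add: power2_eq_square algebra_simps)
  finally have "(norm (hopf_construction h X))\<^sup>2 = 1\<^sup>2" unfolding nuv .
  then show "norm (hopf_construction h X) = 1" by (rule power2_eq_imp_eq) auto
  show "hopf_construction h X \<noteq> - join_map a b X"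
  proof
    assume "hopf_construction h X = - join_map a b X"
    then have e1: "2 *\<^sub>R g (fst X) (hopf_unit (snd X)) = - (a \<rho> *\<^sub>R N X)" and e2: "\<rho> - (1 - \<rho>) = - b \<rho>"
      unfolding Fe nu nv by (auto simp: join_map_def \<rho>_def)
    have "\<rho> \<in> {0..1}" unfolding \<rho>_def by (rule lat_range)
    moreover have "\<rho> \<noteq> 0" "\<rho> \<noteq> 1" using e2 ends by auto
    ultimately have r: "0 < \<rho>" "\<rho> < 1" by auto
    have "(norm (N X))\<^sup>2 = \<rho> * (1 - \<rho>)\<^sup>2"
      using norm_join_map(1)[of X a b, OF X unit[OF lat_range[of X]]] by (simp add: \<rho>_def)
    then have "N X \<noteq> 0" using r by auto
    moreover have "g (fst X) (hopf_unit (snd X)) = inverse (norm (snd X)) *\<^sub>R N X"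
      by (simp add: hopf_unit_def g_simps N_def)
    then have "(2 * inverse (norm (snd X)) + a \<rho>) *\<^sub>R N X = 0" using e1 by (simp add: scaleR_add_left)
    ultimately have "2 * inverse (norm (snd X)) + a \<rho> = 0" by simp
    moreover have "0 \<le> inverse (norm (snd X))" by simp
    ultimately show False using pos[OF r] by linarith
  qed
qed

end

theorem corollary1p2:
  fixes q :: nat
    and f :: "real ^ 'k \<Rightarrow> real ^ 'k \<Rightarrow> real ^ 'n"
    and g :: "real ^ 2 \<Rightarrow> (real ^ 'n) \<times> real \<Rightarrow> (real ^ 'm) \<times> real"
    and \<phi> :: "real ^ 2 \<Rightarrow> real ^ 2"
    and \<psi> :: "(real ^ 'k) \<times> (real ^ 'k) \<Rightarrow> (real ^ 'n) \<times> real"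
  assumes "q > 2" and "even q" and "CARD('k) = q div 2"
    and "orthogonal_multiplication f"
    and "orthogonal_multiplication g"
    and "\<forall>x\<in>sphere 0 1. \<phi> x = x"
    and "\<forall>z\<in>sphere 0 1. \<psi> z = hopf_of_mult f z"
  shows "\<exists>u :: (real ^ 2) \<times> ((real ^ 'k) \<times> (real ^ 'k)) \<Rightarrow> ((real ^ 'm) \<times> real) \<times> real.
           harmonic_sphere_map u \<and>
           homotopic_with_canon (\<lambda>_. True) (sphere 0 1) (sphere 0 1)
             (hopf_construction (\<lambda>x y. g (\<phi> x) (\<psi> y))) u"
proof -
  interpret profile_ode "CARD('k)"
    by unfold_locales (use assms(1-3) in presburger)
  interpret hopf_join f g
    by unfold_locales (rule assms)+
  obtain a b :: "real \<Rightarrow> real" where ab: "\<And>n. Ck_real n a {0..1}" "\<And>n. Ck_real n b {0..1}"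
    and unit: "\<And>x. x \<in> {0..1} \<Longrightarrow> x * (1 - x)\<^sup>2 * (a x)\<^sup>2 + (b x)\<^sup>2 = 1"
    and ends: "b 0 = - 1" "b 1 = 1" and pos: "\<And>x. 0 < x \<Longrightarrow> x < 1 \<Longrightarrow> 0 < a x"
    and eq: "\<And>a1 a2 b1 b2 x. \<lbrakk>\<And>x. x \<in> {0..1} \<Longrightarrow> (a has_real_derivative a1 x) (at x within {0..1});
        \<And>x. x \<in> {0..1} \<Longrightarrow> (a1 has_real_derivative a2 x) (at x within {0..1});
        \<And>x. x \<in> {0..1} \<Longrightarrow> (b has_real_derivative b1 x) (at x within {0..1});
        \<And>x. x \<in> {0..1} \<Longrightarrow> (b1 has_real_derivative b2 x) (at x within {0..1});
        continuous_on {0..1} a2; continuous_on {0..1} b2; x \<in> {0..1}\<rbrakk> \<Longrightarrow>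
      b x * (4 * x * (1 - x) * a2 x + (8 - (4 * real CARD('k) + 16) * x) * a1 x - (6 * real CARD('k) + 9) * a x)
      = a x * (4 * x * (1 - x) * b2 x + (4 - 4 * (real CARD('k) + 1) * x) * b1 x)"
    by (rule profile_exists) blast
  have dim: "DIM(real ^ 'k) = CARD('k)" by simp
  have "harmonic_sphere_map (join_map a b)"
  proof (rule harmonic_join_map[OF _ ab unit])
    fix a1 a2 b1 b2 :: "real \<Rightarrow> real" and x :: real
    assume h: "\<And>x. x \<in> {0..1} \<Longrightarrow> (a has_real_derivative a1 x) (at x within {0..1})"
      "\<And>x. x \<in> {0..1} \<Longrightarrow> (a1 has_real_derivative a2 x) (at x within {0..1})"
      "\<And>x. x \<in> {0..1} \<Longrightarrow> (b has_real_derivative b1 x) (at x within {0..1})"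
      "\<And>x. x \<in> {0..1} \<Longrightarrow> (b1 has_real_derivative b2 x) (at x within {0..1})"
      "continuous_on {0..1} a2" "continuous_on {0..1} b2" "x \<in> {0..1}"
    show "b x * (4 * x * (1 - x) * a2 x + (8 - (4 * real DIM(real ^ 'k) + 16) * x) * a1 x
        - (6 * real DIM(real ^ 'k) + 9) * a x)
      = a x * (4 * x * (1 - x) * b2 x + (4 - 4 * (real DIM(real ^ 'k) + 1) * x) * b1 x)"
      unfolding dim by (rule eq[OF h])
  qed simp
  moreover have "homotopic_with_canon (\<lambda>_. True) (sphere 0 1) (sphere 0 1)
      (hopf_construction (\<lambda>x y. g (\<phi> x) (\<psi> y))) (join_map a b)"
    by (rule homotopic_join_map[OF _ ab unit ends pos]) (use assms(6,7) in auto)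
  ultimately show ?thesis by blast
qed

end
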